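(* Let $\xi \in \mathcal{D}_1$ and let $N$, $M$ be arbitrary non-negative integers. Let $\lambda$ and $\nu$ be complex numbers satisfying $\left|\Re\lambda - \frac{1}{2}\right| <\min \left( N + \frac{1}{2},M + \frac{1}{2} \right)$ and $\Re\nu > \max \left( N - \Re\lambda ,M - \Re\lambda \right)$. Then there exist remainder terms $R_N^{(C1)} (\xi ,\lambda ,\nu )$ and $R_M^{(C2)} (\xi ,\lambda ,\nu )$ such that $$\begin{aligned} C_\nu ^{(\lambda )} (\cosh \xi ) = \;& \frac{e^{\xi (\nu + \lambda )} }{\Gamma (\lambda )(2\sinh \xi )^\lambda }\left( \sum_{n = 0}^{N - 1} a_n \left( \lambda - \tfrac{1}{2} \right)\frac{\Gamma (\nu + \lambda -n)}{\Gamma (\nu+1)}\left( \frac{-e^{ - \xi } }{\sinh \xi } \right)^n+ R_N^{(C1)} (\xi ,\lambda ,\nu ) \right)\\ & + K(\xi ,\lambda )\frac{e^{ - \xi (\nu + \lambda )} }{\Gamma (\lambda )(2\sinh \xi )^\lambda }\left( \sum_{m = 0}^{M - 1} a_m\left( \lambda - \tfrac{1}{2} \right)\frac{\Gamma (\nu + \lambda - m)}{\Gamma (\nu + 1)}\left( \frac{e^\xi }{\sinh \xi } \right)^m + R_M^{(C2)} (\xi ,\lambda ,\nu ) \right),\end{aligned}$$ and the remainder terms satisfy the estimates $$\begin{aligned}\left| R_N^{(C1)} (\xi ,\lambda ,\nu ) \right| \le \; & \left|\frac{\sin (\pi \lambda )}{\sin (\pi \Re\lambda )}\right|\left| a_N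 \left(\Re\lambda - \tfrac{1}{2} \right) \right| \frac{\Gamma \left( \Re\nu+\Re\lambda - N \right)}{|\Gamma (\nu + 1)|} \left| \frac{e^{ - \xi } }{\sinh \xi } \right|^N \\ & \times \begin{cases} 1 & \text{if } \Re (e^{2\xi } ) \le 1, \\ \min\left(\left| 1 - e^{ - 2\xi } \right|\left| \csc (2\Im\xi ) \right|,\,1 + \chi\left(N+\tfrac{1}{2}\right)\right) & \text{if } \Re (e^{2\xi } ) > 1, \end{cases}\end{aligned}$$ and $$\left| R_M^{(C2)} (\xi ,\lambda ,\nu ) \right| \le \left|\frac{\sin (\pi \lambda )}{\sin (\pi \Re\lambda )}\right|\left|a_M \left(\Re\lambda - \tfrac{1}{2} \right)\right|\frac{\Gamma \left( \Re\nu+\Re\lambda - M \right)}{|\Gamma (\nu + 1)|} \left| \frac{e^\xi}{\sinh \xi } \right|^M .$$ If $\Re\lambda $ is an integer, then the limiting values have to be taken in these bounds. The fractional powers are positive for positive real $\xi$ (and real exponent) and are defined by continuity elsewhere. In addition, $R_M^{(C2)} (\xi ,\lambda,\nu)$ does not exceed the corresponding first neglected term $a_M(\lambda-\frac12)\frac{\Gamma(\nu+\lambda-M)}{\Gamma(\nu+1)}\left(\frac{e^\xi}{\sinh\xi}\right)^M$ in absolute value and has the same sign, provided that $\xi$ is positive, $\lambda$ and $\nu$ are real, $\left| \lambda - \frac{1}{2}\right| <M + \frac{1}{2}$ and $\nu > M - \lambda$.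
   Context: $\mathcal{D}_1=\{\xi\in\mathbb{C} : \Re \xi>0,\ |\Im \xi |<\pi\}$; $\cosh$ maps $\mathcal{D}_1$ biholomorphically onto $\mathbb{C}\setminus(-\infty,1]$. The Gegenbauer function is defined for $z\in\mathbb{C}\setminus(-\infty,1]$ by $$C_\nu ^{(\lambda )} (z) = \frac{\sqrt\pi\, \Gamma (\nu + 2\lambda )}{\Gamma (\lambda )\Gamma (\nu + 1)\left(2\sqrt{z^2-1}\right)^{\lambda - \frac{1}{2}} }P_{\nu + \lambda - \frac{1}{2}}^{\frac{1}{2} - \lambda } (z),$$ where $P_\nu ^\mu (z) = \left(\frac{z + 1}{z - 1}\right)^{\mu /2}\mathbf{F}\left(\nu+1,-\nu;1-\mu;\frac{1-z}{2}\right)$ is the associated Legendre function (powers positive-based for $z>1$, continued by analyticity; $\sqrt{z^2-1}=\sinh\xi$ for $z=\cosh\xi$) and $\mathbf{F}(a,b;c;w)=\sum_{n\ge 0}\frac{(a)_n(b)_n}{\Gamma(c+n)\,n!}w^n$ ($|w|<1$), continued analytically to $\mathbb{C}\setminus[1,+\infty)$, is the regularised hypergeometric function. $1/\Gamma$ is $0$ at the poles of $\Gamma$. $a_n (\mu ) = \frac{(4\mu ^2 - 1^2 )(4\mu ^2 - 3^2 ) \cdots (4\mu ^2 - (2n - 1)^2 )}{8^n n!}$. $K(\xi ,\lambda ) = \cos (\pi \lambda )$ if $\xi > 0$, and $K(\xi,\lambda)=e^{ \pm \pi i\lambda }$ if $0<\pm \Im\xi < \pi$. $\chi(p)= \frac{\sqrt\pi\,\Gamma\left(\frac{p}{2}+1\right)}{\Gamma\left(\frac{p}{2}+\frac{1}{2}\right)}$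 for $p>0$. "Limiting value" means that $|a_k(\Re\lambda-\frac12)|/|\sin(\pi\Re\lambda)|$ is replaced by $\lim_{x\to\Re\lambda}|a_k(x-\frac12)|/|\sin(\pi x)|$. When $\sin(2\Im\xi)=0$, $|\csc(2\Im\xi)|$ is read as $+\infty$. *)

theory Defs
  imports "HOL-Analysis.Analysis"
begin

definition D1 :: "complex set" where
  "D1 = {\<xi>. Re \<xi> > 0 \<and> \<bar>Im \<xi>\<bar> < pi}"

definition hyp_series :: "complex \<Rightarrow> complex \<Rightarrow> complex \<Rightarrow> complex \<Rightarrow> complex" where
  "hyp_series a b c w =
     (\<Sum>n. pochhammer a n * pochhammer b n * rGamma (c + of_nat n) / fact n * w ^ n)"

text \<open>The value at \<open>w\<close> of the analytic continuation of the series from the unit disc to the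
  plane cut along \<open>[1, \<infinity>)\<close>; for \<open>w\<close> in the cut plane it is unique because the cut plane is
  connected.\<close>

definition reg_hyp2F1 :: "complex \<Rightarrow> complex \<Rightarrow> complex \<Rightarrow> complex \<Rightarrow> complex" where
  "reg_hyp2F1 a b c w =
     (THE y. \<exists>f. f holomorphic_on (- complex_of_real ` {1..}) \<and>
                 (\<forall>v. norm v < 1 \<longrightarrow> f v = hyp_series a b c v) \<and> f w = y)"

text \<open>For \<open>z\<close> outside \<open>(-\<infinity>, 1]\<close> the base \<open>(z + 1) / (z - 1)\<close> avoids \<open>(-\<infinity>, 0]\<close>, so the
  principal power is the analytic continuation of the positive-based one.\<close>

definition legendre_P :: "complex \<Rightarrow> complex \<Rightarrow> complex \<Rightarrow> complex" where
  "legendre_P \<mu> \<nu> z =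
     ((z + 1) / (z - 1)) powr (\<mu> / 2) * reg_hyp2F1 (\<nu> + 1) (- \<nu>) (1 - \<mu>) ((1 - z) / 2)"

text \<open>The branch of the square root of \<open>z\<^sup>2 - 1\<close> that is analytic off \<open>(-\<infinity>, 1]\<close> and positive for
  \<open>z > 1\<close>, so that it equals \<open>sinh \<xi>\<close> at \<open>z = cosh \<xi>\<close>, \<open>\<xi> \<in> D1\<close>. The principal value
  \<open>csqrt (z\<^sup>2 - 1)\<close> would have the wrong sign for \<open>Re z < 0\<close>. The values of the product avoid
  \<open>(-\<infinity>, 0]\<close>, so principal powers of it are again the analytic continuations.\<close>

definition sqrt_z2m1 :: "complex \<Rightarrow> complex" where
  "sqrt_z2m1 z = csqrt (z - 1) * csqrt (z + 1)"

definition gegenbauer_C :: "complex \<Rightarrow> complex \<Rightarrow> complex \<Rightarrow> complex" where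
  "gegenbauer_C lam \<nu> z =
     of_real (sqrt pi) * Gamma (\<nu> + 2 * lam) * rGamma lam * rGamma (\<nu> + 1)
       / (2 * sqrt_z2m1 z) powr (lam - 1 / 2)
       * legendre_P (1 / 2 - lam) (\<nu> + lam - 1 / 2) z"

definition acoef :: "nat \<Rightarrow> 'a::field_char_0 \<Rightarrow> 'a" where
  "acoef n \<mu> = (\<Prod>k=1..n. 4 * \<mu>\<^sup>2 - (2 * of_nat k - 1)\<^sup>2) / (8 ^ n * fact n)"

definition Kfac :: "complex \<Rightarrow> complex \<Rightarrow> complex" where
  "Kfac \<xi> lam =
     (if Im \<xi> = 0 then cos (of_real pi * lam)
      else if Im \<xi> > 0 then exp (of_real pi * \<i> * lam)
      else exp (- (of_real pi * \<i> * lam)))"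

definition chi :: "real \<Rightarrow> real" where
  "chi p = sqrt pi * Gamma (p / 2 + 1) / Gamma (p / 2 + 1 / 2)"

definition acoef_over_sin :: "nat \<Rightarrow> real \<Rightarrow> real" where
  "acoef_over_sin k x =
     (if x \<in> \<int> then Lim (at x) (\<lambda>t. \<bar>acoef k (t - 1 / 2)\<bar> / \<bar>sin (pi * t)\<bar>)
      else \<bar>acoef k (x - 1 / 2)\<bar> / \<bar>sin (pi * x)\<bar>)"

text \<open>The branch \<open>sin (2 * Im \<xi>) = 0\<close> is the one where the cosecant is \<open>+\<infinity>\<close>, so that the minimum
  is its second argument.\<close>

definition C1_factor :: "nat \<Rightarrow> complex \<Rightarrow> real" where
  "C1_factor N \<xi> =
     (if Re (exp (2 * \<xi>)) \<le> 1 then 1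
      else if sin (2 * Im \<xi>) = 0 then 1 + chi (real N + 1 / 2)
      else min (norm (1 - exp (- 2 * \<xi>)) * \<bar>1 / sin (2 * Im \<xi>)\<bar>) (1 + chi (real N + 1 / 2)))"

end

theory Submission
  imports Defs "HOL-Complex_Analysis.Complex_Analysis"
begin

text \<open>Put \<open>\<alpha> = \<nu> + \<lambda>\<close>, \<open>\<mu> = \<lambda> - 1/2\<close>, \<open>\<kappa> = \<alpha> + 1/2\<close>, \<open>w\<^sub>1 = 1 / (1 - e\<^bsup>2\<xi>\<^esup>)\<close>, \<open>w\<^sub>2 = 1 / (1 - e\<^bsup>-2\<xi>\<^esup>)\<close>
  and \<open>Q(w) = \<Gamma>(\<kappa>) / (2 \<surd>\<pi>) w\<^sup>\<alpha> \<integral> (w + sinh\<^sup>2 (\<eta>/2))\<^bsup>-\<kappa>\<^esup> e\<^bsup>-\<mu>\<eta>\<^esup> d\<eta>\<close>, integrated over the real line.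
  Off the real axis, up to the common prefactor, the Gegenbauer function is
  \<open>e\<^bsup>\<xi>\<alpha>\<^esup> Q(w\<^sub>1) + K e\<^bsup>-\<xi>\<alpha>\<^esup> Q(w\<^sub>2)\<close>. For \<open>\<xi> = i\<theta>\<close> and \<open>0 < Re \<alpha> < 1/2\<close> this follows by shifting the two
  contours by \<open>\<plusminus> i\<pi>/2\<close>, which turns \<open>Q(w\<^sub>1)\<close> and \<open>Q(w\<^sub>2)\<close> into combinations of the same two real
  integrals, one of which cancels while the other is Euler's integral; the general case follows by analytic continuation.

  Expanding \<open>cosh (\<mu>\<eta>) / cosh (\<eta>/2)\<close> in powers of \<open>sinh\<^sup>2 (\<eta>/2)\<close> with an integral remainder yields
  the expansion of \<open>Q(w)\<close> in powers of \<open>2w\<close>, and \<open>2w\<^sub>1 = - e\<^bsup>-\<xi>\<^esup> / sinh \<xi>\<close>, \<open>2w\<^sub>2 = e\<^bsup>\<xi>\<^esup> / sinh \<xi>\<close>. The remainder is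
  an average of \<open>\<Lambda>(c) = \<integral>\<^sub>0\<^sup>\<infinity> v\<^bsup>N-1/2\<^esup> e\<^bsup>-v\<^esup> / (1 + cv) dv\<close> over positive multiples \<open>c\<close> of \<open>w\<close>, so that
  bounding \<open>|\<Lambda>(c)|\<close> in terms of \<open>arg c\<close> alone gives the error bounds. On the real axis \<open>w\<^sub>1\<close> lies on the cut of
  \<open>Q\<close>, and the first remainder is the mean of its limits from above and below.\<close>

section \<open>Parameter integrals\<close>

lemma norm_deriv_le_half_ball:
  fixes f :: "complex \<Rightarrow> complex"
  assumes hol: "f holomorphic_on ball a d" and bound: "\<And>z. z \<in> ball a d \<Longrightarrow> norm (f z) \<le> B"
    and d: "d > 0" and w: "w \<in> ball a (d / 2)"
  shows "norm (deriv f w) \<le> B / (d / 2)"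
proof -
  have sub: "cball w (d / 2) \<subseteq> ball a d"
  proof
    fix u assume "u \<in> cball w (d / 2)"
    thus "u \<in> ball a d" using w dist_triangle[of a u w] by simp
  qed
  have "norm ((deriv ^^ 1) f w) \<le> fact 1 * B / (d / 2) ^ 1"
  proof (rule Cauchy_inequality)
    show "continuous_on (cball w (d / 2)) f"
      using holomorphic_on_subset[OF hol sub] by (rule holomorphic_on_imp_continuous_on)
    show "f holomorphic_on ball w (d / 2)"
      by (rule holomorphic_on_subset[OF hol]) (use sub ball_subset_cball in blast)
    show "norm (f u) \<le> B" if "norm (w - u) = d / 2" for u
      using that by (intro bound subsetD[OF sub]) (simp add: dist_norm)
  qed (use d in simp)
  thus ?thesis by simp
qed

lemma norm_difference_quotient_le:
  fixes f :: "complex \<Rightarrow> complex"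
  assumes hol: "f holomorphic_on ball a d" and bound: "\<And>z. z \<in> ball a d \<Longrightarrow> norm (f z) \<le> B"
    and z: "z \<in> ball a (d / 2)"
  shows "norm ((f z - f a) / (z - a)) \<le> B / (d / 2)"
proof (cases "z = a")
  case False
  have d: "d > 0" using z zero_le_dist[of a z] unfolding mem_ball by linarith
  have "norm (f z - f a) \<le> B / (d / 2) * norm (z - a)"
  proof (rule field_differentiable_bound[OF convex_ball _ norm_deriv_le_half_ball[OF hol bound d] z])
    fix w assume "w \<in> ball a (d / 2)"
    hence "w \<in> ball a d" using d by simp
    thus "(f has_field_derivative deriv f w) (at w within ball a (d / 2))"
      by (rule has_field_derivative_at_within[OF holomorphic_derivI[OF hol open_ball]])
  qed (use d in auto)
  thus ?thesis using False by (simp add: norm_divide field_simps)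
next
  case True
  hence "norm (f a) \<le> B" "d > 0" using bound[of a] z by auto
  moreover from this have "B \<ge> 0" by (meson norm_ge_zero order_trans)
  ultimately show ?thesis using True by simp
qed

lemma has_field_derivative_integral:
  fixes f :: "complex \<Rightarrow> 'a \<Rightarrow> complex"
  assumes d: "d > 0" and meas: "\<And>z. z \<in> ball a d \<Longrightarrow> f z \<in> borel_measurable M"
    and hol: "\<And>x. x \<in> space M \<Longrightarrow> (\<lambda>z. f z x) holomorphic_on ball a d"
    and h: "integrable M h"
    and bound: "\<And>z x. z \<in> ball a d \<Longrightarrow> x \<in> space M \<Longrightarrow> norm (f z x) \<le> h x"
  shows "((\<lambda>z. \<integral>x. f z x \<partial>M) has_field_derivative (\<integral>x. deriv (\<lambda>z. f z x) a \<partial>M)) (at a)"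
proof -
  have "((\<lambda>z. \<integral>x. f z x \<partial>M) has_field_derivative (\<integral>x. deriv (\<lambda>z. f z x) a \<partial>M)) (at a within ball a (d / 2))"
    unfolding has_field_derivative_iff tendsto_at_iff_sequentially
  proof (intro allI impI)
    fix Z assume "\<forall>i. Z i \<in> ball a (d / 2) - {a}" and lim: "Z \<longlonglongrightarrow> a"
    hence Z_half: "Z i \<in> ball a (d / 2)" and Z_ne: "Z i \<noteq> a" for i by auto
    have Z: "Z i \<in> ball a d" for i using Z_half[of i] d by simp
    have a: "a \<in> ball a d" using d by simp
    define quot where "quot i x = (f (Z i) x - f a x) / (Z i - a)" for i x
    have quot_meas: "quot i \<in> borel_measurable M" for i
      unfolding quot_def using meas[OF a] meas[OF Z[of i]] by measurable
    have quot_lim: "(\<lambda>i. quot i x) \<longlonglongrightarrow> deriv (\<lambda>z. f z x) a" if x: "x \<in> space M" for x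
    proof -
      have "((\<lambda>z. (f z x - f a x) / (z - a)) \<longlongrightarrow> deriv (\<lambda>z. f z x) a) (at a)"
        using holomorphic_derivI[OF hol[OF x] open_ball a] unfolding has_field_derivative_iff .
      thus ?thesis using Z_ne lim unfolding tendsto_at_iff_sequentially by (auto simp: o_def quot_def)
    qed
    have "(\<lambda>i. \<integral>x. quot i x \<partial>M) \<longlonglongrightarrow> (\<integral>x. deriv (\<lambda>z. f z x) a \<partial>M)"
    proof (rule integral_dominated_convergence[where w = "\<lambda>x. h x / (d / 2)"])
      show "(\<lambda>x. deriv (\<lambda>z. f z x) a) \<in> borel_measurable M"
        using quot_meas quot_lim by (rule borel_measurable_LIMSEQ_metric)
      show "AE x in M. norm (quot i x) \<le> h x / (d / 2)" for i unfolding quot_def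
        by (intro AE_I2 norm_difference_quotient_le[OF hol bound Z_half])
    qed (use quot_meas quot_lim h in auto)
    moreover have "integrable M (f z)" if "z \<in> ball a d" for z
      by (rule Bochner_Integration.integrable_bound[OF h meas[OF that]])
         (auto intro!: AE_I2 order_trans[OF bound[OF that] abs_ge_self])
    hence "(\<integral>x. quot i x \<partial>M) = ((\<integral>x. f (Z i) x \<partial>M) - (\<integral>x. f a x \<partial>M)) / (Z i - a)" for i
      unfolding quot_def using Z a by simp
    ultimately show "((\<lambda>z. ((\<integral>x. f z x \<partial>M) - (\<integral>x. f a x \<partial>M)) / (z - a)) \<circ> Z)
        \<longlonglongrightarrow> (\<integral>x. deriv (\<lambda>z. f z x) a \<partial>M)"
      by (simp add: o_def)
  qed
  thus ?thesis using d by (subst (asm) at_within_open) auto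
qed

lemma holomorphic_on_integral:
  fixes f :: "complex \<Rightarrow> 'a \<Rightarrow> complex"
  assumes S: "open S" and meas: "\<And>z. z \<in> S \<Longrightarrow> f z \<in> borel_measurable M"
    and hol: "\<And>x. x \<in> space M \<Longrightarrow> (\<lambda>z. f z x) holomorphic_on S"
    and dom: "\<And>a. a \<in> S \<Longrightarrow>
      \<exists>h. integrable M h \<and> (\<forall>\<^sub>F z in nhds a. \<forall>x\<in>space M. norm (f z x) \<le> h x)"
  shows "(\<lambda>z. \<integral>x. f z x \<partial>M) holomorphic_on S"
  unfolding holomorphic_on_def
proof
  fix a assume a: "a \<in> S"
  then obtain h where h: "integrable M h" "\<forall>\<^sub>F z in nhds a. \<forall>x\<in>space M. norm (f z x) \<le> h x"
    using dom by blast
  have "\<forall>\<^sub>F z in nhds a. z \<in> S \<and> (\<forall>x\<in>space M. norm (f z x) \<le> h x)"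
    using h(2) eventually_nhds_in_open[OF S a] by eventually_elim auto
  then obtain d where d: "d > 0"
      and ball: "\<And>z. dist z a < d \<Longrightarrow> z \<in> S \<and> (\<forall>x\<in>space M. norm (f z x) \<le> h x)"
    by (auto simp: eventually_nhds_metric)
  have sub: "ball a d \<subseteq> S"
    and bound: "\<And>z x. z \<in> ball a d \<Longrightarrow> x \<in> space M \<Longrightarrow> norm (f z x) \<le> h x"
    using ball by (auto simp: dist_commute)
  have "((\<lambda>z. \<integral>x. f z x \<partial>M) has_field_derivative (\<integral>x. deriv (\<lambda>z. f z x) a \<partial>M)) (at a)"
    by (rule has_field_derivative_integral[OF d _ _ h(1) bound])
       (use sub meas hol in \<open>auto intro: holomorphic_on_subset\<close>)
  thus "(\<lambda>z. \<integral>x. f z x \<partial>M) field_differentiable at a within S"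
    by (auto simp: field_differentiable_def intro: has_field_derivative_at_within)
qed

lemma holomorphic_on_set_integral:
  fixes f :: "complex \<Rightarrow> 'a::euclidean_space \<Rightarrow> complex"
  assumes S: "open S" and A: "A \<in> sets borel" and cont: "\<And>z. z \<in> S \<Longrightarrow> continuous_on A (f z)"
    and hol: "\<And>x. x \<in> A \<Longrightarrow> (\<lambda>z. f z x) holomorphic_on S"
    and dom: "\<And>a. a \<in> S \<Longrightarrow>
      \<exists>h. set_integrable lborel A h \<and> (\<forall>\<^sub>F z in nhds a. \<forall>x\<in>A. norm (f z x) \<le> h x)"
  shows "(\<lambda>z. LINT x:A|lborel. f z x) holomorphic_on S"
  unfolding set_lebesgue_integral_def
proof (rule holomorphic_on_integral[OF S])
  show "(\<lambda>x. indicator A x *\<^sub>R f z x) \<in> borel_measurable lborel" if "z \<in> S" for z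
    using borel_measurable_continuous_on_indicator[OF A cont[OF that]] by simp
  show "(\<lambda>z. indicat_real A x *\<^sub>R f z x) holomorphic_on S" for x
    using hol[of x] by (cases "x \<in> A") (auto simp: scaleR_conv_of_real intro!: holomorphic_intros)
  fix a assume "a \<in> S"
  then obtain h where h: "set_integrable lborel A h" "\<forall>\<^sub>F z in nhds a. \<forall>x\<in>A. norm (f z x) \<le> h x"
    using dom by blast
  from h(2) have "\<forall>\<^sub>F z in nhds a. \<forall>x\<in>space lborel. norm (indicator A x *\<^sub>R f z x) \<le> indicator A x *\<^sub>R h x"
    by eventually_elim (auto simp: indicator_def)
  with h(1) show "\<exists>h. integrable lborel h \<and>
      (\<forall>\<^sub>F z in nhds a. \<forall>x\<in>space lborel. norm (indicator A x *\<^sub>R f z x) \<le> h x)"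
    unfolding set_integrable_def by blast
qed

lemma set_integrable_dominated:
  fixes f :: "'a::euclidean_space \<Rightarrow> 'b::{banach, second_countable_topology}"
  assumes h: "set_integrable lborel A h" and A: "A \<in> sets borel" and f: "continuous_on A f"
    and bound: "\<And>x. x \<in> A \<Longrightarrow> norm (f x) \<le> (h x :: real)"
  shows "set_integrable lborel A f"
proof (rule set_integrable_bound[OF h])
  show "set_borel_measurable lborel A f"
    using set_measurable_continuous_on[OF A f] by (simp add: set_borel_measurable_def)
  show "AE x in lborel. x \<in> A \<longrightarrow> norm (f x) \<le> norm (h x)"
    by (auto intro!: AE_I2 order_trans[OF bound abs_ge_self])
qed

lemma norm_set_integral_le:
  fixes f :: "'a::euclidean_space \<Rightarrow> 'b::{banach, second_countable_topology}"
  assumes h: "set_integrable lborel A h" and A: "A \<in> sets borel" and f: "continuous_on A f"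
    and bound: "\<And>x. x \<in> A \<Longrightarrow> norm (f x) \<le> h x"
  shows "norm (LINT x:A|lborel. f x) \<le> (LINT x:A|lborel. h x)"
proof -
  note f_int = set_integrable_dominated[OF h A f bound]
  have "norm (LINT x:A|lborel. f x) \<le> (LINT x:A|lborel. norm (f x))"
    by (rule set_integral_norm_bound[OF f_int])
  also have "\<dots> \<le> (LINT x:A|lborel. h x)"
    by (rule set_integral_mono[OF set_integrable_norm[OF f_int] h bound])
  finally show ?thesis .
qed

lemma
  assumes "\<And>i. i \<in> I \<Longrightarrow> set_integrable M A (f i)"
  shows set_integrable_sum: "set_integrable M A (\<lambda>x. \<Sum>i\<in>I. f i x)"
    and set_integral_sum: "(LINT x:A|M. \<Sum>i\<in>I. f i x) = (\<Sum>i\<in>I. LINT x:A|M. f i x)"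
  using assms unfolding set_integrable_def set_lebesgue_integral_def scaleR_sum_right
  by (intro Bochner_Integration.integrable_sum Bochner_Integration.integral_sum; blast)+

lemma integral_suminf_dominated:
  fixes f :: "nat \<Rightarrow> 'a \<Rightarrow> 'b::{banach, second_countable_topology}" and c :: "nat \<Rightarrow> real"
  assumes c: "summable c" and h: "integrable M h" and f: "\<And>n. f n \<in> borel_measurable M"
    and bound: "\<And>n x. norm (f n x) \<le> c n * h x"
  shows "(\<integral>x. (\<Sum>n. f n x) \<partial>M) = (\<Sum>n. integral\<^sup>L M (f n))"
proof (rule integral_suminf)
  show f_int: "integrable M (f n)" for n
    by (rule Bochner_Integration.integrable_bound[OF integrable_mult_right[OF h, of "c n"] f])
       (auto intro!: AE_I2 order_trans[OF bound abs_ge_self])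
  show "AE x in M. summable (\<lambda>n. norm (f n x))"
    by (intro AE_I2 summable_comparison_test'[OF summable_mult2[OF c]]) (auto intro: bound)
  have "(\<integral>x. norm (f n x) \<partial>M) \<le> (\<integral>x. c n * h x \<partial>M)" for n
    by (intro integral_mono bound integrable_norm f_int integrable_mult_right h)
  thus "summable (\<lambda>n. \<integral>x. norm (f n x) \<partial>M)"
    by (intro summable_comparison_test'[OF summable_mult2[OF c, of "integral\<^sup>L M h"]]) simp
qed

lemma set_integral_mult_power_series:
  fixes g :: "real \<Rightarrow> complex"
  assumes g: "set_integrable lborel A g" and A: "A \<subseteq> {-1..1}" and k: "summable (\<lambda>n. norm (k n))"
  shows "(LINT s:A|lborel. g s * (\<Sum>n. k n * of_real s ^ n)) = (\<Sum>n. k n * (LINT s:A|lborel. g s * of_real s ^ n))"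
proof -
  define G where "G s = indicator A s *\<^sub>R g s" for s
  define f where "f n s = k n * (G s * of_real s ^ n)" for n s
  have G_int: "integrable lborel G" using g by (simp add: G_def[abs_def] set_integrable_def)
  have power_le: "norm (complex_of_real s ^ n) \<le> 1" if "s \<in> A" for s n
    using that A by (force simp: norm_power intro!: power_le_one)
  have "norm (f n s) \<le> norm (k n) * norm (G s)" for n s
  proof (cases "s \<in> A")
    case True
    show ?thesis unfolding f_def norm_mult using power_le[OF True] by (intro mult_left_mono mult_left_le) auto
  qed (simp add: f_def G_def)
  moreover have "f n \<in> borel_measurable lborel" for n
    unfolding f_def using borel_measurable_integrable[OF G_int] by measurable
  ultimately have "(\<integral>s. (\<Sum>n. f n s) \<partial>lborel) = (\<Sum>n. integral\<^sup>L lborel (f n))"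
    by (intro integral_suminf_dominated[OF k integrable_norm[OF G_int]])
  moreover have "(\<Sum>n. f n s) = indicator A s *\<^sub>R (g s * (\<Sum>n. k n * of_real s ^ n))" for s
  proof (cases "s \<in> A")
    case True
    have "summable (\<lambda>n. k n * of_real s ^ n)"
      by (rule summable_comparison_test'[OF k]) (use power_le[OF True] in \<open>auto simp: norm_mult intro!: mult_left_le\<close>)
    from suminf_mult[OF this, of "g s"] True show ?thesis by (simp add: f_def G_def mult_ac)
  qed (simp add: f_def G_def)
  moreover have "integral\<^sup>L lborel (f n) = k n * (LINT s:A|lborel. g s * of_real s ^ n)" for n
  proof -
    have "f n = (\<lambda>s. k n * (indicator A s *\<^sub>R (g s * of_real s ^ n)))" by (simp add: f_def G_def fun_eq_iff)
    thus ?thesis by (simp only: set_lebesgue_integral_def integral_mult_right_zero)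
  qed
  ultimately show ?thesis unfolding set_lebesgue_integral_def by simp
qed

lemma integrable_pair_indicator:
  fixes f :: "real \<Rightarrow> real \<Rightarrow> 'b::{banach, second_countable_topology}" and g :: "real \<Rightarrow> real"
  assumes A: "A \<in> sets borel" and B: "B \<in> sets borel"
    and f: "continuous_on (A \<times> B) (\<lambda>(x,y). f x y)"
    and f_int: "\<And>x. x \<in> A \<Longrightarrow> set_integrable lborel B (f x)"
    and bound: "\<And>x. x \<in> A \<Longrightarrow> (LINT y:B|lborel. norm (f x y)) \<le> g x"
    and g: "set_integrable lborel A g"
  shows "integrable (lborel \<Otimes>\<^sub>M lborel) (\<lambda>(x,y). indicator A x *\<^sub>R (indicator B y *\<^sub>R f x y))"
    (is "integrable _ ?F")
proof -
  have meas: "?F \<in> borel_measurable (lborel \<Otimes>\<^sub>M lborel)"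
  proof -
    have "(\<lambda>z. indicator (A \<times> B) z *\<^sub>R (case z of (x,y) \<Rightarrow> f x y)) \<in> borel_measurable borel"
      by (rule borel_measurable_continuous_on_indicator[OF borel_Times[OF A B] f])
    also have "(\<lambda>z. indicator (A \<times> B) z *\<^sub>R (case z of (x,y) \<Rightarrow> f x y)) = ?F"
      by (auto simp: indicator_def fun_eq_iff)
    finally show ?thesis by (simp add: lborel_prod)
  qed
  show ?thesis
  proof (rule lborel_pair.Fubini_integrable[OF meas])
    have "norm (\<integral>y. norm (?F (x, y)) \<partial>lborel) \<le> norm (indicator A x *\<^sub>R g x)" for x
    proof (cases "x \<in> A")
      case True
      have "(\<integral>y. norm (?F (x, y)) \<partial>lborel) = (LINT y:B|lborel. norm (f x y))"
        using True by (simp add: set_lebesgue_integral_def)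
      moreover have "(\<integral>y. norm (?F (x, y)) \<partial>lborel) \<ge> 0" by (intro integral_nonneg_AE AE_I2) simp
      ultimately show ?thesis using True bound[OF True] by simp
    qed simp
    moreover have "(\<lambda>x. \<integral>y. norm (?F (x, y)) \<partial>lborel) \<in> borel_measurable lborel"
      using meas by measurable
    ultimately show "integrable lborel (\<lambda>x. \<integral>y. norm (?F (x, y)) \<partial>lborel)"
      by (rule Bochner_Integration.integrable_bound[OF g[unfolded set_integrable_def] _ AE_I2, rotated])
    show "AE x in lborel. integrable lborel (\<lambda>y. ?F (x, y))"
      using f_int by (auto intro!: AE_I2 simp: set_integrable_def indicator_def)
  qed
qed

lemma set_integral_Fubini:
  fixes f :: "real \<Rightarrow> real \<Rightarrow> 'b::{banach, second_countable_topology}" and g :: "real \<Rightarrow> real"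
  assumes A: "A \<in> sets borel" and B: "B \<in> sets borel"
    and f: "continuous_on (A \<times> B) (\<lambda>(x,y). f x y)"
    and f_int: "\<And>x. x \<in> A \<Longrightarrow> set_integrable lborel B (f x)"
    and bound: "\<And>x. x \<in> A \<Longrightarrow> (LINT y:B|lborel. norm (f x y)) \<le> g x"
    and g: "set_integrable lborel A g"
  shows "(LINT x:A|lborel. LINT y:B|lborel. f x y) = (LINT y:B|lborel. LINT x:A|lborel. f x y)"
    and "set_integrable lborel A (\<lambda>x. LINT y:B|lborel. f x y)"
    and "set_integrable lborel B (\<lambda>y. LINT x:A|lborel. f x y)"
proof -
  note int = integrable_pair_indicator[OF A B f f_int bound g]
  show "(LINT x:A|lborel. LINT y:B|lborel. f x y) = (LINT y:B|lborel. LINT x:A|lborel. f x y)"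
    using lborel_pair.Fubini_integral[OF int] unfolding set_lebesgue_integral_def
    by (simp add: mult.commute flip: integral_scaleR_right)
  show "set_integrable lborel A (\<lambda>x. LINT y:B|lborel. f x y)"
    using lborel_pair.integrable_fst[OF int] unfolding set_lebesgue_integral_def set_integrable_def
    by (simp flip: integral_scaleR_right)
  show "set_integrable lborel B (\<lambda>y. LINT x:A|lborel. f x y)"
    using lborel_pair.integrable_snd[OF int] unfolding set_lebesgue_integral_def set_integrable_def
    by (simp add: mult.commute flip: integral_scaleR_right)
qed

lemma set_integral_Fubini_product_bound:
  fixes f :: "real \<Rightarrow> real \<Rightarrow> 'b::{banach, second_countable_topology}"
  assumes A: "A \<in> sets borel" and B: "B \<in> sets borel"
    and f: "continuous_on (A \<times> B) (\<lambda>(x,y). f x y)"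
    and h: "set_integrable lborel A h" and k: "set_integrable lborel B k"
    and bound: "\<And>x y. x \<in> A \<Longrightarrow> y \<in> B \<Longrightarrow> norm (f x y) \<le> h x * k y"
  shows "(LINT x:A|lborel. LINT y:B|lborel. f x y) = (LINT y:B|lborel. LINT x:A|lborel. f x y)"
    and "set_integrable lborel A (\<lambda>x. LINT y:B|lborel. f x y)"
proof -
  have k': "set_integrable lborel B (\<lambda>y. h x * k y)" for x
    using k by (rule set_integrable_mult_right)
  have f_int: "set_integrable lborel B (f x)" if "x \<in> A" for x
  proof (rule set_integrable_dominated[OF k' B _ bound[OF that]])
    have "continuous_on B (\<lambda>y. (x, y))" by (intro continuous_on_Pair continuous_on_const continuous_on_id)
    from continuous_on_compose2[OF f this] that show "continuous_on B (f x)" by auto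
  qed
  have norm_int: "(LINT y:B|lborel. norm (f x y)) \<le> h x * (LINT y:B|lborel. k y)" if "x \<in> A" for x
    using set_integral_mono[OF set_integrable_norm[OF f_int[OF that]] k' bound[OF that]] by simp
  note Fubini = set_integral_Fubini[OF A B f f_int norm_int set_integrable_mult_left[OF h]]
  show "(LINT x:A|lborel. LINT y:B|lborel. f x y) = (LINT y:B|lborel. LINT x:A|lborel. f x y)"
    by (rule Fubini(1))
  show "set_integrable lborel A (\<lambda>x. LINT y:B|lborel. f x y)" by (rule Fubini(2))
qed

lemma set_integrable_lborel_iff_absolutely_integrable_on:
  fixes f :: "'a::euclidean_space \<Rightarrow> 'b::euclidean_space"
  assumes "A \<in> sets borel" "continuous_on A f"
  shows "set_integrable lborel A f \<longleftrightarrow> f absolutely_integrable_on A"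
  unfolding set_integrable_def
  using borel_measurable_continuous_on_indicator[OF assms] by (intro integrable_completion[symmetric]) simp

lemma set_integral_substitution:
  fixes f :: "real \<Rightarrow> 'a::euclidean_space"
  assumes S: "S \<in> sets borel" "T \<in> sets borel" "g ` S = T"
    and deriv: "\<And>x. x \<in> S \<Longrightarrow> (g has_field_derivative h x) (at x)"
    and inj: "inj_on g S" and f: "continuous_on T f" and h: "continuous_on S h"
    and F: "\<And>x. x \<in> S \<Longrightarrow> F x = \<bar>h x\<bar> *\<^sub>R f (g x)"
  shows "set_integrable lborel T f \<longleftrightarrow> set_integrable lborel S F"
    and "(LINT x:T|lborel. f x) = (LINT x:S|lborel. F x)"
proof -
  have "continuous_on S g"
    using deriv DERIV_continuous continuous_at_imp_continuous_on by blast
  hence "continuous_on S (\<lambda>x. \<bar>h x\<bar> *\<^sub>R f (g x))"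
    using S(3) by (intro continuous_intros h continuous_on_compose2[OF f]) auto
  hence F_cont: "continuous_on S F" using F by (simp cong: continuous_on_cong)
  have "F absolutely_integrable_on S \<and> integral S F = b \<longleftrightarrow>
      f absolutely_integrable_on T \<and> integral T f = b" for b
  proof -
    have "F absolutely_integrable_on S \<longleftrightarrow> (\<lambda>x. \<bar>h x\<bar> *\<^sub>R f (g x)) absolutely_integrable_on S"
      using F by (intro set_integrable_cong) auto
    moreover have "integral S F = integral S (\<lambda>x. \<bar>h x\<bar> *\<^sub>R f (g x))"
      by (rule Henstock_Kurzweil_Integration.integral_cong[OF F])
    ultimately show ?thesis
      using has_absolute_integral_change_of_variables_real[OF _
          has_field_derivative_at_within[OF deriv] inj, of f b] S by simp
  qed
  note change = this[folded set_integrable_lborel_iff_absolutely_integrable_on[OF S(1) F_cont]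
      set_integrable_lborel_iff_absolutely_integrable_on[OF S(2) f]]
  thus iff: "set_integrable lborel T f \<longleftrightarrow> set_integrable lborel S F" by blast
  show "(LINT x:T|lborel. f x) = (LINT x:S|lborel. F x)"
  proof (cases "set_integrable lborel T f")
    case True
    with iff have "set_integrable lborel S F" by blast
    from set_borel_integral_eq_integral(2)[OF this] set_borel_integral_eq_integral(2)[OF True]
    show ?thesis using change[of "integral S F"] True \<open>set_integrable lborel S F\<close> by simp
  next
    case False
    with iff show ?thesis
      by (simp add: set_lebesgue_integral_def set_integrable_def not_integrable_integral_eq)
  qed
qed

lemma set_integral_Ioi_scale:
  fixes f :: "real \<Rightarrow> 'a::euclidean_space"
  assumes c: "c > 0" and f: "continuous_on {0<..} f"
  shows "(LINT x:{0<..}|lborel. f x) = (LINT x:{0<..}|lborel. c *\<^sub>R f (c * x))"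
proof (rule set_integral_substitution(2)[where g = "\<lambda>x. c * x" and h = "\<lambda>_. c"])
  show "(*) c ` {0<..} = {0<..}"
  proof (intro equalityI subsetI)
    fix x :: real assume "x \<in> {0<..}"
    thus "x \<in> (*) c ` {0<..}" using c by (intro image_eqI[of _ _ "x / c"]) auto
  qed (use c in auto)
qed (use c f in \<open>auto intro!: derivative_eq_intros inj_onI\<close>)

lemma integral_fold_real_line:
  fixes f :: "real \<Rightarrow> 'a::{banach, second_countable_topology}"
  assumes f: "integrable lborel f"
  shows "(LINT x|lborel. f x) = (LINT x:{0<..}|lborel. f x + f (- x))"
proof -
  have reflect: "integrable lborel (\<lambda>x. f (- x))"
    using lborel_integrable_real_affine[OF f, of "-1" 0] by simp
  have int: "set_integrable lborel {0<..} f" "set_integrable lborel {0<..} (\<lambda>x. f (- x))"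
    "set_integrable lborel {..<0} f"
    unfolding set_integrable_def using f reflect by (auto intro!: integrable_mult_indicator)
  have "AE x in lborel. f x = indicator {0<..} x *\<^sub>R f x + indicator {..<0} x *\<^sub>R f x"
    using AE_lborel_singleton[of "0::real"] by eventually_elim (auto simp: indicator_def)
  hence "(LINT x|lborel. f x) = (LINT x|lborel. indicator {0<..} x *\<^sub>R f x + indicator {..<0} x *\<^sub>R f x)"
    using f int unfolding set_integrable_def by (intro integral_cong_AE) auto
  also have "\<dots> = (LINT x:{0<..}|lborel. f x) + (LINT x:{..<0}|lborel. f x)"
    using int unfolding set_integrable_def set_lebesgue_integral_def by simp
  also have "(LINT x:{..<0}|lborel. f x) = (LINT x:{0<..}|lborel. f (- x))"
    using lborel_integral_real_affine[of "-1" "\<lambda>x. indicator {..<0} x *\<^sub>R f x" 0]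
    by (simp add: set_lebesgue_integral_def indicator_def)
  finally show ?thesis using int by simp
qed

lemma set_integral_pos_real:
  fixes f :: "real \<Rightarrow> complex"
  assumes f_int: "set_integrable lborel A f" and A: "a < b" "{a<..<b} \<subseteq> A"
    and f: "\<And>x. x \<in> A \<Longrightarrow> \<exists>r>0. f x = of_real r"
  shows "\<exists>r>0. (LINT x:A|lborel. f x) = of_real r"
proof -
  define g where "g x = indicator A x * Re (f x)" for x
  have f_eq: "indicator A x *\<^sub>R f x = of_real (g x)" for x using f[of x] by (auto simp: g_def indicator_def)
  have g_int: "integrable lborel g"
    using f_int unfolding set_integrable_def f_eq complex_of_real_integrable_eq .
  have g_nonneg: "g x \<ge> 0" and g_pos: "x \<in> A \<Longrightarrow> g x > 0" for x
    using f[of x] by (auto simp: g_def indicator_def)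
  have "integral\<^sup>L lborel g \<noteq> 0"
  proof
    assume "integral\<^sup>L lborel g = 0"
    hence "AE x in lborel. g x = 0" using integral_nonneg_eq_0_iff_AE[OF g_int] g_nonneg by simp
    hence "AE x in lborel. x \<notin> {a<..<b}"
      by eventually_elim (use A g_pos in \<open>fastforce simp: subset_iff\<close>)
    hence "emeasure lborel {a<..<b} = 0" by (subst (asm) AE_iff_measurable[of "{a<..<b}"]) auto
    thus False using A(1) by simp
  qed
  moreover have "integral\<^sup>L lborel g \<ge> 0" by (rule integral_nonneg_AE) (use g_nonneg in simp)
  moreover have "(LINT x:A|lborel. f x) = of_real (integral\<^sup>L lborel g)"
    unfolding set_lebesgue_integral_def f_eq by (rule integral_complex_of_real)
  ultimately show ?thesis by (intro exI[of _ "integral\<^sup>L lborel g"]) auto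
qed

lemma holomorphic_eq_on_segment:
  assumes hol: "f holomorphic_on S" "g holomorphic_on S" and S: "open S" "connected S"
    and lr: "l < r" and v: "v \<noteq> 0"
    and eq: "\<And>t. l < t \<Longrightarrow> t < r \<Longrightarrow> of_real t * v \<in> S \<and> f (of_real t * v) = g (of_real t * v)"
    and z: "z \<in> S"
  shows "f z = g z"
proof -
  define U where "U = (\<lambda>t. of_real t * v) ` {l<..<r}"
  obtain s where s: "l < s" "s < r" using lr dense by blast
  obtain t where t: "l < t" "t < s" using s dense by blast
  have "of_real s * v islimpt U"
  proof (rule connected_imp_perfect)
    show "connected U" unfolding U_def
      by (rule connected_continuous_image) (auto intro!: continuous_intros)
    show s_U: "of_real s * v \<in> U" unfolding U_def using s by auto
    have "of_real t * v \<in> U" unfolding U_def using s t by auto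
    moreover have "of_real t * v \<noteq> of_real s * v" using t v by simp
    ultimately show "U \<noteq> {x}" for x using s_U by auto
  qed
  hence "f z - g z = 0"
    by (rule analytic_continuation[of "\<lambda>z. f z - g z" S U, rotated 5])
       (use hol S z s eq in \<open>auto simp: U_def intro!: holomorphic_intros\<close>)
  thus ?thesis by simp
qed

section \<open>Complex powers and the slit plane\<close>

lemma tendsto_nhds_holomorphic:
  assumes "f holomorphic_on S" "open S" "a \<in> S"
  shows "(f \<longlongrightarrow> f a) (nhds a)"
  using assms holomorphic_on_imp_continuous_on continuous_on_eq_continuous_at
  by (metis isCont_def tendsto_at_iff_tendsto_nhds)

lemma norm_powr_le:
  assumes "z \<noteq> 0"
  shows "norm (z powr a :: complex) \<le> norm z powr Re a * exp (pi * \<bar>Im a\<bar>)"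
proof -
  have "- (Im a * Im (Ln z)) \<le> \<bar>Im a\<bar> * \<bar>Im (Ln z)\<bar>" unfolding abs_mult[symmetric] by simp
  also have "\<dots> \<le> \<bar>Im a\<bar> * pi"
    using mpi_less_Im_Ln[OF assms] Im_Ln_le_pi[OF assms] by (intro mult_left_mono) auto
  finally have "exp (- (Im a * Im (Ln z))) \<le> exp (pi * \<bar>Im a\<bar>)" by (simp add: mult.commute)
  moreover have "norm (z powr a) = norm z powr Re a * exp (- (Im a * Im (Ln z)))"
    using assms by (simp add: powr_def exp_diff exp_minus divide_inverse)
  ultimately show ?thesis by (simp add: mult_left_mono)
qed

lemma norm_of_real_powr: "x \<ge> 0 \<Longrightarrow> norm (complex_of_real x powr a) = x powr Re a"
  by (simp add: norm_powr_real_powr)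

lemma of_real_powr_exp: "x > 0 \<Longrightarrow> complex_of_real x powr a = exp (a * of_real (ln x))"
  by (simp add: powr_def Ln_of_real)

lemma exp_powr: "\<bar>Im z\<bar> < pi \<Longrightarrow> exp z powr a = exp (a * z :: complex)"
  by (simp add: powr_def)

lemma of_real_mult_powr: "r > 0 \<Longrightarrow> (complex_of_real r * z) powr a = of_real r powr a * z powr a"
  by (simp add: powr_times_real_left)

lemma powr_uminus_lower_half_plane:
  assumes "Im z < 0"
  shows "(- z) powr a = exp (\<i> * of_real pi * a) * z powr a"
proof -
  have "z \<noteq> 0" using assms by auto
  moreover have "Ln (- z) = Ln z + \<i> * of_real pi" using assms \<open>z \<noteq> 0\<close> by (subst Ln_minus) auto
  ultimately show ?thesis by (simp add: powr_def exp_add algebra_simps)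
qed

lemma continuous_on_of_real_powr:
  assumes "\<And>x. x \<in> A \<Longrightarrow> g x > 0" "continuous_on A g"
  shows "continuous_on A (\<lambda>x. complex_of_real (g x) powr a)"
  by (rule continuous_on_powr_complex) (use assms in \<open>force intro!: continuous_intros\<close>)+

lemma continuous_on_powr_slit:
  assumes "continuous_on A f" "\<And>x. x \<in> A \<Longrightarrow> f x \<notin> \<real>\<^sub>\<le>\<^sub>0"
  shows "continuous_on A (\<lambda>x. f x powr (a::complex))"
  by (rule continuous_on_powr_complex) (use assms in \<open>force simp: complex_nonpos_Reals_iff\<close>)+

lemma open_slit_plane: "open (- \<real>\<^sub>\<le>\<^sub>0 :: complex set)"
  by (simp add: open_Compl)

lemma connected_slit_plane: "connected (- \<real>\<^sub>\<le>\<^sub>0 :: complex set)"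
proof -
  have "(\<real>\<^sub>\<le>\<^sub>0 :: complex set) = complex_of_real ` {..0}"
    by (auto simp: complex_nonpos_Reals_iff complex_eq_iff image_iff)
  thus ?thesis using starlike_imp_connected[OF starlike_slotted_complex_plane_left[of 0]] by simp
qed

lemma Re_pos_notin_nonpos_Reals: "Re z > 0 \<Longrightarrow> z \<notin> \<real>\<^sub>\<le>\<^sub>0"
  by (auto simp: complex_nonpos_Reals_iff)

lemma Im_nonzero_notin_nonpos_Reals: "Im z \<noteq> 0 \<Longrightarrow> z \<notin> \<real>\<^sub>\<le>\<^sub>0"
  by (auto simp: complex_nonpos_Reals_iff)

lemma of_real_mult_notin_nonpos_Reals: "z \<notin> \<real>\<^sub>\<le>\<^sub>0 \<Longrightarrow> r > 0 \<Longrightarrow> complex_of_real r * z \<notin> \<real>\<^sub>\<le>\<^sub>0"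
  by (auto simp: complex_nonpos_Reals_iff mult_le_0_iff)

lemma add_nonneg_notin_nonpos_Reals:
  "z \<notin> \<real>\<^sub>\<le>\<^sub>0 \<Longrightarrow> s \<ge> 0 \<Longrightarrow> z + complex_of_real s \<notin> \<real>\<^sub>\<le>\<^sub>0"
  by (auto simp: complex_nonpos_Reals_iff)

lemma norm_add_nonneg_lower_bound:
  assumes "a \<notin> \<real>\<^sub>\<le>\<^sub>0"
  obtains d where "d > 0" "\<forall>\<^sub>F z in nhds a. \<forall>s\<ge>0. d * (1 + s) \<le> norm (z + complex_of_real s)"
proof -
  obtain r where r: "r > 0" "ball a r \<subseteq> - \<real>\<^sub>\<le>\<^sub>0"
    using assms open_slit_plane by (metis ComplI open_contains_ball)
  define h where "h = r / 2"
  define K where "K = norm a + h"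
  have h: "h > 0" and K: "K \<ge> 0" using r by (simp_all add: h_def K_def)
  have "h / (1 + K + h) * (1 + s) \<le> norm (z + of_real s)" if z: "z \<in> ball a h" and s: "s \<ge> 0" for z s
  proof -
    have "- of_real s \<notin> ball a r" using r(2) s by (auto simp: complex_nonpos_Reals_iff)
    hence "r \<le> norm (a + of_real s)" by (simp add: dist_norm)
    also have "\<dots> \<le> norm (a - z) + norm (z + of_real s)"
      using norm_triangle_ineq[of "a - z" "z + of_real s"] by simp
    finally have ge_h: "h \<le> norm (z + of_real s)" using z by (simp add: h_def dist_norm)
    have "norm z \<le> norm a + norm (a - z)" using norm_triangle_ineq4[of a "a - z"] by simp
    hence ge_diff: "s - K \<le> norm (z + of_real s)"
      using norm_triangle_ineq2[of "of_real s" "- z"] z s by (simp add: K_def dist_norm add.commute)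
    have "h * (1 + s) = h * (1 + K) + h * (s - K)" by (simp add: algebra_simps)
    also have "\<dots> \<le> norm (z + of_real s) * (1 + K) + h * norm (z + of_real s)"
      using ge_h ge_diff h K by (intro add_mono mult_right_mono mult_left_mono) auto
    finally show ?thesis using h K by (simp add: field_simps)
  qed
  moreover have "\<forall>\<^sub>F z in nhds a. z \<in> ball a h" using h by (intro eventually_nhds_in_open) auto
  ultimately have "\<forall>\<^sub>F z in nhds a. \<forall>s\<ge>0. h / (1 + K + h) * (1 + s) \<le> norm (z + of_real s)"
    by (auto elim: eventually_mono)
  thus ?thesis using h K by (intro that[of "h / (1 + K + h)"]) auto
qed

lemma norm_one_plus_mult_lower_bound:
  assumes "a \<notin> \<real>\<^sub>\<le>\<^sub>0"
  obtains d where "d > 0" "\<forall>\<^sub>F z in nhds a. \<forall>s>0. d \<le> norm (1 + z * complex_of_real s)"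
proof -
  obtain d where d: "d > 0" "\<forall>\<^sub>F z in nhds a. \<forall>s\<ge>0. d * (1 + s) \<le> norm (z + complex_of_real s)"
    using norm_add_nonneg_lower_bound[OF assms] .
  from d(2) have "\<forall>\<^sub>F z in nhds a. \<forall>s>0. d \<le> norm (1 + z * complex_of_real s)"
  proof eventually_elim
    case (elim z)
    show ?case
    proof (intro allI impI)
      fix s :: real assume s: "s > 0"
      have "d \<le> s * (d * (1 + 1 / s))" using s d(1) by (simp add: field_simps)
      also have "\<dots> \<le> s * norm (z + of_real (1 / s))" using elim[rule_format, of "1 / s"] s
        by (intro mult_left_mono) auto
      also have "\<dots> = norm (of_real s * (z + of_real (1 / s)))" using s by (simp add: norm_mult)
      also have "of_real s * (z + of_real (1 / s)) = 1 + z * of_real s" using s by (simp add: field_simps)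
      finally show "d \<le> norm (1 + z * complex_of_real s)" .
    qed
  qed
  with d(1) show ?thesis by (rule that)
qed

section \<open>Gamma and Beta integrals\<close>

lemma Re_pos_notin_nonpos_Ints: "Re z > 0 \<Longrightarrow> z \<notin> \<int>\<^sub>\<le>\<^sub>0"
  by (auto elim!: nonpos_Ints_cases)

lemma Gamma_nonzero_Re_pos: "Re z > 0 \<Longrightarrow> Gamma z \<noteq> (0 :: complex)"
  by (simp add: Gamma_eq_zero_iff Re_pos_notin_nonpos_Ints)

lemma set_integrable_powr_exp:
  assumes "r > 0" "c > (0::real)"
  shows "set_integrable lborel {0<..} (\<lambda>s. s powr (r - 1) * exp (- (c * s)))"
proof -
  let ?f = "\<lambda>s. complex_of_real s powr (of_real r - 1) / of_real (exp (c * s))"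
  have "?f absolutely_integrable_on {0<..}"
    using absolutely_integrable_Gamma_integral[of "of_real r" c] assms by simp
  hence "set_integrable lborel {0<..} ?f"
    unfolding set_integrable_def
    by (subst (asm) integrable_completion)
       (auto intro!: borel_measurable_continuous_on_indicator continuous_intros continuous_on_of_real_powr)
  hence "set_integrable lborel {0<..} (\<lambda>s. norm (?f s))" by (rule set_integrable_norm)
  thus ?thesis
    by (rule set_integrable_cong[THEN iffD1, rotated -1])
       (auto simp: norm_divide norm_of_real_powr exp_minus field_simps)
qed

lemma set_integrable_exp: "c > 0 \<Longrightarrow> set_integrable lborel {0<..} (\<lambda>s::real. exp (- (c * s)))"
  by (rule set_integrable_cong[THEN iffD1, OF _ _ _ set_integrable_powr_exp[of 1 c]]) auto

lemma norm_powr_exp: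
  "s > 0 \<Longrightarrow> norm (complex_of_real s powr (a - 1) * exp (- (z * of_real s))) =
      s powr (Re a - 1) * exp (- (Re z * s))"
  by (simp add: norm_mult norm_of_real_powr)

lemma holomorphic_on_Laplace_powr:
  assumes a: "Re a > 0"
  shows "(\<lambda>z. LINT s:{0<..}|lborel. complex_of_real s powr (a - 1) * exp (- (z * of_real s)))
    holomorphic_on {z. Re z > 0}"
proof (rule holomorphic_on_set_integral)
  fix z assume "z \<in> {z. Re z > 0}"
  hence z: "Re z / 2 > 0" "Re z > Re z / 2" by auto
  have "(Re \<longlongrightarrow> Re z) (nhds z)" by (intro tendsto_intros filterlim_ident)
  hence "\<forall>\<^sub>F u in nhds z. Re u > Re z / 2" using z(2) by (rule order_tendstoD)
  hence "\<forall>\<^sub>F u in nhds z. \<forall>s\<in>{0<..}. norm (complex_of_real s powr (a - 1) * exp (- (u * of_real s)))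
      \<le> s powr (Re a - 1) * exp (- (Re z / 2 * s))"
    by eventually_elim (auto simp: norm_powr_exp intro!: mult_left_mono)
  with set_integrable_powr_exp[OF a z(1)] show "\<exists>h. set_integrable lborel {0<..} h \<and>
      (\<forall>\<^sub>F u in nhds z. \<forall>s\<in>{0<..}. norm (complex_of_real s powr (a - 1) * exp (- (u * of_real s))) \<le> h s)"
    by blast
qed (auto intro!: holomorphic_intros continuous_intros continuous_on_of_real_powr simp: open_halfspace_Re_gt)

lemma Gamma_set_integral:
  assumes a: "Re a > 0" and z: "Re z > 0"
  shows "(LINT s:{0<..}|lborel. complex_of_real s powr (a - 1) * exp (- (z * of_real s))) = Gamma a * z powr (- a)"
    (is "?I z = _")
proof (rule holomorphic_eq_on_segment[OF holomorphic_on_Laplace_powr[OF a], of "\<lambda>z. Gamma a * z powr (- a)" 0 1 1])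
  have int_1: "set_integrable lborel {0<..} (\<lambda>s. complex_of_real s powr (a - 1) * exp (- (1 * of_real s)))"
    by (rule set_integrable_dominated[OF set_integrable_powr_exp[OF a zero_less_one]])
       (auto simp: norm_mult norm_of_real_powr intro!: continuous_intros continuous_on_of_real_powr)
  have "?I 1 = integral {0<..} (\<lambda>s. complex_of_real s powr (a - 1) * exp (- (1 * of_real s)))"
    by (rule set_borel_integral_eq_integral(2)[OF int_1])
  also have "\<dots> = Gamma a"
    using integral_unique[OF Gamma_integral_complex'[OF a]] by (simp add: exp_minus field_simps exp_of_real)
  finally have I_1: "?I 1 = Gamma a" .
  fix t :: real assume t: "0 < t" "t < 1"
  have "?I 1 = (LINT s:{0<..}|lborel. t *\<^sub>R (complex_of_real (t * s) powr (a - 1) * exp (- (1 * of_real (t * s)))))"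
    by (rule set_integral_Ioi_scale[OF t(1)]) (auto intro!: continuous_intros continuous_on_of_real_powr)
  also have "\<dots> = (LINT s:{0<..}|lborel. of_real t powr a *
      (complex_of_real s powr (a - 1) * exp (- (of_real t * of_real s))))"
    using t by (intro set_lebesgue_integral_cong) (auto simp: powr_times_real powr_diff scaleR_conv_of_real)
  finally have "Gamma a = of_real t powr a * ?I (of_real t)" using I_1 by simp
  thus "of_real t * 1 \<in> {z. 0 < Re z} \<and> ?I (of_real t * 1) = Gamma a * (of_real t * 1) powr - a"
    using t by (simp add: powr_minus field_simps)
qed (use z in \<open>auto intro!: holomorphic_intros convex_connected
      simp: open_halfspace_Re_gt convex_halfspace_Re_gt complex_nonpos_Reals_iff\<close>)

lemma Gamma_set_integral_real:
  assumes "a > 0" "c > (0::real)"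
  shows "(LINT s:{0<..}|lborel. s powr (a - 1) * exp (- (c * s))) = Gamma a * c powr (- a)"
proof -
  have of_real_kernel: "complex_of_real (s powr (a - 1) * exp (- (c * s))) =
      of_real s powr (of_real a - 1) * exp (- (of_real c * of_real s))" if "s > 0" for s
    using powr_of_real[of s "a - 1"] that by (simp add: exp_of_real flip: of_real_mult of_real_minus)
  have "complex_of_real (LINT s:{0<..}|lborel. s powr (a - 1) * exp (- (c * s))) =
      (LINT s:{0<..}|lborel. of_real (s powr (a - 1) * exp (- (c * s))))"
    by (rule set_integral_complex_of_real[symmetric])
  also have "\<dots> = (LINT s:{0<..}|lborel. of_real s powr (of_real a - 1) * exp (- (of_real c * of_real s)))"
    using of_real_kernel by (intro set_lebesgue_integral_cong) auto
  also have "\<dots> = Gamma (of_real a) * of_real c powr (- of_real a)"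
    using assms by (intro Gamma_set_integral) auto
  also have "\<dots> = of_real (Gamma a * c powr (- a))"
    using powr_of_real[of c "- a"] assms by (simp add: Gamma_complex_of_real)
  finally show ?thesis by (simp only: of_real_eq_iff)
qed

definition Gamma_kernel :: "complex \<Rightarrow> real \<Rightarrow> complex" where
  "Gamma_kernel a s = of_real s powr (a - 1) * exp (- of_real s)"

lemma norm_Gamma_kernel: "s > 0 \<Longrightarrow> norm (Gamma_kernel a s) = s powr (Re a - 1) * exp (- s)"
  by (simp add: Gamma_kernel_def norm_mult norm_of_real_powr)

lemma continuous_on_Gamma_kernel [continuous_intros]: "continuous_on {0<..} (Gamma_kernel a)"
  unfolding Gamma_kernel_def by (auto intro!: continuous_intros continuous_on_of_real_powr)

lemma Gamma_kernel_pos_real: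
  assumes "s > 0"
  shows "Gamma_kernel (of_real r) s = of_real (s powr (r - 1) * exp (- s))"
  using powr_of_real[of s "r - 1"] assms by (simp add: Gamma_kernel_def exp_of_real flip: of_real_minus)

lemma Gamma_kernel_integral: "Re a > 0 \<Longrightarrow> (LINT s:{0<..}|lborel. Gamma_kernel a s) = Gamma a"
  using Gamma_set_integral[of a 1] by (simp add: Gamma_kernel_def)

lemma set_integrable_Gamma_kernel_bounded:
  assumes a: "Re a > 0" and f: "continuous_on {0<..} f" and bound: "\<And>s. s > 0 \<Longrightarrow> norm (f s) \<le> K"
  shows "set_integrable lborel {0<..} (\<lambda>s. Gamma_kernel a s * f s)"
    and "norm (LINT s:{0<..}|lborel. Gamma_kernel a s * f s) \<le> Gamma (Re a) * K"
proof -
  have dom: "set_integrable lborel {0<..} (\<lambda>s. s powr (Re a - 1) * exp (- (1 * s)) * K)"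
    by (intro set_integrable_mult_left set_integrable_powr_exp a) simp
  have le: "norm (Gamma_kernel a s * f s) \<le> s powr (Re a - 1) * exp (- (1 * s)) * K" if "s \<in> {0<..}" for s
    using that bound[of s] by (auto simp: norm_mult norm_Gamma_kernel intro!: mult_left_mono)
  have cont: "continuous_on {0<..} (\<lambda>s. Gamma_kernel a s * f s)" by (intro continuous_intros f)
  show "set_integrable lborel {0<..} (\<lambda>s. Gamma_kernel a s * f s)"
    by (rule set_integrable_dominated[OF dom _ cont le]) auto
  have "norm (LINT s:{0<..}|lborel. Gamma_kernel a s * f s) \<le>
      (LINT s:{0<..}|lborel. s powr (Re a - 1) * exp (- (1 * s)) * K)"
    by (rule norm_set_integral_le[OF dom _ cont le]) auto
  also have "\<dots> = Gamma (Re a) * K"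
    using Gamma_set_integral_real[OF a zero_less_one] by (simp only: set_integral_mult_left) simp
  finally show "norm (LINT s:{0<..}|lborel. Gamma_kernel a s * f s) \<le> Gamma (Re a) * K" .
qed

lemma holomorphic_on_Gamma_kernel_integral:
  assumes a: "Re a > 0" and S: "open S"
    and cont: "\<And>z. z \<in> S \<Longrightarrow> continuous_on {0<..} (f z)"
    and hol: "\<And>s. s > 0 \<Longrightarrow> (\<lambda>z. f z s) holomorphic_on S"
    and bound: "\<And>z. z \<in> S \<Longrightarrow> \<exists>K. \<forall>\<^sub>F u in nhds z. \<forall>s>0. norm (f u s) \<le> K"
  shows "(\<lambda>z. LINT s:{0<..}|lborel. Gamma_kernel a s * f z s) holomorphic_on S"
proof (rule holomorphic_on_set_integral[OF S])
  fix z assume "z \<in> S"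
  then obtain K where "\<forall>\<^sub>F u in nhds z. \<forall>s>0. norm (f u s) \<le> K" using bound by blast
  hence "\<forall>\<^sub>F u in nhds z. \<forall>s\<in>{0<..}. norm (Gamma_kernel a s * f u s) \<le> s powr (Re a - 1) * exp (- (1 * s)) * K"
    by eventually_elim (auto simp: norm_mult norm_Gamma_kernel intro!: mult_left_mono)
  moreover have "set_integrable lborel {0<..} (\<lambda>s. s powr (Re a - 1) * exp (- (1 * s)) * K)"
    by (intro set_integrable_mult_left set_integrable_powr_exp a) simp
  ultimately show "\<exists>h. set_integrable lborel {0<..} h \<and>
      (\<forall>\<^sub>F u in nhds z. \<forall>s\<in>{0<..}. norm (Gamma_kernel a s * f u s) \<le> h s)"
    by blast
qed (auto intro!: holomorphic_intros continuous_intros hol cont)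

lemma set_integrable_Beta:
  assumes "a > 0" "b > 0"
  shows "set_integrable lborel {0<..<1} (\<lambda>x::real. x powr (a - 1) * (1 - x) powr (b - 1))"
  by (rule set_integrable_subset[OF integrable_Beta[OF assms]]) auto

lemma Beta_set_integral_real:
  assumes "a > 0" "b > (0::real)"
  shows "(LINT x:{0<..<1}|lborel. x powr (a - 1) * (1 - x) powr (b - 1)) = Beta a b"
  using set_borel_integral_eq_integral(2)[OF set_integrable_Beta[OF assms]]
    integral_unique[OF has_integral_Beta_real[OF assms]]
  by (simp add: integral_open_interval_real)

definition Beta_kernel :: "complex \<Rightarrow> complex \<Rightarrow> real \<Rightarrow> complex" where
  "Beta_kernel a b x = of_real x powr (a - 1) * of_real (1 - x) powr (b - 1)"

lemma norm_Beta_kernel: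
  "x \<in> {0<..<1} \<Longrightarrow> norm (Beta_kernel a b x) = x powr (Re a - 1) * (1 - x) powr (Re b - 1)"
  using norm_of_real_powr[of x "a - 1"] norm_of_real_powr[of "1 - x" "b - 1"]
  by (simp add: Beta_kernel_def norm_mult)

lemma norm_Beta_kernel_mono:
  assumes "x \<in> {0<..<1}" "a' \<le> Re a" "b' \<le> Re b"
  shows "norm (Beta_kernel a b x) \<le> x powr (a' - 1) * (1 - x) powr (b' - 1)"
  unfolding norm_Beta_kernel[OF assms(1)] using assms by (intro mult_mono powr_mono') auto

lemma continuous_on_Beta_kernel [continuous_intros]: "continuous_on {0<..<1} (Beta_kernel a b)"
  unfolding Beta_kernel_def by (intro continuous_intros continuous_on_of_real_powr) auto

lemma holomorphic_on_Beta_kernel: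
  "a holomorphic_on S \<Longrightarrow> b holomorphic_on S \<Longrightarrow> x \<in> {0<..<1} \<Longrightarrow> (\<lambda>z. Beta_kernel (a z) (b z) x) holomorphic_on S"
  unfolding Beta_kernel_def by (intro holomorphic_intros) auto

lemma Beta_kernel_of_real:
  assumes "x \<in> {0<..<1}"
  shows "Beta_kernel (of_real a) (of_real b) x = of_real (x powr (a - 1) * (1 - x) powr (b - 1))"
  using powr_of_real[of x "a - 1"] powr_of_real[of "1 - x" "b - 1"] assms by (simp add: Beta_kernel_def)

lemma Beta_kernel_shift:
  assumes "x \<in> {0<..<1}"
  shows "Beta_kernel (a + of_nat m) (b + of_nat n) x = Beta_kernel a b x * (of_real x ^ m * of_real (1 - x) ^ n)"
proof -
  have "complex_of_real y powr (c + of_nat k - 1) = of_real y powr (c - 1) * of_real y ^ k" if "y > 0" for y c k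
    using powr_add[of "complex_of_real y" "c - 1" "of_nat k"] that by (simp add: add_diff_eq diff_add_eq powr_nat')
  from this[of x a m] this[of "1 - x" b n] show ?thesis
    using assms by (simp only: Beta_kernel_def mult_ac) simp
qed

lemma set_integrable_Beta_kernel_bounded:
  assumes ab: "Re a > 0" "Re b > 0" and f: "continuous_on {0<..<1} f"
    and bound: "\<And>x. x \<in> {0<..<1} \<Longrightarrow> norm (f x) \<le> K"
  shows "set_integrable lborel {0<..<1} (\<lambda>x. Beta_kernel a b x * f x)"
    and "norm (LINT x:{0<..<1}|lborel. Beta_kernel a b x * f x) \<le> Beta (Re a) (Re b) * K"
proof -
  have dom: "set_integrable lborel {0<..<1} (\<lambda>x. x powr (Re a - 1) * (1 - x) powr (Re b - 1) * K)"
    by (intro set_integrable_mult_left set_integrable_Beta ab)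
  have le: "norm (Beta_kernel a b x * f x) \<le> x powr (Re a - 1) * (1 - x) powr (Re b - 1) * K"
    if "x \<in> {0<..<1}" for x
    unfolding norm_mult norm_Beta_kernel[OF that] using bound[OF that] by (intro mult_left_mono) auto
  have cont: "continuous_on {0<..<1} (\<lambda>x. Beta_kernel a b x * f x)" by (intro continuous_intros f)
  show "set_integrable lborel {0<..<1} (\<lambda>x. Beta_kernel a b x * f x)"
    by (rule set_integrable_dominated[OF dom _ cont le]) auto
  have "norm (LINT x:{0<..<1}|lborel. Beta_kernel a b x * f x)
      \<le> (LINT x:{0<..<1}|lborel. x powr (Re a - 1) * (1 - x) powr (Re b - 1) * K)"
    by (rule norm_set_integral_le[OF dom _ cont le]) auto
  also have "\<dots> = Beta (Re a) (Re b) * K" using Beta_set_integral_real[OF ab] by simp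
  finally show "norm (LINT x:{0<..<1}|lborel. Beta_kernel a b x * f x) \<le> Beta (Re a) (Re b) * K" .
qed

lemma set_integrable_Beta_kernel: "Re a > 0 \<Longrightarrow> Re b > 0 \<Longrightarrow> set_integrable lborel {0<..<1} (Beta_kernel a b)"
  using set_integrable_Beta_kernel_bounded(1)[of a b "\<lambda>_. 1" 1] by simp

lemma holomorphic_on_Beta_kernel_integral:
  assumes S: "open S" and a: "a holomorphic_on S" "\<And>z. z \<in> S \<Longrightarrow> Re (a z) > 0"
    and b: "b holomorphic_on S" "\<And>z. z \<in> S \<Longrightarrow> Re (b z) > 0"
    and cont: "\<And>z. z \<in> S \<Longrightarrow> continuous_on {0<..<1} (f z)"
    and hol: "\<And>x. x \<in> {0<..<1} \<Longrightarrow> (\<lambda>z. f z x) holomorphic_on S"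
    and bound: "\<And>z. z \<in> S \<Longrightarrow> \<exists>K. \<forall>\<^sub>F u in nhds z. \<forall>x\<in>{0<..<1}. norm (f u x) \<le> K"
  shows "(\<lambda>z. LINT x:{0<..<1}|lborel. Beta_kernel (a z) (b z) x * f z x) holomorphic_on S"
proof (rule holomorphic_on_set_integral[OF S])
  show "continuous_on {0<..<1} (\<lambda>x. Beta_kernel (a z) (b z) x * f z x)" if "z \<in> S" for z
    by (intro continuous_intros cont that)
  show "(\<lambda>z. Beta_kernel (a z) (b z) x * f z x) holomorphic_on S" if "x \<in> {0<..<1}" for x
    by (intro holomorphic_on_mult holomorphic_on_Beta_kernel hol a b that)
  fix z assume z: "z \<in> S"
  obtain K where K: "\<forall>\<^sub>F u in nhds z. \<forall>x\<in>{0<..<1}. norm (f u x) \<le> K" using bound[OF z] by blast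
  define r s where "r = Re (a z) / 2" and "s = Re (b z) / 2"
  have rs: "r > 0" "s > 0" "r < Re (a z)" "s < Re (b z)" using a b z by (auto simp: r_def s_def)
  have "\<forall>\<^sub>F u in nhds z. r < Re (a u)" "\<forall>\<^sub>F u in nhds z. s < Re (b u)"
    using rs by (auto intro!: order_tendstoD tendsto_Re tendsto_nhds_holomorphic[OF a(1) S z]
        tendsto_nhds_holomorphic[OF b(1) S z])
  with K have "\<forall>\<^sub>F u in nhds z. \<forall>x\<in>{0<..<1}. norm (Beta_kernel (a u) (b u) x * f u x)
      \<le> x powr (r - 1) * (1 - x) powr (s - 1) * K"
  proof eventually_elim
    case (elim u)
    show ?case
      unfolding norm_mult using elim by (intro ballI mult_mono norm_Beta_kernel_mono) auto
  qed
  moreover have "set_integrable lborel {0<..<1} (\<lambda>x. x powr (r - 1) * (1 - x) powr (s - 1) * K)"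
    by (intro set_integrable_mult_left set_integrable_Beta rs)
  ultimately show "\<exists>h. set_integrable lborel {0<..<1} h \<and>
      (\<forall>\<^sub>F u in nhds z. \<forall>x\<in>{0<..<1}. norm (Beta_kernel (a u) (b u) x * f u x) \<le> h x)"
    by blast
qed auto

lemma Beta_kernel_integral:
  assumes a: "Re a > 0" and b: "Re b > 0"
  shows "(LINT x:{0<..<1}|lborel. Beta_kernel a b x) = Beta a b"
proof -
  let ?S = "{z. Re z > 0}" and ?I = "\<lambda>a b. LINT x:{0<..<1}|lborel. Beta_kernel a b x"
  have S: "open ?S" "connected ?S"
    by (simp_all add: open_halfspace_Re_gt convex_connected convex_halfspace_Re_gt)
  have hol: "(\<lambda>z. LINT x:{0<..<1}|lborel. Beta_kernel (a z) (b z) x) holomorphic_on ?S"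
    if "a holomorphic_on ?S" "\<And>z. z \<in> ?S \<Longrightarrow> Re (a z) > 0" "b holomorphic_on ?S" "\<And>z. z \<in> ?S \<Longrightarrow> Re (b z) > 0" for a b
  proof -
    have "(\<lambda>z. LINT x:{0<..<1}|lborel. Beta_kernel (a z) (b z) x * 1) holomorphic_on ?S"
      by (rule holomorphic_on_Beta_kernel_integral[OF S(1) that]) (auto intro: exI[of _ "1::real"])
    thus ?thesis by (simp only: mult_1_right)
  qed
  have hol_left: "(\<lambda>a. ?I a b) holomorphic_on ?S" if "Re b > 0" for b
    by (rule hol) (use that in auto)
  have hol_right: "(\<lambda>b. ?I a b) holomorphic_on ?S" if "Re a > 0" for a
    by (rule hol) (use that in auto)
  have Beta_hol: "(\<lambda>z. Beta z c) holomorphic_on ?S" "(\<lambda>z. Beta c z) holomorphic_on ?S" if "Re c > 0" for c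
    by (rule holomorphic_Beta; use that in \<open>auto intro!: holomorphic_intros Re_pos_notin_nonpos_Ints\<close>)+
  have real: "?I (of_real r) (of_real s) = Beta (of_real r) (of_real s)" if "r > 0" "s > 0" for r s
  proof -
    have "?I (of_real r) (of_real s) = (LINT x:{0<..<1}|lborel. of_real (x powr (r - 1) * (1 - x) powr (s - 1)))"
      by (intro set_lebesgue_integral_cong allI impI Beta_kernel_of_real) auto
    also have "\<dots> = of_real (Beta r s)"
      unfolding set_integral_complex_of_real Beta_set_integral_real[OF that] ..
    finally show ?thesis by (simp add: Beta_complex_of_real)
  qed
  have "?I a (of_real s) = Beta a (of_real s)" if s: "s > 0" for s
  proof (rule holomorphic_eq_on_segment[where f = "\<lambda>a. ?I a (of_real s)" and l = 0 and r = 1 and v = 1, OF _ _ S])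
    show "(\<lambda>a. ?I a (of_real s)) holomorphic_on ?S" by (rule hol_left) (use s in simp)
    show "(\<lambda>a. Beta a (of_real s)) holomorphic_on ?S" by (rule Beta_hol(1)) (use s in simp)
  qed (use a s real in auto)
  thus "?I a b = Beta a b"
    by (intro holomorphic_eq_on_segment[where f = "?I a" and l = 0 and r = 1 and v = 1, OF hol_right[OF a] Beta_hol(2)[OF a] S])
       (use b in auto)
qed

section \<open>The regularised hypergeometric function\<close>

definition hyp_coeff :: "complex \<Rightarrow> complex \<Rightarrow> complex \<Rightarrow> nat \<Rightarrow> complex" where
  "hyp_coeff a b c n = pochhammer a n * pochhammer b n * rGamma (c + of_nat n) / fact n"

lemma hyp_series_eq_suminf_hyp_coeff: "hyp_series a b c w = (\<Sum>n. hyp_coeff a b c n * w ^ n)"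
  by (simp add: hyp_series_def hyp_coeff_def)

lemma hyp_coeff_Suc:
  "hyp_coeff a b c (Suc n) * ((c + of_nat n) * of_nat (Suc n)) =
     hyp_coeff a b c n * ((a + of_nat n) * (b + of_nat n))"
proof -
  have "rGamma (c + of_nat n) = (c + of_nat n) * rGamma (c + of_nat (Suc n))"
    using rGamma_plus1[of "c + of_nat n"] by (simp add: add_ac)
  thus ?thesis
    by (simp add: hyp_coeff_def pochhammer_Suc field_simps del: of_nat_Suc)
qed

lemma diffs_hyp_coeff: "diffs (hyp_coeff a b c) n = a * b * hyp_coeff (a + 1) (b + 1) (c + 1) n"
proof -
  have shift: "c + of_nat (Suc n) = c + 1 + of_nat n" by simp
  have "(of_nat (Suc n) :: complex) \<noteq> 0" by (simp del: of_nat_Suc)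
  thus ?thesis unfolding diffs_def hyp_coeff_def pochhammer_rec fact_Suc shift
    by (simp add: field_simps del: of_nat_Suc)
qed

lemma hyp_coeff_lower_c: "hyp_coeff a b (c - 1) n = (c - 1 + of_nat n) * hyp_coeff a b c n"
proof -
  have "rGamma (c - 1 + of_nat n) = (c - 1 + of_nat n) * rGamma (c + of_nat n)"
    using rGamma_plus1[of "c - 1 + of_nat n"] by (simp add: algebra_simps)
  thus ?thesis by (simp only: hyp_coeff_def) simp
qed

lemma norm_pochhammer_le: "norm a \<le> A \<Longrightarrow> norm (pochhammer (a::complex) n) \<le> pochhammer A n"
  unfolding pochhammer_prod prod_norm[symmetric]
  by (rule prod_mono) (auto intro: order_trans[OF norm_triangle_ineq])

lemma hyp_coeff_bounded:
  fixes A :: real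
  obtains B where "B \<ge> 0"
    "\<And>a b c. norm a \<le> A \<Longrightarrow> norm b \<le> A \<Longrightarrow> norm c \<le> A \<Longrightarrow> norm (hyp_coeff a b c n) \<le> B"
proof -
  have "bounded (rGamma ` cball (0::complex) (A + real n))"
    by (intro compact_imp_bounded compact_continuous_image holomorphic_on_imp_continuous_on
        holomorphic_rGamma) auto
  then obtain K where K: "K > 0" "\<And>z::complex. norm z \<le> A + real n \<Longrightarrow> norm (rGamma z) \<le> K"
    by (auto simp: bounded_pos)
  have "norm (hyp_coeff a b c n) \<le> \<bar>pochhammer A n * pochhammer A n * K / fact n\<bar>"
    if abc: "norm a \<le> A" "norm b \<le> A" "norm c \<le> A" for a b c
  proof -
    have "norm (c + of_nat n) \<le> A + real n" using norm_triangle_ineq[of c "of_nat n"] abc by simp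
    hence "norm (hyp_coeff a b c n) \<le> pochhammer A n * pochhammer A n * K / fact n"
      unfolding hyp_coeff_def norm_mult norm_divide norm_fact
      using norm_pochhammer_le[of a A n] norm_pochhammer_le[of b A n] abc K
      by (intro divide_right_mono mult_mono mult_nonneg_nonneg)
         (auto intro: order_trans[OF norm_ge_zero norm_pochhammer_le])
    thus ?thesis by (rule order_trans[OF _ abs_ge_self])
  qed
  thus ?thesis by (intro that[of "\<bar>pochhammer A n * pochhammer A n * K / fact n\<bar>"]) auto
qed

lemma norm_hyp_coeff_Suc_le:
  fixes A :: real
  assumes abc: "norm a \<le> A" "norm b \<le> A" "norm c \<le> A" and n: "real n > A"
  shows "norm (hyp_coeff a b c (Suc n)) \<le>
    norm (hyp_coeff a b c n) * ((real n + A)\<^sup>2 / ((real n - A) * (real n + 1)))"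
proof -
  have A: "A \<ge> 0" using abc(1) norm_ge_zero order_trans by blast
  have "real n - A \<le> norm (c + of_nat n)"
    using norm_triangle_ineq2[of "of_nat n" "- c"] abc by (simp add: add.commute)
  hence "norm (hyp_coeff a b c (Suc n)) * ((real n - A) * (real n + 1)) \<le>
      norm (hyp_coeff a b c (Suc n)) * (norm (c + of_nat n) * (real n + 1))"
    by (intro mult_left_mono mult_right_mono) auto
  also have "\<dots> = norm (hyp_coeff a b c (Suc n) * ((c + of_nat n) * of_nat (Suc n)))"
    by (simp only: norm_mult norm_of_nat) (simp add: add.commute)
  also have "\<dots> = norm (hyp_coeff a b c n) * (norm (a + of_nat n) * norm (b + of_nat n))"
    unfolding hyp_coeff_Suc by (simp add: norm_mult)
  also have "\<dots> \<le> norm (hyp_coeff a b c n) * (real n + A)\<^sup>2"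
    using norm_triangle_ineq[of a "of_nat n"] norm_triangle_ineq[of b "of_nat n"] abc A n
    by (intro mult_left_mono) (auto simp: power2_eq_square intro!: mult_mono)
  finally show ?thesis
    using n A by (simp only: times_divide_eq_right) (subst pos_le_divide_eq, auto)
qed

lemma hyp_coeff_ratio_eventually_less:
  fixes A R :: real
  assumes "R > 1"
  obtains m where "\<And>n. n \<ge> m \<Longrightarrow> (real n + A)\<^sup>2 / ((real n - A) * (real n + 1)) < R" "\<And>n. n \<ge> m \<Longrightarrow> real n > A"
proof -
  have "((\<lambda>n. (real n + A)\<^sup>2 / ((real n - A) * (real n + 1))) \<longlongrightarrow> 1) sequentially"
    by real_asymp
  hence "\<forall>\<^sub>F n in sequentially. (real n + A)\<^sup>2 / ((real n - A) * (real n + 1)) < R"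
    using assms by (rule order_tendstoD)
  moreover have "\<forall>\<^sub>F n in sequentially. real n > A" by real_asymp
  ultimately have "\<forall>\<^sub>F n in sequentially. (real n + A)\<^sup>2 / ((real n - A) * (real n + 1)) < R \<and> real n > A"
    by eventually_elim auto
  thus ?thesis using that by (auto simp: eventually_sequentially)
qed

lemma hyp_coeff_bounded_up_to:
  fixes A :: real and m :: nat
  obtains K where "K \<ge> 0"
    "\<And>a b c n. norm a \<le> A \<Longrightarrow> norm b \<le> A \<Longrightarrow> norm c \<le> A \<Longrightarrow> n \<le> m \<Longrightarrow> norm (hyp_coeff a b c n) \<le> K"
proof -
  have "\<exists>B\<ge>0. \<forall>a b c. norm a \<le> A \<longrightarrow> norm b \<le> A \<longrightarrow> norm c \<le> A \<longrightarrow> norm (hyp_coeff a b c n) \<le> B" for n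
    by (rule hyp_coeff_bounded[of A n]) blast
  then obtain B where B: "\<And>n. B n \<ge> 0"
      "\<And>n a b c. norm a \<le> A \<Longrightarrow> norm b \<le> A \<Longrightarrow> norm c \<le> A \<Longrightarrow> norm (hyp_coeff a b c n) \<le> B n" by metis
  have "B n \<le> (\<Sum>n\<le>m. B n)" if "n \<le> m" for n
    using B(1) that by (intro member_le_sum) auto
  hence "norm (hyp_coeff a b c n) \<le> (\<Sum>n\<le>m. B n)" if "norm a \<le> A" "norm b \<le> A" "norm c \<le> A" "n \<le> m" for a b c n
    using B(2)[OF that(1-3), of n] that(4) by (meson order_trans)
  thus ?thesis using B(1) by (intro that[of "\<Sum>n\<le>m. B n"] sum_nonneg)
qed

lemma hyp_coeff_geometric_bound:
  fixes A R :: real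
  assumes R: "R > 1"
  obtains K where "\<And>a b c n. norm a \<le> A \<Longrightarrow> norm b \<le> A \<Longrightarrow> norm c \<le> A \<Longrightarrow> norm (hyp_coeff a b c n) \<le> K * R ^ n"
proof -
  obtain m where ratio: "\<And>n. n \<ge> m \<Longrightarrow> (real n + A)\<^sup>2 / ((real n - A) * (real n + 1)) < R"
    and gt: "\<And>n. n \<ge> m \<Longrightarrow> real n > A"
    using hyp_coeff_ratio_eventually_less[OF R, of A] by blast
  obtain K where K: "K \<ge> 0" and initial: "\<And>a b c n. norm a \<le> A \<Longrightarrow> norm b \<le> A \<Longrightarrow> norm c \<le> A \<Longrightarrow> n \<le> m \<Longrightarrow>
      norm (hyp_coeff a b c n) \<le> K"
    using hyp_coeff_bounded_up_to[of A m] by blast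
  have "norm (hyp_coeff a b c n) \<le> K * R ^ n" if abc: "norm a \<le> A" "norm b \<le> A" "norm c \<le> A" for a b c n
  proof (induction n)
    case 0
    show ?case using initial[OF abc, of 0] by simp
  next
    case (Suc n)
    show ?case
    proof (cases "Suc n \<le> m")
      case True
      have "norm (hyp_coeff a b c (Suc n)) \<le> K" by (rule initial[OF abc True])
      also have "\<dots> \<le> K * R ^ Suc n" using K R one_le_power[of R "Suc n"] by (simp add: mult_le_cancel_left1)
      finally show ?thesis .
    next
      case False
      hence n: "m \<le> n" by simp
      have "norm (hyp_coeff a b c (Suc n)) \<le>
          norm (hyp_coeff a b c n) * ((real n + A)\<^sup>2 / ((real n - A) * (real n + 1)))"
        by (rule norm_hyp_coeff_Suc_le[OF abc gt[OF n]])
      also have "\<dots> \<le> norm (hyp_coeff a b c n) * R" using ratio[OF n] by (intro mult_left_mono) auto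
      also have "\<dots> \<le> K * R ^ n * R" using Suc.IH R by (intro mult_right_mono) auto
      finally show ?thesis by (simp add: mult_ac)
    qed
  qed
  thus ?thesis by (rule that)
qed

lemma hyp_coeff_majorant:
  fixes A q :: real
  assumes "0 \<le> q" "q < 1"
  obtains M where "summable M" and
    "\<And>a b c w n. norm a \<le> A \<Longrightarrow> norm b \<le> A \<Longrightarrow> norm c \<le> A \<Longrightarrow> norm w \<le> q \<Longrightarrow> norm (hyp_coeff a b c n * w ^ n) \<le> M n"
proof -
  obtain p where p: "q < p" "p < 1" using assms dense by blast
  hence p0: "p > 0" using assms by simp
  obtain B where B: "\<And>a b c n. norm a \<le> A \<Longrightarrow> norm b \<le> A \<Longrightarrow> norm c \<le> A \<Longrightarrow> norm (hyp_coeff a b c n) \<le> B * (1 / p) ^ n"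
    using hyp_coeff_geometric_bound[of "1 / p" A] p p0 by auto
  have "summable (\<lambda>n. B * (q / p) ^ n)"
    using p p0 assms by (intro summable_mult summable_geometric) simp
  moreover have "norm (hyp_coeff a b c n * w ^ n) \<le> B * (q / p) ^ n"
    if "norm a \<le> A" "norm b \<le> A" "norm c \<le> A" "norm w \<le> q" for a b c w n
  proof -
    have "norm (hyp_coeff a b c n) * norm w ^ n \<le> (B * (1 / p) ^ n) * q ^ n"
      using that by (intro mult_mono B power_mono) (auto intro: order_trans[OF norm_ge_zero B])
    thus ?thesis by (simp add: norm_mult norm_power power_divide)
  qed
  ultimately show ?thesis using that by blast
qed

lemma summable_hyp_series:
  assumes "norm w < 1"
  shows "summable (\<lambda>n. hyp_coeff a b c n * w ^ n)"
proof -
  define A where "A = norm a + norm b + norm c"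
  obtain M where M_sum: "summable M" and M: "\<And>a b c v n. norm a \<le> A \<Longrightarrow> norm b \<le> A \<Longrightarrow> norm c \<le> A \<Longrightarrow>
      norm v \<le> norm w \<Longrightarrow> norm (hyp_coeff a b c n * v ^ n) \<le> M n"
    using hyp_coeff_majorant[OF norm_ge_zero assms] by blast
  have "norm (hyp_coeff a b c n * w ^ n) \<le> M n" for n by (rule M) (simp_all add: A_def)
  thus ?thesis by (rule summable_comparison_test'[OF M_sum])
qed

lemma holomorphic_on_hyp_series:
  assumes S: "open S" and hol: "a holomorphic_on S" "b holomorphic_on S" "c holomorphic_on S" "w holomorphic_on S"
    and w: "\<And>t. t \<in> S \<Longrightarrow> norm (w t) < 1"
  shows "(\<lambda>t. hyp_series (a t) (b t) (c t) (w t)) holomorphic_on S"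
proof (rule holomorphic_uniform_sequence[OF S, of "\<lambda>n t. \<Sum>i<n. hyp_coeff (a t) (b t) (c t) i * w t ^ i"])
  show "(\<lambda>t. \<Sum>i<n. hyp_coeff (a t) (b t) (c t) i * w t ^ i) holomorphic_on S" for n
    unfolding hyp_coeff_def pochhammer_prod by (intro holomorphic_intros hol) auto
  fix u assume u: "u \<in> S"
  then obtain d where d: "d > 0" "cball u d \<subseteq> S" using S open_contains_cball by blast
  have cont: "continuous_on (cball u d) f" if "f holomorphic_on S" for f
    by (intro holomorphic_on_imp_continuous_on holomorphic_on_subset[OF that d(2)])
  have "continuous_on (cball u d) (\<lambda>t. norm (a t) + norm (b t) + norm (c t))"
    and "continuous_on (cball u d) (\<lambda>t. norm (w t))"
    by (intro continuous_intros cont hol)+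
  then obtain s t where s: "\<forall>r\<in>cball u d. norm (a r) + norm (b r) + norm (c r) \<le>
      norm (a s) + norm (b s) + norm (c s)"
      and t: "t \<in> cball u d" "\<forall>r\<in>cball u d. norm (w r) \<le> norm (w t)"
    using d(1) continuous_attains_sup[OF compact_cball, of u d] by fastforce
  define A where "A = norm (a s) + norm (b s) + norm (c s)"
  have A: "norm (a r) + norm (b r) + norm (c r) \<le> A" if "r \<in> cball u d" for r
    using s that by (simp add: A_def)
  have q: "norm (w t) < 1" using t d w by blast
  obtain M where M: "summable M" "\<And>a b c v n. norm a \<le> A \<Longrightarrow> norm b \<le> A \<Longrightarrow> norm c \<le> A \<Longrightarrow>
      norm v \<le> norm (w t) \<Longrightarrow> norm (hyp_coeff a b c n * v ^ n) \<le> M n"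
    using hyp_coeff_majorant[OF norm_ge_zero q] by blast
  have "uniform_limit (cball u d) (\<lambda>n t. \<Sum>i<n. hyp_coeff (a t) (b t) (c t) i * w t ^ i)
           (\<lambda>t. hyp_series (a t) (b t) (c t) (w t)) sequentially"
    unfolding hyp_series_eq_suminf_hyp_coeff
  proof (rule Weierstrass_m_test[OF _ M(1)])
    fix n r assume r: "r \<in> cball u d"
    hence "norm (a r) \<le> A" "norm (b r) \<le> A" "norm (c r) \<le> A"
      using A[OF r] norm_ge_zero[of "a r"] norm_ge_zero[of "b r"] norm_ge_zero[of "c r"] by linarith+
    thus "norm (hyp_coeff (a r) (b r) (c r) n * w r ^ n) \<le> M n" using t(2) r by (intro M(2)) auto
  qed
  with d show "\<exists>d>0. cball u d \<subseteq> S \<and> uniform_limit (cball u d)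
            (\<lambda>n t. \<Sum>i<n. hyp_coeff (a t) (b t) (c t) i * w t ^ i)
            (\<lambda>t. hyp_series (a t) (b t) (c t) (w t)) sequentially"
    by blast
qed

lemma diffs_hyp_coeff_sums:
  assumes "norm w < 1"
  shows "(\<lambda>n. diffs (hyp_coeff a b c) n * w ^ n) sums (a * b * hyp_series (a + 1) (b + 1) (c + 1) w)"
  unfolding diffs_hyp_coeff hyp_series_eq_suminf_hyp_coeff mult.assoc[of "a * b"]
  by (intro sums_mult summable_sums summable_hyp_series assms)

lemma hyp_series_deriv:
  assumes "norm w < 1"
  shows "(hyp_series a b c has_field_derivative a * b * hyp_series (a + 1) (b + 1) (c + 1) w) (at w)"
  using termdiffs_strong'[OF summable_hyp_series assms, of a b c] diffs_hyp_coeff_sums[OF assms, of a b c]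
  by (simp add: hyp_series_eq_suminf_hyp_coeff[abs_def] sums_iff)

lemma hyp_series_lower_c:
  assumes "norm w < 1"
  shows "hyp_series a b (c - 1) w =
      (c - 1) * hyp_series a b c w + w * (a * b * hyp_series (a + 1) (b + 1) (c + 1) w)"
proof -
  let ?h = "hyp_coeff a b c"
  have "(\<lambda>n. of_nat (Suc n) * ?h (Suc n) * w ^ Suc n) sums (w * (a * b * hyp_series (a + 1) (b + 1) (c + 1) w))"
    using sums_mult[OF diffs_hyp_coeff_sums[OF assms, of a b c], of w] by (simp add: diffs_def mult_ac)
  hence "(\<lambda>n. of_nat n * ?h n * w ^ n) sums (w * (a * b * hyp_series (a + 1) (b + 1) (c + 1) w))"
    by (subst (asm) sums_Suc_iff) simp
  moreover have "(\<lambda>n. (c - 1) * (?h n * w ^ n)) sums ((c - 1) * hyp_series a b c w)"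
    unfolding hyp_series_eq_suminf_hyp_coeff by (intro sums_mult summable_sums summable_hyp_series assms)
  ultimately have "(\<lambda>n. (c - 1) * (?h n * w ^ n) + of_nat n * ?h n * w ^ n) sums
      ((c - 1) * hyp_series a b c w + w * (a * b * hyp_series (a + 1) (b + 1) (c + 1) w))"
    by (intro sums_add)
  moreover have "(c - 1) * (?h n * w ^ n) + of_nat n * ?h n * w ^ n = hyp_coeff a b (c - 1) n * w ^ n" for n
    unfolding hyp_coeff_lower_c by (simp add: algebra_simps)
  ultimately show ?thesis by (simp add: hyp_series_eq_suminf_hyp_coeff[of a b "c - 1"] sums_iff)
qed

definition cut_plane :: "complex set" where
  "cut_plane = - complex_of_real ` {1..}"

lemma cut_plane_iff: "w \<in> cut_plane \<longleftrightarrow> 1 - w \<notin> \<real>\<^sub>\<le>\<^sub>0"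
  by (auto simp: cut_plane_def complex_nonpos_Reals_iff complex_eq_iff image_iff)

lemma open_cut_plane: "open cut_plane"
proof -
  have "cut_plane = (\<lambda>w. 1 - w) -` (- \<real>\<^sub>\<le>\<^sub>0)" by (auto simp: cut_plane_iff)
  moreover have "open ((\<lambda>w::complex. 1 - w) -` (- \<real>\<^sub>\<le>\<^sub>0))"
    by (intro open_vimage open_slit_plane continuous_intros)
  ultimately show ?thesis by simp
qed

lemma starlike_cut_plane: "starlike cut_plane"
  using starlike_slotted_complex_plane_right[of 1] by (simp add: cut_plane_def)

lemma connected_cut_plane: "connected cut_plane"
  by (rule starlike_imp_connected[OF starlike_cut_plane])

lemma one_minus_mult_notin_nonpos_Reals:
  assumes w: "w \<in> cut_plane" and s: "0 \<le> s" "s \<le> 1"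
  shows "1 - w * of_real s \<notin> \<real>\<^sub>\<le>\<^sub>0"
proof
  assume "1 - w * of_real s \<in> \<real>\<^sub>\<le>\<^sub>0"
  hence "Im w * s = 0" "Re w * s \<ge> 1" by (auto simp: complex_nonpos_Reals_iff)
  moreover from this have "s > 0" using s by (cases "s = 0") auto
  moreover from this have "Re w \<ge> 1"
    using s \<open>Re w * s \<ge> 1\<close> by (smt (verit) mult_left_le mult_nonneg_nonpos2)
  ultimately show False using w by (auto simp: cut_plane_iff complex_nonpos_Reals_iff)
qed

lemma ball_subset_cut_plane: "norm w < 1 \<Longrightarrow> w \<in> cut_plane"
  using complex_Re_le_cmod[of w] by (auto simp: cut_plane_iff complex_nonpos_Reals_iff)

lemma Euler_weight_locally_bounded:
  assumes w: "w \<in> cut_plane"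
  shows "\<exists>K. \<forall>\<^sub>F u in nhds w. \<forall>s\<in>{0<..<1}. norm ((1 - u * complex_of_real s) powr a) \<le> K"
proof -
  obtain e where e: "e > 0" "cball w e \<subseteq> cut_plane" using w open_cut_plane open_contains_cball by blast
  let ?f = "\<lambda>(u, s). (1 - u * complex_of_real s) powr a"
  have "continuous_on (cball w e \<times> {0..1}) ?f"
    unfolding case_prod_beta using e(2) one_minus_mult_notin_nonpos_Reals
    by (intro continuous_on_powr_slit continuous_intros) (auto simp: subset_iff)
  hence "bounded (?f ` (cball w e \<times> {0..1}))"
    by (intro compact_imp_bounded compact_continuous_image compact_Times) auto
  then obtain K where K: "\<And>u s. u \<in> cball w e \<Longrightarrow> s \<in> {0..1} \<Longrightarrow> norm (?f (u, s)) \<le> K"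
    by (force simp: bounded_iff)
  have "\<forall>\<^sub>F u in nhds w. u \<in> ball w e" using e(1) by (intro eventually_nhds_in_open) auto
  hence "\<forall>\<^sub>F u in nhds w. \<forall>s\<in>{0<..<1}. norm ((1 - u * complex_of_real s) powr a) \<le> K"
    by eventually_elim (use K in force)
  thus ?thesis ..
qed

lemma continuous_on_Euler_weight:
  assumes "w \<in> cut_plane"
  shows "continuous_on {0<..<1} (\<lambda>s. (1 - w * complex_of_real s) powr a)"
  using one_minus_mult_notin_nonpos_Reals[OF assms] by (intro continuous_on_powr_slit continuous_intros) auto

lemma set_integrable_Euler:
  assumes "Re b > 0" "Re d > 0" "w \<in> cut_plane"
  shows "set_integrable lborel {0<..<1} (\<lambda>s. Beta_kernel b d s * (1 - w * of_real s) powr (- a))"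
proof -
  obtain K where "\<forall>\<^sub>F u in nhds w. \<forall>s\<in>{0<..<1}. norm ((1 - u * complex_of_real s) powr (- a)) \<le> K"
    using Euler_weight_locally_bounded[OF assms(3)] by blast
  hence "\<forall>s\<in>{0<..<1}. norm ((1 - w * complex_of_real s) powr (- a)) \<le> K" by (rule eventually_nhds_x_imp_x)
  thus ?thesis using assms by (intro set_integrable_Beta_kernel_bounded continuous_on_Euler_weight) auto
qed

lemma holomorphic_on_Euler_integral:
  assumes b: "Re b > 0" and d: "Re d > 0"
  shows "(\<lambda>w. LINT s:{0<..<1}|lborel. Beta_kernel b d s * (1 - w * of_real s) powr (- a)) holomorphic_on cut_plane"
proof (rule holomorphic_on_Beta_kernel_integral[OF open_cut_plane])
  fix s :: real assume "s \<in> {0<..<1}"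
  thus "(\<lambda>w. (1 - w * of_real s) powr (- a)) holomorphic_on cut_plane"
    using one_minus_mult_notin_nonpos_Reals by (intro holomorphic_intros) auto
qed (use b d continuous_on_Euler_weight Euler_weight_locally_bounded in auto)

lemma binomial_series_complex:
  assumes "norm z < 1"
  shows "(\<lambda>n. pochhammer a n / fact n * z ^ n) sums (1 - z) powr (- a :: complex)"
proof -
  have "(- a gchoose n) * (- z) ^ n = pochhammer a n / fact n * z ^ n" for n
  proof -
    have "(- a gchoose n) * (- z) ^ n = ((- 1) ^ n * (- 1) ^ n) * (pochhammer a n / fact n * z ^ n)"
      by (simp only: gbinomial_pochhammer power_minus[of z n] minus_minus times_divide_eq_left
          times_divide_eq_right mult_ac)
    thus ?thesis by (simp flip: power_mult_distrib)
  qed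
  thus ?thesis using gen_binomial_complex[of "- z" "- a"] assms by simp
qed

lemma summable_norm_binomial_series:
  assumes "norm z < 1"
  shows "summable (\<lambda>n. norm (pochhammer (a::complex) n / fact n * z ^ n))"
proof -
  obtain r where r: "norm z < r" "r < 1" using assms dense by blast
  hence "r > 0" using norm_ge_zero le_less_trans by blast
  hence "summable (\<lambda>n. pochhammer a n / fact n * (of_real r) ^ n)"
    using binomial_series_complex[of "of_real r"] r by (auto simp: sums_iff)
  thus ?thesis by (rule powser_insidea) (use r \<open>r > 0\<close> in auto)
qed

lemma Beta_kernel_integral_power_series:
  assumes b: "Re b > 0" and d: "Re d > 0" and k: "summable (\<lambda>n. norm (k n))"
  shows "(LINT s:{0<..<1}|lborel. Beta_kernel b d s * (\<Sum>n. k n * of_real s ^ n)) =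
      (\<Sum>n. k n * Beta (b + of_nat n) d)"
proof -
  have "(LINT s:{0<..<1}|lborel. Beta_kernel b d s * of_real s ^ n) = Beta (b + of_nat n) d" for n
  proof -
    have "(LINT s:{0<..<1}|lborel. Beta_kernel b d s * of_real s ^ n) =
        (LINT s:{0<..<1}|lborel. Beta_kernel (b + of_nat n) d s)"
      using Beta_kernel_shift[of _ b n d 0] by (intro set_lebesgue_integral_cong) auto
    also have "\<dots> = Beta (b + of_nat n) d" using b d by (intro Beta_kernel_integral) auto
    finally show ?thesis .
  qed
  moreover have "{0<..<1} \<subseteq> {-1..1::real}" by auto
  ultimately show ?thesis
    using set_integral_mult_power_series[OF set_integrable_Beta_kernel[OF b d] _ k] by simp
qed

lemma Euler_integral:
  assumes b: "Re b > 0" and d: "Re (c - b) > 0" and w: "norm w < 1"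
  shows "(LINT s:{0<..<1}|lborel. Beta_kernel b (c - b) s * (1 - w * of_real s) powr (- a)) =
    Gamma b * Gamma (c - b) * hyp_series a b c w"
proof -
  let ?k = "\<lambda>n. pochhammer a n / fact n * w ^ n"
  have "(1 - w * of_real s) powr (- a) = (\<Sum>n. ?k n * of_real s ^ n)" if s: "s \<in> {0<..<1}" for s
  proof -
    have "norm (w * of_real s) < 1 * 1" unfolding norm_mult using s w by (intro mult_strict_mono') auto
    thus ?thesis using binomial_series_complex[of "w * of_real s" a]
      by (simp add: sums_iff power_mult_distrib mult.assoc)
  qed
  hence "(LINT s:{0<..<1}|lborel. Beta_kernel b (c - b) s * (1 - w * of_real s) powr (- a)) =
      (LINT s:{0<..<1}|lborel. Beta_kernel b (c - b) s * (\<Sum>n. ?k n * of_real s ^ n))"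
    by (intro set_lebesgue_integral_cong) auto
  also have "\<dots> = (\<Sum>n. ?k n * Beta (b + of_nat n) (c - b))"
    by (rule Beta_kernel_integral_power_series[OF b d summable_norm_binomial_series[OF w]])
  also have "(\<lambda>n. ?k n * Beta (b + of_nat n) (c - b)) =
      (\<lambda>n. Gamma b * Gamma (c - b) * (hyp_coeff a b c n * w ^ n))"
  proof
    fix n
    have "Gamma (b + of_nat n) = pochhammer b n * Gamma b"
      using pochhammer_Gamma[OF Re_pos_notin_nonpos_Ints[OF b], of n] Gamma_nonzero_Re_pos[OF b] by simp
    thus "?k n * Beta (b + of_nat n) (c - b) = Gamma b * Gamma (c - b) * (hyp_coeff a b c n * w ^ n)"
      by (simp add: hyp_coeff_def Beta_altdef add_ac)
  qed
  also have "(\<Sum>n. Gamma b * Gamma (c - b) * (hyp_coeff a b c n * w ^ n)) =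
      Gamma b * Gamma (c - b) * hyp_series a b c w"
    unfolding hyp_series_eq_suminf_hyp_coeff by (rule suminf_mult[OF summable_hyp_series[OF w]])
  finally show ?thesis .
qed

definition hyp_series_continues :: "complex \<Rightarrow> complex \<Rightarrow> complex \<Rightarrow> bool" where
  "hyp_series_continues a b c \<longleftrightarrow>
     (\<exists>f. f holomorphic_on cut_plane \<and> (\<forall>v. norm v < 1 \<longrightarrow> f v = hyp_series a b c v))"

lemma hyp_series_continues_Euler:
  assumes b: "Re b > 0" and d: "Re (c - b) > 0"
  shows "hyp_series_continues a b c"
proof -
  let ?f = "\<lambda>w. (LINT s:{0<..<1}|lborel. Beta_kernel b (c - b) s * (1 - w * of_real s) powr (- a)) /
      (Gamma b * Gamma (c - b))"
  have nz: "Gamma b * Gamma (c - b) \<noteq> 0" using b d Gamma_nonzero_Re_pos by simp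
  have "?f holomorphic_on cut_plane"
    by (intro holomorphic_on_divide holomorphic_on_const holomorphic_on_Euler_integral assms nz)
  moreover have "?f v = hyp_series a b c v" if "norm v < 1" for v
    unfolding Euler_integral[OF b d that] using nz by simp
  ultimately show ?thesis unfolding hyp_series_continues_def by blast
qed

lemma hyp_series_continues_lower_c:
  assumes "hyp_series_continues a b c"
  shows "hyp_series_continues a b (c - 1)"
proof -
  obtain f where f: "f holomorphic_on cut_plane" "\<And>v. norm v < 1 \<Longrightarrow> f v = hyp_series a b c v"
    using assms by (auto simp: hyp_series_continues_def)
  have "(c - 1) * f v + v * deriv f v = hyp_series a b (c - 1) v" if v: "norm v < 1" for v
  proof -
    have "(f has_field_derivative a * b * hyp_series (a + 1) (b + 1) (c + 1) v) (at v)"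
      by (rule has_field_derivative_transform_within_open[OF hyp_series_deriv[OF v], of "ball 0 1"])
         (use v f in auto)
    thus ?thesis using f(2)[OF v] by (simp add: DERIV_imp_deriv hyp_series_lower_c[OF v])
  qed
  moreover have "(\<lambda>w. (c - 1) * f w + w * deriv f w) holomorphic_on cut_plane"
    by (intro holomorphic_intros f holomorphic_deriv open_cut_plane)
  ultimately show ?thesis unfolding hyp_series_continues_def by blast
qed

lemma hyp_series_continues_primitive:
  assumes "hyp_series_continues (a + 1) (b + 1) (c + 1)"
  shows "hyp_series_continues a b c"
proof -
  obtain f where f: "f holomorphic_on cut_plane" "\<And>v. norm v < 1 \<Longrightarrow> f v = hyp_series (a + 1) (b + 1) (c + 1) v"
    using assms by (auto simp: hyp_series_continues_def)
  have hol: "(\<lambda>w. a * b * f w) holomorphic_on cut_plane" by (intro holomorphic_intros f)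
  obtain G where G: "\<And>w. w \<in> cut_plane \<Longrightarrow> (G has_field_derivative a * b * f w) (at w)"
    using holomorphic_starlike_primitive[OF holomorphic_on_imp_continuous_on[OF hol] starlike_cut_plane open_cut_plane finite.emptyI]
      holomorphic_on_imp_differentiable_at[OF hol open_cut_plane] by auto
  have "\<exists>k. \<forall>v\<in>ball 0 1. G v - hyp_series a b c v = k"
  proof (rule has_field_derivative_zero_constant)
    fix v :: complex assume "v \<in> ball 0 1"
    hence v: "norm v < 1" by simp
    have "((\<lambda>v. G v - hyp_series a b c v) has_field_derivative (a * b * f v - a * b * f v)) (at v)"
      using G[OF ball_subset_cut_plane[OF v]] hyp_series_deriv[OF v, of a b c] f(2)[OF v]
      by (intro derivative_intros) auto
    thus "((\<lambda>v. G v - hyp_series a b c v) has_field_derivative 0) (at v within ball 0 1)"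
      by (auto intro: has_field_derivative_at_within)
  qed auto
  then obtain k where "\<And>v. norm v < 1 \<Longrightarrow> G v - k = hyp_series a b c v" by (auto simp: algebra_simps)
  moreover have "(\<lambda>w. G w - k) holomorphic_on cut_plane"
    using G by (intro holomorphic_intros) (auto simp: holomorphic_on_open[OF open_cut_plane])
  ultimately show ?thesis unfolding hyp_series_continues_def by blast
qed

lemma hyp_series_continues: "hyp_series_continues a b c"
proof -
  have lower: "hyp_series_continues a b (c + of_nat n) \<Longrightarrow> hyp_series_continues a b c" for a b c n
  proof (induction n)
    case (Suc n)
    thus ?case using hyp_series_continues_lower_c[of a b "c + of_nat (Suc n)"] by (simp add: algebra_simps)
  qed simp
  have primitive: "hyp_series_continues (a + of_nat n) (b + of_nat n) (c + of_nat n) \<Longrightarrow>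
      hyp_series_continues a b c" for a b c n
  proof (induction n)
    case (Suc n)
    thus ?case using hyp_series_continues_primitive[of "a + of_nat n" "b + of_nat n" "c + of_nat n"]
      by (simp add: algebra_simps)
  qed simp
  obtain n :: nat where n: "real n > - Re b" using reals_Archimedean2 by blast
  obtain m :: nat where m: "real m > Re b - Re c" using reals_Archimedean2 by blast
  have "hyp_series_continues (a + of_nat n) (b + of_nat n) (c + of_nat n + of_nat m)"
    using n m by (intro hyp_series_continues_Euler) auto
  thus ?thesis using lower primitive by blast
qed

lemma reg_hyp2F1_eq:
  assumes f: "f holomorphic_on cut_plane" "\<And>v. norm v < 1 \<Longrightarrow> f v = hyp_series a b c v" and w: "w \<in> cut_plane"
  shows "reg_hyp2F1 a b c w = f w"
  unfolding reg_hyp2F1_def cut_plane_def[symmetric]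
proof (rule the_equality)
  show "\<exists>g. g holomorphic_on cut_plane \<and> (\<forall>v. norm v < 1 \<longrightarrow> g v = hyp_series a b c v) \<and> g w = f w"
    using f by blast
  fix y assume "\<exists>g. g holomorphic_on cut_plane \<and> (\<forall>v. norm v < 1 \<longrightarrow> g v = hyp_series a b c v) \<and> g w = y"
  then obtain g where g: "g holomorphic_on cut_plane" "\<And>v. norm v < 1 \<Longrightarrow> g v = hyp_series a b c v" "g w = y"
    by blast
  have "g w = f w"
    by (rule analytic_continuation_open[OF _ open_cut_plane _ connected_cut_plane _ g(1) f(1) _ w, of "ball 0 1"])
       (use f g ball_subset_cut_plane in auto)
  thus "y = f w" using g by simp
qed

lemma holomorphic_on_reg_hyp2F1: "reg_hyp2F1 a b c holomorphic_on cut_plane"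
  and reg_hyp2F1_eq_series: "norm w < 1 \<Longrightarrow> reg_hyp2F1 a b c w = hyp_series a b c w"
proof -
  obtain f where f: "f holomorphic_on cut_plane" "\<And>v. norm v < 1 \<Longrightarrow> f v = hyp_series a b c v"
    using hyp_series_continues[of a b c] by (auto simp: hyp_series_continues_def)
  show "reg_hyp2F1 a b c holomorphic_on cut_plane"
    by (rule holomorphic_transform[OF f(1)]) (use reg_hyp2F1_eq[OF f] in auto)
  show "reg_hyp2F1 a b c w = hyp_series a b c w" if "norm w < 1"
    using reg_hyp2F1_eq[OF f ball_subset_cut_plane[OF that]] f(2)[OF that] by simp
qed

section \<open>The Legendre integral and its contour shift\<close>

lemma Re_cosh: "Re (cosh z) = cosh (Re z) * cos (Im z)"
  and Im_cosh: "Im (cosh z) = sinh (Re z) * sin (Im z)"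
  and Re_sinh: "Re (sinh z) = sinh (Re z) * cos (Im z)"
  and Im_sinh: "Im (sinh z) = cosh (Re z) * sin (Im z)"
  by (simp_all add: cosh_field_def sinh_field_def Re_exp Im_exp field_simps)

lemma cosh_ge_exp_abs: "exp \<bar>x\<bar> / 2 \<le> cosh (x::real)"
  by (cases "x \<ge> 0") (auto simp: cosh_field_def)

lemma
  fixes x :: "'a :: {banach, real_normed_field}"
  shows sinh_half_squared: "(sinh (x / 2))\<^sup>2 = (cosh x - 1) / 2"
    and cosh_half_squared: "(cosh (x / 2))\<^sup>2 = (cosh x + 1) / 2"
    and sinh_half_mult_cosh_half: "sinh (x / 2) * cosh (x / 2) = sinh x / 2"
  using cosh_double[of "x / 2"] cosh_square_eq[of "x / 2"] sinh_double[of "x / 2"] by simp_all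

lemma integrable_exp_minus_abs:
  assumes "c > (0::real)"
  shows "integrable lborel (\<lambda>x. exp (- (c * \<bar>x\<bar>)))"
proof -
  let ?f = "\<lambda>x. indicator {0<..} x * exp (- (c * x))"
  have right: "integrable lborel ?f" using set_integrable_exp[OF assms] by (simp add: set_integrable_def)
  moreover have left: "integrable lborel (\<lambda>x. ?f (- x))"
    using lborel_integrable_real_affine[OF right, of "-1" 0] by simp
  moreover have "integrable lborel (indicator {0::real} :: real \<Rightarrow> real)"
    by (rule integrable_real_indicator) auto
  moreover have "exp (- (c * \<bar>x\<bar>)) = ?f x + ?f (- x) + indicator {0} x" for x
    by (auto simp: indicator_def)
  ultimately show ?thesis by simp
qed

lemma norm_powr_exp_decay:
  assumes d: "d > 0" "d * exp \<bar>\<eta>\<bar> \<le> norm b" and \<kappa>: "Re \<kappa> \<ge> 0"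
  shows "norm (b powr (- \<kappa>) * exp (- (\<mu> * of_real \<eta>))) \<le>
    d powr (- Re \<kappa>) * exp (pi * \<bar>Im \<kappa>\<bar>) * exp (- ((Re \<kappa> - \<bar>Re \<mu>\<bar>) * \<bar>\<eta>\<bar>))"
proof -
  have pos: "d * exp \<bar>\<eta>\<bar> > 0" using d(1) by simp
  hence "b \<noteq> 0" using d(2) by auto
  hence "norm (b powr (- \<kappa>)) \<le> norm b powr (- Re \<kappa>) * exp (pi * \<bar>Im \<kappa>\<bar>)"
    using norm_powr_le[of b "- \<kappa>"] by simp
  also have "\<dots> \<le> (d * exp \<bar>\<eta>\<bar>) powr (- Re \<kappa>) * exp (pi * \<bar>Im \<kappa>\<bar>)"
    using d(2) pos \<kappa> by (intro mult_right_mono powr_mono2') auto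
  also have "(d * exp \<bar>\<eta>\<bar>) powr (- Re \<kappa>) = d powr (- Re \<kappa>) * exp (- (Re \<kappa> * \<bar>\<eta>\<bar>))"
    using d(1) by (simp add: powr_def ln_mult distrib_left flip: exp_add)
  finally have power: "norm (b powr (- \<kappa>)) \<le> d powr (- Re \<kappa>) * exp (- (Re \<kappa> * \<bar>\<eta>\<bar>)) * exp (pi * \<bar>Im \<kappa>\<bar>)" .
  have "- (Re \<mu> * \<eta>) \<le> \<bar>Re \<mu>\<bar> * \<bar>\<eta>\<bar>" unfolding abs_mult[symmetric] by simp
  hence "norm (exp (- (\<mu> * of_real \<eta>))) \<le> exp (\<bar>Re \<mu>\<bar> * \<bar>\<eta>\<bar>)" by simp
  with power have "norm (b powr (- \<kappa>) * exp (- (\<mu> * of_real \<eta>))) \<le>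
      d powr (- Re \<kappa>) * exp (- (Re \<kappa> * \<bar>\<eta>\<bar>)) * exp (pi * \<bar>Im \<kappa>\<bar>) * exp (\<bar>Re \<mu>\<bar> * \<bar>\<eta>\<bar>)"
    unfolding norm_mult by (rule mult_mono) auto
  also have "\<dots> = d powr (- Re \<kappa>) * exp (pi * \<bar>Im \<kappa>\<bar>) * exp (- ((Re \<kappa> - \<bar>Re \<mu>\<bar>) * \<bar>\<eta>\<bar>))"
    by (simp add: algebra_simps flip: exp_add)
  finally show ?thesis .
qed

definition legendre_integrand :: "complex \<Rightarrow> complex \<Rightarrow> complex \<Rightarrow> real \<Rightarrow> complex" where
  "legendre_integrand \<kappa> \<mu> w \<eta> = (w + of_real ((sinh (\<eta> / 2))\<^sup>2)) powr (- \<kappa>) * exp (- (\<mu> * of_real \<eta>))"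

definition legendre_integral :: "complex \<Rightarrow> complex \<Rightarrow> complex \<Rightarrow> complex" where
  "legendre_integral \<kappa> \<mu> w = (LINT \<eta>|lborel. legendre_integrand \<kappa> \<mu> w \<eta>)"

lemma continuous_on_legendre_integrand:
  assumes "w \<notin> \<real>\<^sub>\<le>\<^sub>0"
  shows "continuous_on A (legendre_integrand \<kappa> \<mu> w)"
  unfolding legendre_integrand_def
  by (intro continuous_intros continuous_on_powr_slit add_nonneg_notin_nonpos_Reals assms) auto

lemma borel_measurable_legendre_integrand:
  "w \<notin> \<real>\<^sub>\<le>\<^sub>0 \<Longrightarrow> legendre_integrand \<kappa> \<mu> w \<in> borel_measurable lborel"
  using borel_measurable_continuous_onI[OF continuous_on_legendre_integrand] by simp

lemma legendre_integrand_dominated: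
  assumes "w \<notin> \<real>\<^sub>\<le>\<^sub>0"
  obtains d where "d > 0" "\<forall>\<^sub>F v in nhds w. \<forall>\<kappa> \<mu> \<eta>. Re \<kappa> \<ge> 0 \<longrightarrow> norm (legendre_integrand \<kappa> \<mu> v \<eta>) \<le>
    d powr (- Re \<kappa>) * exp (pi * \<bar>Im \<kappa>\<bar>) * exp (- ((Re \<kappa> - \<bar>Re \<mu>\<bar>) * \<bar>\<eta>\<bar>))"
proof -
  obtain d where d: "d > 0" "\<forall>\<^sub>F v in nhds w. \<forall>s\<ge>0. d * (1 + s) \<le> norm (v + complex_of_real s)"
    using norm_add_nonneg_lower_bound[OF assms] .
  have exp_le: "exp \<bar>\<eta>\<bar> / 4 \<le> 1 + (sinh (\<eta> / 2))\<^sup>2" for \<eta> :: real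
    using cosh_ge_exp_abs[of \<eta>] by (simp add: sinh_half_squared field_simps)
  from d(2) have "\<forall>\<^sub>F v in nhds w. \<forall>\<kappa> \<mu> \<eta>. Re \<kappa> \<ge> 0 \<longrightarrow> norm (legendre_integrand \<kappa> \<mu> v \<eta>) \<le>
    (d / 4) powr (- Re \<kappa>) * exp (pi * \<bar>Im \<kappa>\<bar>) * exp (- ((Re \<kappa> - \<bar>Re \<mu>\<bar>) * \<bar>\<eta>\<bar>))"
  proof eventually_elim
    case (elim v)
    have "d / 4 * exp \<bar>\<eta>\<bar> \<le> norm (v + of_real ((sinh (\<eta> / 2))\<^sup>2))" for \<eta>
    proof -
      have "d / 4 * exp \<bar>\<eta>\<bar> \<le> d * (1 + (sinh (\<eta> / 2))\<^sup>2)"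
        using mult_left_mono[OF exp_le[of \<eta>], of d] d(1) by simp
      also have "\<dots> \<le> norm (v + of_real ((sinh (\<eta> / 2))\<^sup>2))" using elim by (meson zero_le_power2)
      finally show ?thesis .
    qed
    thus ?case unfolding legendre_integrand_def using d(1) by (intro allI impI norm_powr_exp_decay) auto
  qed
  thus ?thesis using d(1) by (intro that[of "d / 4"]) auto
qed

lemma integrable_legendre_integrand:
  assumes w: "w \<notin> \<real>\<^sub>\<le>\<^sub>0" and k: "\<bar>Re \<mu>\<bar> < Re \<kappa>"
  shows "integrable lborel (legendre_integrand \<kappa> \<mu> w)"
proof -
  obtain d where "d > 0" "\<forall>\<^sub>F v in nhds w. \<forall>\<kappa> \<mu> \<eta>. Re \<kappa> \<ge> 0 \<longrightarrow> norm (legendre_integrand \<kappa> \<mu> v \<eta>) \<le>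
      d powr (- Re \<kappa>) * exp (pi * \<bar>Im \<kappa>\<bar>) * exp (- ((Re \<kappa> - \<bar>Re \<mu>\<bar>) * \<bar>\<eta>\<bar>))"
    using legendre_integrand_dominated[OF w] .
  hence bound: "norm (legendre_integrand \<kappa> \<mu> w \<eta>) \<le>
      d powr (- Re \<kappa>) * exp (pi * \<bar>Im \<kappa>\<bar>) * exp (- ((Re \<kappa> - \<bar>Re \<mu>\<bar>) * \<bar>\<eta>\<bar>))" for \<eta>
    using k by (auto dest: eventually_nhds_x_imp_x)
  have "integrable lborel (\<lambda>\<eta>. d powr (- Re \<kappa>) * exp (pi * \<bar>Im \<kappa>\<bar>) * exp (- ((Re \<kappa> - \<bar>Re \<mu>\<bar>) * \<bar>\<eta>\<bar>)))"
    using k by (intro integrable_mult_right integrable_exp_minus_abs) simp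
  thus ?thesis
    by (rule Bochner_Integration.integrable_bound[OF _ borel_measurable_legendre_integrand[OF w]])
       (auto intro!: AE_I2 order_trans[OF bound])
qed

lemma legendre_integrand_locally_dominated:
  assumes S: "open S" and hol: "k holomorphic_on S" "m holomorphic_on S" "w holomorphic_on S"
    and s: "s \<in> S" and w: "w s \<notin> \<real>\<^sub>\<le>\<^sub>0" and km: "\<bar>Re (m s)\<bar> < Re (k s)"
  shows "\<exists>h. integrable lborel h \<and>
      (\<forall>\<^sub>F t in nhds s. \<forall>\<eta>\<in>space lborel. norm (legendre_integrand (k t) (m t) (w t) \<eta>) \<le> h \<eta>)"
proof -
  obtain d where d: "d > 0" "\<forall>\<^sub>F v in nhds (w s). \<forall>\<kappa> \<mu> \<eta>. Re \<kappa> \<ge> 0 \<longrightarrow> norm (legendre_integrand \<kappa> \<mu> v \<eta>) \<le>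
      d powr (- Re \<kappa>) * exp (pi * \<bar>Im \<kappa>\<bar>) * exp (- ((Re \<kappa> - \<bar>Re \<mu>\<bar>) * \<bar>\<eta>\<bar>))"
    using legendre_integrand_dominated[OF w] .
  note lim = tendsto_nhds_holomorphic[OF _ S s]
  define C where "C t = d powr (- Re (k t)) * exp (pi * \<bar>Im (k t)\<bar>)" for t
  define \<epsilon> where "\<epsilon> = (Re (k s) - \<bar>Re (m s)\<bar>) / 2"
  have \<epsilon>: "\<epsilon> > 0" using km by (simp add: \<epsilon>_def)
  have "((\<lambda>t. Re (k t) - \<bar>Re (m t)\<bar>) \<longlongrightarrow> Re (k s) - \<bar>Re (m s)\<bar>) (nhds s)"
    by (intro tendsto_intros lim hol)
  hence gap: "\<forall>\<^sub>F t in nhds s. \<epsilon> < Re (k t) - \<bar>Re (m t)\<bar>"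
    by (rule order_tendstoD) (use km in \<open>simp add: \<epsilon>_def\<close>)
  have "(C \<longlongrightarrow> C s) (nhds s)" unfolding C_def using d(1) by (intro tendsto_intros lim hol) auto
  hence C: "\<forall>\<^sub>F t in nhds s. C t < C s + 1" by (rule order_tendstoD) simp
  have "\<forall>\<^sub>F t in nhds s. \<forall>\<kappa> \<mu> \<eta>. Re \<kappa> \<ge> 0 \<longrightarrow> norm (legendre_integrand \<kappa> \<mu> (w t) \<eta>) \<le>
      d powr (- Re \<kappa>) * exp (pi * \<bar>Im \<kappa>\<bar>) * exp (- ((Re \<kappa> - \<bar>Re \<mu>\<bar>) * \<bar>\<eta>\<bar>))"
    using d(2) lim[OF hol(3)] by (rule eventually_compose_filterlim)
  with gap C have "\<forall>\<^sub>F t in nhds s. \<forall>\<eta>\<in>space lborel.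
      norm (legendre_integrand (k t) (m t) (w t) \<eta>) \<le> (C s + 1) * exp (- (\<epsilon> * \<bar>\<eta>\<bar>))"
  proof eventually_elim
    case (elim t)
    have "norm (legendre_integrand (k t) (m t) (w t) \<eta>) \<le> C t * exp (- ((Re (k t) - \<bar>Re (m t)\<bar>) * \<bar>\<eta>\<bar>))" for \<eta>
      unfolding C_def using elim \<epsilon> by auto
    moreover have "C t * exp (- ((Re (k t) - \<bar>Re (m t)\<bar>) * \<bar>\<eta>\<bar>)) \<le> (C s + 1) * exp (- (\<epsilon> * \<bar>\<eta>\<bar>))" for \<eta>
      using elim by (intro mult_mono) (auto intro!: mult_right_mono simp: C_def)
    ultimately show ?case by (blast intro: order_trans)
  qed
  moreover have "integrable lborel (\<lambda>\<eta>. (C s + 1) * exp (- (\<epsilon> * \<bar>\<eta>\<bar>)))"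
    by (intro integrable_mult_right integrable_exp_minus_abs \<epsilon>)
  ultimately show ?thesis by blast
qed

lemma holomorphic_on_legendre_integral:
  assumes S: "open S" and hol: "k holomorphic_on S" "m holomorphic_on S" "w holomorphic_on S"
    and w: "\<And>t. t \<in> S \<Longrightarrow> w t \<notin> \<real>\<^sub>\<le>\<^sub>0" and km: "\<And>t. t \<in> S \<Longrightarrow> \<bar>Re (m t)\<bar> < Re (k t)"
  shows "(\<lambda>t. legendre_integral (k t) (m t) (w t)) holomorphic_on S"
  unfolding legendre_integral_def
proof (rule holomorphic_on_integral[OF S])
  show "legendre_integrand (k t) (m t) (w t) \<in> borel_measurable lborel" if "t \<in> S" for t
    by (rule borel_measurable_legendre_integrand[OF w[OF that]])
  show "(\<lambda>t. legendre_integrand (k t) (m t) (w t) \<eta>) holomorphic_on S" for \<eta>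
    unfolding legendre_integrand_def
    by (intro holomorphic_intros hol add_nonneg_notin_nonpos_Reals w) auto
  show "\<exists>h. integrable lborel h \<and>
      (\<forall>\<^sub>F t in nhds s. \<forall>\<eta>\<in>space lborel. norm (legendre_integrand (k t) (m t) (w t) \<eta>) \<le> h \<eta>)" if "s \<in> S" for s
    using legendre_integrand_locally_dominated[OF S hol that w[OF that] km[OF that]] .
qed

lemma cnj_legendre_integral:
  assumes "w \<notin> \<real>\<^sub>\<le>\<^sub>0"
  shows "cnj (legendre_integral \<kappa> \<mu> w) = legendre_integral (cnj \<kappa>) (cnj \<mu>) (cnj w)"
proof -
  have "cnj (legendre_integrand \<kappa> \<mu> w \<eta>) = legendre_integrand (cnj \<kappa>) (cnj \<mu>) (cnj w) \<eta>" for \<eta>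
  proof -
    have "w + of_real ((sinh (\<eta> / 2))\<^sup>2) \<notin> \<real>\<^sub>\<le>\<^sub>0" using assms by (rule add_nonneg_notin_nonpos_Reals) simp
    hence "cnj ((w + of_real ((sinh (\<eta> / 2))\<^sup>2)) powr (- \<kappa>)) = cnj (w + of_real ((sinh (\<eta> / 2))\<^sup>2)) powr cnj (- \<kappa>)"
      by (intro cnj_powr) (auto simp: complex_nonpos_Reals_iff)
    thus ?thesis by (simp add: legendre_integrand_def exp_cnj)
  qed
  hence "legendre_integrand (cnj \<kappa>) (cnj \<mu>) (cnj w) = (\<lambda>\<eta>. cnj (legendre_integrand \<kappa> \<mu> w \<eta>))" by (intro ext) simp
  thus ?thesis unfolding legendre_integral_def by simp
qed

definition shifted_base :: "real \<Rightarrow> complex \<Rightarrow> real \<Rightarrow> complex" where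
  "shifted_base k z \<eta> = cosh (of_real \<eta> + \<i> * z) - \<i> * of_real k"

definition shifted_integrand :: "real \<Rightarrow> complex \<Rightarrow> complex \<Rightarrow> complex \<Rightarrow> real \<Rightarrow> complex" where
  "shifted_integrand k \<kappa> \<mu> z \<eta> = shifted_base k z \<eta> powr (- \<kappa>) * exp (- (\<mu> * (of_real \<eta> + \<i> * z)))"

lemma legendre_integral_eq_shifted:
  "legendre_integral \<kappa> \<mu> (1 / 2 - \<i> * of_real k / 2) =
      of_real 2 powr \<kappa> * (LINT \<eta>|lborel. shifted_integrand k \<kappa> \<mu> 0 \<eta>)"
proof -
  have half: "complex_of_real (1 / 2) powr (- \<kappa>) = of_real 2 powr \<kappa>"
    using of_real_powr_exp[of "1 / 2" "- \<kappa>"] of_real_powr_exp[of 2 \<kappa>] by (simp add: ln_div)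
  have "legendre_integrand \<kappa> \<mu> (1 / 2 - \<i> * of_real k / 2) = (\<lambda>\<eta>. of_real 2 powr \<kappa> * shifted_integrand k \<kappa> \<mu> 0 \<eta>)"
  proof
    fix \<eta> :: real
    have base: "1 / 2 - \<i> * of_real k / 2 + of_real ((sinh (\<eta> / 2))\<^sup>2) = of_real (1 / 2) * shifted_base k 0 \<eta>"
      by (simp add: sinh_half_squared shifted_base_def complex_eq_iff Re_cosh Im_cosh field_simps)
    show "legendre_integrand \<kappa> \<mu> (1 / 2 - \<i> * of_real k / 2) \<eta> = of_real 2 powr \<kappa> * shifted_integrand k \<kappa> \<mu> 0 \<eta>"
      unfolding legendre_integrand_def shifted_integrand_def base half[symmetric]
      by (subst of_real_mult_powr) auto
  qed
  thus ?thesis unfolding legendre_integral_def by simp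
qed

lemma Re_shifted_base: "Re (shifted_base k z \<eta>) = cosh (\<eta> - Im z) * cos (Re z)"
  by (simp add: shifted_base_def Re_cosh)

lemma shifted_base_notin_nonpos_Reals: "\<bar>Re z\<bar> < pi / 2 \<Longrightarrow> shifted_base k z \<eta> \<notin> \<real>\<^sub>\<le>\<^sub>0"
  using cos_gt_zero_pi[of "Re z"] by (intro Re_pos_notin_nonpos_Reals) (auto simp: Re_shifted_base)

lemma continuous_on_shifted_integrand:
  assumes "\<bar>Re z\<bar> < pi / 2"
  shows "continuous_on A (shifted_integrand k \<kappa> \<mu> z)"
  unfolding shifted_integrand_def
  by (intro continuous_intros continuous_on_powr_slit shifted_base_notin_nonpos_Reals assms)
     (auto simp: shifted_base_def intro!: continuous_intros)

lemma norm_shifted_base_ge_exp: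
  assumes r: "\<bar>Re z\<bar> \<le> r" "r < pi / 2" and b: "\<bar>Im z\<bar> \<le> b"
  shows "cos r * exp (- b) / 2 * exp \<bar>\<eta>\<bar> \<le> norm (shifted_base k z \<eta>)"
proof -
  have "\<bar>\<eta>\<bar> - b \<le> \<bar>\<eta> - Im z\<bar>" using b by linarith
  hence "exp (\<bar>\<eta>\<bar> - b) / 2 \<le> cosh (\<eta> - Im z)"
    by (intro order_trans[OF _ cosh_ge_exp_abs]) simp
  moreover have "cos r \<le> cos (Re z)" "cos r \<ge> 0"
    using cos_monotone_0_pi_le[of "\<bar>Re z\<bar>" r] cos_ge_zero[of r] r by auto
  ultimately have "exp (\<bar>\<eta>\<bar> - b) / 2 * cos r \<le> Re (shifted_base k z \<eta>)"
    unfolding Re_shifted_base by (intro mult_mono) auto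
  also have "\<dots> \<le> norm (shifted_base k z \<eta>)" by (rule complex_Re_le_cmod)
  finally show ?thesis by (simp add: exp_diff exp_minus field_simps)
qed

lemma norm_shifted_integrand_le:
  assumes r: "\<bar>Re z\<bar> \<le> r" "r < pi / 2" and b: "\<bar>Im z\<bar> \<le> b" and \<kappa>: "Re \<kappa> \<ge> 0"
  shows "norm (shifted_integrand k \<kappa> \<mu> z \<eta>) \<le> (cos r * exp (- b) / 2) powr (- Re \<kappa>) * exp (pi * \<bar>Im \<kappa>\<bar>) *
    exp (norm \<mu> * norm z) * exp (- ((Re \<kappa> - \<bar>Re \<mu>\<bar>) * \<bar>\<eta>\<bar>))"
proof -
  have "cos r > 0" using r by (intro cos_gt_zero_pi) auto
  hence base: "norm (shifted_base k z \<eta> powr (- \<kappa>) * exp (- (\<mu> * of_real \<eta>))) \<le>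
      (cos r * exp (- b) / 2) powr (- Re \<kappa>) * exp (pi * \<bar>Im \<kappa>\<bar>) * exp (- ((Re \<kappa> - \<bar>Re \<mu>\<bar>) * \<bar>\<eta>\<bar>))"
    by (intro norm_powr_exp_decay norm_shifted_base_ge_exp r b \<kappa>) simp
  have "norm (exp (- (\<mu> * (\<i> * z)))) \<le> exp (norm (- (\<mu> * (\<i> * z))))" by (rule norm_exp)
  hence "norm (exp (- (\<mu> * (\<i> * z)))) \<le> exp (norm \<mu> * norm z)"
    by (simp only: norm_minus_cancel norm_mult norm_ii mult_1)
  with base have "norm (shifted_base k z \<eta> powr (- \<kappa>) * exp (- (\<mu> * of_real \<eta>))) * norm (exp (- (\<mu> * (\<i> * z)))) \<le>
      (cos r * exp (- b) / 2) powr (- Re \<kappa>) * exp (pi * \<bar>Im \<kappa>\<bar>) * exp (- ((Re \<kappa> - \<bar>Re \<mu>\<bar>) * \<bar>\<eta>\<bar>)) *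
        exp (norm \<mu> * norm z)"
    by (rule mult_mono) auto
  moreover have "shifted_integrand k \<kappa> \<mu> z \<eta> =
      shifted_base k z \<eta> powr (- \<kappa>) * exp (- (\<mu> * of_real \<eta>)) * exp (- (\<mu> * (\<i> * z)))"
    by (simp add: shifted_integrand_def distrib_left exp_add exp_diff exp_minus divide_inverse)
  ultimately show ?thesis by (simp add: norm_mult mult_ac)
qed

lemma holomorphic_on_shifted_integral:
  assumes km: "\<bar>Re \<mu>\<bar> < Re \<kappa>"
  shows "(\<lambda>z. LINT \<eta>|lborel. shifted_integrand k \<kappa> \<mu> z \<eta>) holomorphic_on {z. \<bar>Re z\<bar> < pi / 2}"
    (is "_ holomorphic_on ?S")
proof (rule holomorphic_on_integral)
  show "open ?S" by (intro open_Collect_less continuous_intros)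
  show "shifted_integrand k \<kappa> \<mu> z \<in> borel_measurable lborel" if "z \<in> ?S" for z
    using that borel_measurable_continuous_onI[OF continuous_on_shifted_integrand, of z] by simp
  show "(\<lambda>z. shifted_integrand k \<kappa> \<mu> z \<eta>) holomorphic_on ?S" for \<eta>
    unfolding shifted_integrand_def using shifted_base_notin_nonpos_Reals
    by (intro holomorphic_intros) (auto simp: shifted_base_def cosh_field_def intro!: holomorphic_intros)
  fix u assume u: "u \<in> ?S"
  define r where "r = (\<bar>Re u\<bar> + pi / 2) / 2"
  have r: "\<bar>Re u\<bar> < r" "r < pi / 2" using u by (auto simp: r_def)
  define h where "h \<eta> = (cos r * exp (- (norm u + 1)) / 2) powr (- Re \<kappa>) * exp (pi * \<bar>Im \<kappa>\<bar>) *
    exp (norm \<mu> * (norm u + 1)) * exp (- ((Re \<kappa> - \<bar>Re \<mu>\<bar>) * \<bar>\<eta>\<bar>))" for \<eta>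
  have "((\<lambda>z. \<bar>Re z\<bar>) \<longlongrightarrow> \<bar>Re u\<bar>) (nhds u)" "(norm \<longlongrightarrow> norm u) (nhds u)"
    by (intro tendsto_intros filterlim_ident)+
  hence "\<forall>\<^sub>F z in nhds u. \<bar>Re z\<bar> < r" "\<forall>\<^sub>F z in nhds u. norm z < norm u + 1"
    using r(1) by (auto elim: order_tendstoD)
  hence "\<forall>\<^sub>F z in nhds u. \<forall>\<eta>\<in>space lborel. norm (shifted_integrand k \<kappa> \<mu> z \<eta>) \<le> h \<eta>"
  proof eventually_elim
    case (elim z)
    have "norm (shifted_integrand k \<kappa> \<mu> z \<eta>) \<le> (cos r * exp (- (norm u + 1)) / 2) powr (- Re \<kappa>) *
        exp (pi * \<bar>Im \<kappa>\<bar>) * exp (norm \<mu> * norm z) * exp (- ((Re \<kappa> - \<bar>Re \<mu>\<bar>) * \<bar>\<eta>\<bar>))" for \<eta>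
      using elim km r(2) abs_Im_le_cmod[of z] by (intro norm_shifted_integrand_le) auto
    moreover have "exp (norm \<mu> * norm z) \<le> exp (norm \<mu> * (norm u + 1))" using elim by (simp add: mult_left_mono)
    ultimately have "norm (shifted_integrand k \<kappa> \<mu> z \<eta>) \<le> h \<eta>" for \<eta>
      unfolding h_def by (rule order_trans[OF _ mult_right_mono[OF mult_left_mono]]) auto
    thus ?case by blast
  qed
  moreover have "integrable lborel h" unfolding h_def
    using km by (intro integrable_mult_right integrable_exp_minus_abs) simp
  ultimately show "\<exists>h. integrable lborel h \<and>
      (\<forall>\<^sub>F z in nhds u. \<forall>\<eta>\<in>space lborel. norm (shifted_integrand k \<kappa> \<mu> z \<eta>) \<le> h \<eta>)" by blast
qed

text \<open>Moving \<open>z\<close> along the imaginary axis merely translates \<open>\<eta>\<close>.\<close>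

lemma shifted_integral_constant:
  assumes km: "\<bar>Re \<mu>\<bar> < Re \<kappa>" and z: "\<bar>Re z\<bar> < pi / 2"
  shows "(LINT \<eta>|lborel. shifted_integrand k \<kappa> \<mu> z \<eta>) = (LINT \<eta>|lborel. shifted_integrand k \<kappa> \<mu> 0 \<eta>)"
proof (rule holomorphic_eq_on_segment[OF holomorphic_on_shifted_integral[OF km] holomorphic_on_const, where l = 0 and r = 1 and v = \<i>])
  let ?S = "{z. \<bar>Re z\<bar> < pi / 2}"
  have strip: "?S = {z. Re z < pi / 2} \<inter> {z. Re z > - (pi / 2)}" by auto
  show "open ?S" by (intro open_Collect_less continuous_intros)
  show "connected ?S" unfolding strip
    by (intro convex_connected convex_Int convex_halfspace_Re_lt convex_halfspace_Re_gt)
  fix t :: real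
  have "(LINT \<eta>|lborel. shifted_integrand k \<kappa> \<mu> 0 \<eta>) = (LINT \<eta>|lborel. shifted_integrand k \<kappa> \<mu> 0 (- t + 1 * \<eta>))"
    using lborel_integral_real_affine[of 1 "shifted_integrand k \<kappa> \<mu> 0" "- t"] by simp
  also have "(\<lambda>\<eta>. shifted_integrand k \<kappa> \<mu> 0 (- t + 1 * \<eta>)) = shifted_integrand k \<kappa> \<mu> (of_real t * \<i>)"
    by (intro ext) (simp add: shifted_integrand_def shifted_base_def algebra_simps)
  finally show "of_real t * \<i> \<in> ?S \<and>
      (LINT \<eta>|lborel. shifted_integrand k \<kappa> \<mu> (of_real t * \<i>) \<eta>) = (LINT \<eta>|lborel. shifted_integrand k \<kappa> \<mu> 0 \<eta>)"
    by simp
qed (use z in auto)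

definition sinh_gap :: "complex \<Rightarrow> complex \<Rightarrow> real \<Rightarrow> real \<Rightarrow> complex" where
  "sinh_gap \<kappa> \<mu> c \<eta> = of_real \<bar>sinh \<eta> - sinh c\<bar> powr (- \<kappa>) * exp (- (\<mu> * of_real \<eta>))"

lemma norm_sinh_gap: "norm (sinh_gap \<kappa> \<mu> c \<eta>) = \<bar>sinh \<eta> - sinh c\<bar> powr (- Re \<kappa>) * exp (- (Re \<mu> * \<eta>))"
  by (simp add: sinh_gap_def norm_mult norm_of_real_powr del: of_real_diff)

lemma sinh_gap_at: "sinh_gap \<kappa> \<mu> c c = 0"
  by (simp add: sinh_gap_def)

lemma sinh_gap_minus: "sinh_gap \<kappa> \<mu> c (- \<eta>) = sinh_gap \<kappa> (- \<mu>) (- c) \<eta>"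
proof -
  have "\<bar>sinh (- \<eta>) - sinh c\<bar> = \<bar>sinh \<eta> - sinh (- c)\<bar>" by (simp only: sinh_minus)
  thus ?thesis by (simp add: sinh_gap_def)
qed

lemma cnj_sinh_gap: "cnj (sinh_gap \<kappa> \<mu> c \<eta>) = sinh_gap (cnj \<kappa>) (cnj \<mu>) c \<eta>"
  using cnj_powr[of "of_real \<bar>sinh \<eta> - sinh c\<bar>" "- \<kappa>"] by (simp add: sinh_gap_def exp_cnj del: of_real_diff)

lemma continuous_on_sinh_gap:
  assumes "c \<notin> A"
  shows "continuous_on A (sinh_gap \<kappa> \<mu> c)"
proof -
  have "sinh \<eta> \<noteq> sinh c" if "\<eta> \<in> A" for \<eta> using assms that by auto
  thus ?thesis unfolding sinh_gap_def by (intro continuous_intros continuous_on_of_real_powr) auto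
qed

definition sinh_gap_arg :: "real \<Rightarrow> real" where
  "sinh_gap_arg c = exp (- c) / (2 * cosh c)"

lemma sinh_gap_arg_bounds: "0 < sinh_gap_arg c" "sinh_gap_arg c < 1"
proof -
  have "2 * cosh c = exp c + exp (- c)" by (simp add: cosh_field_def)
  hence "sinh_gap_arg c = exp (- c) / (exp c + exp (- c))" by (simp only: sinh_gap_arg_def)
  thus "0 < sinh_gap_arg c" "sinh_gap_arg c < 1" by (simp_all add: add_pos_pos)
qed

lemma sinh_diff_ln:
  assumes s: "s < 1"
  shows "sinh (c - ln (1 - s)) - sinh c = cosh c * (s * (1 - sinh_gap_arg c * s)) / (1 - s)"
proof -
  have nz: "1 - s \<noteq> 0" "cosh c \<noteq> 0" using s by auto
  have "exp (c - ln (1 - s)) = exp c / (1 - s)" "exp (- (c - ln (1 - s))) = exp (- c) * (1 - s)"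
    using s by (simp_all add: exp_diff exp_minus field_simps)
  hence "sinh (c - ln (1 - s)) - sinh c = (exp c / (1 - s) - exp (- c) * (1 - s)) / 2 - (exp c - exp (- c)) / 2"
    by (simp only: sinh_field_def)
  also have "\<dots> = s * ((exp c + exp (- c)) / 2 - exp (- c) / 2 * s) / (1 - s)"
    using nz by (simp add: divide_simps) (simp add: algebra_simps)
  also have "(exp c + exp (- c)) / 2 = cosh c" by (simp only: cosh_field_def)
  also have "cosh c - exp (- c) / 2 * s = cosh c * (1 - sinh_gap_arg c * s)"
    using nz by (simp add: sinh_gap_arg_def field_simps)
  finally show ?thesis by (simp add: mult_ac)
qed

lemma sinh_gap_Euler_kernel:
  assumes s: "s \<in> {0<..<1}"
  shows "of_real (cosh c) powr (- \<kappa>) * exp (- (\<mu> * of_real c)) *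
      (Beta_kernel (1 - \<kappa>) (1 + \<mu> - (1 - \<kappa>)) s * (1 - of_real (sinh_gap_arg c) * of_real s) powr (- \<kappa>)) =
    \<bar>1 / (1 - s)\<bar> *\<^sub>R sinh_gap \<kappa> \<mu> c (c - ln (1 - s))"
proof -
  define w where "w = sinh_gap_arg c"
  have "w * s < 1 * 1" using sinh_gap_arg_bounds[of c] s unfolding w_def by (intro mult_strict_mono) auto
  hence pos: "0 < s" "0 < 1 - s" "0 < 1 - w * s" "0 < cosh c" using s by auto
  define X where "X = cosh c * (s * (1 - w * s)) / (1 - s)"
  have X: "X > 0" "ln X = ln (cosh c) + ln s + ln (1 - w * s) - ln (1 - s)"
    unfolding X_def using pos by (simp_all add: ln_mult ln_div)
  have gap: "\<bar>sinh (c - ln (1 - s)) - sinh c\<bar> = X"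
    using X(1) pos sinh_diff_ln[of s c] unfolding X_def w_def by simp
  have "\<bar>1 / (1 - s)\<bar> *\<^sub>R sinh_gap \<kappa> \<mu> c (c - ln (1 - s)) =
      exp (of_real (- ln (1 - s))) * (exp (- \<kappa> * of_real (ln X)) * exp (- (\<mu> * of_real (c - ln (1 - s)))))"
    unfolding sinh_gap_def gap of_real_powr_exp[OF X(1)] scaleR_conv_of_real exp_of_real using pos
    by (simp add: exp_minus inverse_eq_divide)
  also have "\<dots> = exp (- \<kappa> * of_real (ln (cosh c))) * exp (- (\<mu> * of_real c)) *
      (exp ((1 - \<kappa> - 1) * of_real (ln s)) * exp ((1 + \<mu> - (1 - \<kappa>) - 1) * of_real (ln (1 - s))) *
       exp (- \<kappa> * of_real (ln (1 - w * s))))"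
    unfolding X(2) exp_add[symmetric] by (simp add: algebra_simps)
  also have "\<dots> = of_real (cosh c) powr (- \<kappa>) * exp (- (\<mu> * of_real c)) *
      (Beta_kernel (1 - \<kappa>) (1 + \<mu> - (1 - \<kappa>)) s * complex_of_real (1 - w * s) powr (- \<kappa>))"
    unfolding Beta_kernel_def using pos by (simp only: of_real_powr_exp)
  finally show ?thesis by (simp add: w_def)
qed

lemma image_minus_ln_one_minus: "(\<lambda>s::real. c - ln (1 - s)) ` {0<..<1} = {c<..}"
proof (intro equalityI subsetI)
  fix y assume "y \<in> {c<..}"
  thus "y \<in> (\<lambda>s. c - ln (1 - s)) ` {0<..<1}" by (intro image_eqI[of _ _ "1 - exp (c - y)"]) auto
qed auto

lemma sinh_gap_Euler_integral:
  assumes \<kappa>: "Re \<kappa> < 1" and \<mu>: "Re (\<kappa> + \<mu>) > 0"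
  shows "set_integrable lborel {c<..} (sinh_gap \<kappa> \<mu> c)"
    and "(LINT \<eta>:{c<..}|lborel. sinh_gap \<kappa> \<mu> c \<eta>) = of_real (cosh c) powr (- \<kappa>) * exp (- (\<mu> * of_real c)) *
      (Gamma (1 - \<kappa>) * Gamma (\<kappa> + \<mu>) * hyp_series \<kappa> (1 - \<kappa>) (1 + \<mu>) (of_real (sinh_gap_arg c)))"
proof -
  define C where "C = of_real (cosh c) powr (- \<kappa>) * exp (- (\<mu> * of_real c))"
  define E where "E s = Beta_kernel (1 - \<kappa>) (1 + \<mu> - (1 - \<kappa>)) s *
    (1 - of_real (sinh_gap_arg c) * of_real s) powr (- \<kappa>)" for s
  have params: "Re (1 - \<kappa>) > 0" "Re (1 + \<mu> - (1 - \<kappa>)) > 0" using \<kappa> \<mu> by auto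
  have arg: "norm (complex_of_real (sinh_gap_arg c)) < 1" using sinh_gap_arg_bounds[of c] by simp
  have deriv: "((\<lambda>s. c - ln (1 - s)) has_field_derivative 1 / (1 - s)) (at s)" if "s \<in> {0<..<1}" for s
    using that by (auto intro!: derivative_eq_intros simp: field_simps)
  have kernel: "C * E s = \<bar>1 / (1 - s)\<bar> *\<^sub>R sinh_gap \<kappa> \<mu> c (c - ln (1 - s))" if "s \<in> {0<..<1}" for s
    unfolding C_def E_def by (rule sinh_gap_Euler_kernel[OF that])
  note change = set_integral_substitution[OF _ _ image_minus_ln_one_minus deriv _ continuous_on_sinh_gap _ kernel]
  have "set_integrable lborel {0<..<1} E"
    unfolding E_def by (intro set_integrable_Euler params ball_subset_cut_plane arg)
  hence "set_integrable lborel {0<..<1} (\<lambda>s. C * E s)" by (rule set_integrable_mult_right)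
  thus "set_integrable lborel {c<..} (sinh_gap \<kappa> \<mu> c)"
    by (subst change(1)) (auto intro!: inj_onI continuous_intros)
  have "(LINT \<eta>:{c<..}|lborel. sinh_gap \<kappa> \<mu> c \<eta>) = (LINT s:{0<..<1}|lborel. C * E s)"
    by (rule change(2)) (auto intro!: inj_onI continuous_intros)
  also have "\<dots> = C * (LINT s:{0<..<1}|lborel. E s)" by (rule set_integral_mult_right)
  also have "(LINT s:{0<..<1}|lborel. E s) = Gamma (1 - \<kappa>) * Gamma (1 + \<mu> - (1 - \<kappa>)) *
      hyp_series \<kappa> (1 - \<kappa>) (1 + \<mu>) (of_real (sinh_gap_arg c))"
    unfolding E_def by (rule Euler_integral[OF params arg])
  finally show "(LINT \<eta>:{c<..}|lborel. sinh_gap \<kappa> \<mu> c \<eta>) = of_real (cosh c) powr (- \<kappa>) * exp (- (\<mu> * of_real c)) *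
      (Gamma (1 - \<kappa>) * Gamma (\<kappa> + \<mu>) * hyp_series \<kappa> (1 - \<kappa>) (1 + \<mu>) (of_real (sinh_gap_arg c)))"
    by (simp add: C_def add.commute)
qed

lemma set_integrable_sinh_gap_left:
  assumes "Re \<kappa> < 1" "Re (\<kappa> - \<mu>) > 0"
  shows "set_integrable lborel {..<c} (sinh_gap \<kappa> \<mu> c)"
proof (subst set_integral_substitution(1)[where S = "{- c<..}" and g = uminus and h = "\<lambda>_. -1" and F = "sinh_gap \<kappa> (- \<mu>) (- c)"])
  show "set_integrable lborel {- c<..} (sinh_gap \<kappa> (- \<mu>) (- c))"
    using assms by (intro sinh_gap_Euler_integral) auto
qed (auto intro!: derivative_eq_intros continuous_on_sinh_gap simp: sinh_gap_minus)

lemma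
  assumes "Re \<kappa> < 1" "\<bar>Re \<mu>\<bar> < Re \<kappa>"
  shows integrable_sinh_gap: "integrable lborel (sinh_gap \<kappa> \<mu> c)"
    and integral_sinh_gap_split: "(LINT \<eta>|lborel. (if c < \<eta> then a else b) * sinh_gap \<kappa> \<mu> c \<eta>) =
      a * (LINT \<eta>:{c<..}|lborel. sinh_gap \<kappa> \<mu> c \<eta>) + b * (LINT \<eta>:{..<c}|lborel. sinh_gap \<kappa> \<mu> c \<eta>)"
proof -
  have right: "set_integrable lborel {c<..} (sinh_gap \<kappa> \<mu> c)"
    and left: "set_integrable lborel {..<c} (sinh_gap \<kappa> \<mu> c)"
    using assms by (auto intro!: sinh_gap_Euler_integral set_integrable_sinh_gap_left)
  have split: "(if c < \<eta> then a else b) * sinh_gap \<kappa> \<mu> c \<eta> =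
      a * (indicator {c<..} \<eta> *\<^sub>R sinh_gap \<kappa> \<mu> c \<eta>) + b * (indicator {..<c} \<eta> *\<^sub>R sinh_gap \<kappa> \<mu> c \<eta>)" for a b \<eta>
    by (cases \<eta> c rule: linorder_cases) (simp_all add: sinh_gap_at)
  have "sinh_gap \<kappa> \<mu> c = (\<lambda>\<eta>. 1 * (indicator {c<..} \<eta> *\<^sub>R sinh_gap \<kappa> \<mu> c \<eta>) +
      1 * (indicator {..<c} \<eta> *\<^sub>R sinh_gap \<kappa> \<mu> c \<eta>))"
    unfolding split[symmetric] by simp
  thus "integrable lborel (sinh_gap \<kappa> \<mu> c)"
    using right left unfolding set_integrable_def
    by (metis (no_types) Bochner_Integration.integrable_add integrable_mult_right)
  show "(LINT \<eta>|lborel. (if c < \<eta> then a else b) * sinh_gap \<kappa> \<mu> c \<eta>) =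
      a * (LINT \<eta>:{c<..}|lborel. sinh_gap \<kappa> \<mu> c \<eta>) + b * (LINT \<eta>:{..<c}|lborel. sinh_gap \<kappa> \<mu> c \<eta>)"
    using right left unfolding split set_integrable_def set_lebesgue_integral_def
    by (subst Bochner_Integration.integral_add) (simp_all only: integrable_mult_right integral_mult_right_zero)
qed

lemma i_mult_of_real_powr:
  assumes "x > 0"
  shows "(\<i> * complex_of_real x) powr a = exp (\<i> * of_real (pi / 2) * a) * of_real x powr a"
    and "(- (\<i> * complex_of_real x)) powr a = exp (- (\<i> * of_real (pi / 2) * a)) * of_real x powr a"
  using of_real_mult_powr[OF assms, of \<i> a] of_real_mult_powr[OF assms, of "- \<i>" a]
  by (simp_all add: powr_def mult_ac)

lemma shifted_base_of_real: "shifted_base k (of_real \<phi>) \<eta> = Complex (cosh \<eta> * cos \<phi>) (sinh \<eta> * sin \<phi> - k)"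
  by (simp add: shifted_base_def complex_eq_iff Re_cosh Im_cosh)

lemma shifted_base_half_pi: "shifted_base k (of_real (pi / 2)) \<eta> = \<i> * of_real (sinh \<eta> - k)"
  unfolding shifted_base_of_real by (simp add: complex_eq_iff)

lemma shifted_integrand_half_pi:
  assumes \<kappa>: "\<kappa> \<noteq> 0"
  shows "shifted_integrand (sinh c) \<kappa> \<mu> (of_real (pi / 2)) \<eta> =
    (if c < \<eta> then exp (- (\<i> * of_real (pi / 2) * (\<mu> + \<kappa>))) else exp (- (\<i> * of_real (pi / 2) * (\<mu> - \<kappa>)))) *
      sinh_gap \<kappa> \<mu> c \<eta>"
proof -
  have phase: "exp (- (\<mu> * (of_real \<eta> + \<i> * of_real (pi / 2)))) =
      exp (- (\<i> * of_real (pi / 2) * \<mu>)) * exp (- (\<mu> * of_real \<eta>))"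
    unfolding exp_add[symmetric] by (simp add: algebra_simps)
  have exp_plus: "exp (- (\<i> * of_real (pi / 2) * (\<mu> + \<kappa>))) =
      exp (- (\<i> * of_real (pi / 2) * \<mu>)) * exp (\<i> * of_real (pi / 2) * - \<kappa>)"
    and exp_minus: "exp (- (\<i> * of_real (pi / 2) * (\<mu> - \<kappa>))) =
        exp (- (\<i> * of_real (pi / 2) * \<mu>)) * exp (- (\<i> * of_real (pi / 2) * - \<kappa>))"
    unfolding exp_add[symmetric] by (rule arg_cong[where f = exp], simp add: field_simps)+
  consider (right) "\<eta> > c" | (left) "\<eta> < c" | (at) "\<eta> = c" by linarith
  thus ?thesis
  proof cases
    case right
    hence pos: "sinh \<eta> - sinh c > 0" by simp
    show ?thesis
      unfolding shifted_integrand_def shifted_base_half_pi sinh_gap_def phase exp_plus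
        i_mult_of_real_powr(1)[OF pos] abs_of_pos[OF pos]
      using right by (simp only: if_True mult_ac)
  next
    case left
    hence pos: "sinh c - sinh \<eta> > 0" by simp
    have base: "\<i> * of_real (sinh \<eta> - sinh c) = - (\<i> * of_real (sinh c - sinh \<eta>))" by (simp add: algebra_simps)
    have "\<not> c < \<eta>" using left by simp
    thus ?thesis
      unfolding shifted_integrand_def shifted_base_half_pi sinh_gap_def phase exp_minus base
        i_mult_of_real_powr(2)[OF pos] abs_minus_commute[of "sinh \<eta>"] abs_of_pos[OF pos]
      by (simp only: if_False mult_ac)
  next
    case at
    thus ?thesis unfolding shifted_integrand_def shifted_base_half_pi by (simp add: sinh_gap_at)
  qed
qed

lemma norm_shifted_base_ge_sinh:
  assumes \<phi>: "0 \<le> \<phi>" "\<phi> \<le> pi / 2"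
  shows "\<bar>sinh \<eta> - k\<bar> / sqrt 2 \<le> norm (shifted_base k (of_real \<phi>) \<eta>)"
proof (rule power2_le_imp_le)
  define s where "s = sinh \<eta>"
  define S where "S = sin \<phi>"
  have S: "0 \<le> S" "S \<le> 1" unfolding S_def using \<phi> by (auto intro!: sin_ge_zero)
  have "S\<^sup>2 \<le> 1" using S by (simp add: abs_square_le_1)
  have "(norm (shifted_base k (of_real \<phi>) \<eta>))\<^sup>2 = (cosh \<eta>)\<^sup>2 * (cos \<phi>)\<^sup>2 + (s * S - k)\<^sup>2"
    by (simp add: shifted_base_of_real cmod_power2 power_mult_distrib s_def S_def)
  also have "\<dots> = (1 + s\<^sup>2) * (1 - S\<^sup>2) + (s * S - k)\<^sup>2"
    by (simp add: s_def S_def cosh_square_eq cos_squared_eq add.commute)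
  also have "\<dots> = (1 - S\<^sup>2) + (1 + S) / 2 * (s - k)\<^sup>2 + (1 - S) / 2 * (s + k)\<^sup>2"
    by (simp add: field_simps power2_eq_square)
  also have "\<dots> \<ge> 0 + 1 / 2 * (s - k)\<^sup>2 + 0"
    using S \<open>S\<^sup>2 \<le> 1\<close> by (intro add_mono mult_right_mono mult_nonneg_nonneg) auto
  finally show "(\<bar>sinh \<eta> - k\<bar> / sqrt 2)\<^sup>2 \<le> (norm (shifted_base k (of_real \<phi>) \<eta>))\<^sup>2"
    by (simp add: power_divide s_def)
qed simp

lemma norm_shifted_integrand_le_sinh_gap:
  assumes \<phi>: "0 \<le> \<phi>" "\<phi> \<le> pi / 2" and \<kappa>: "Re \<kappa> \<ge> 0" and \<eta>: "\<eta> \<noteq> c"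
  shows "norm (shifted_integrand (sinh c) \<kappa> \<mu> (of_real \<phi>) \<eta>) \<le>
    2 powr (Re \<kappa> / 2) * exp (pi * \<bar>Im \<kappa>\<bar>) * exp (norm \<mu> * (pi / 2)) *
      (norm (sinh_gap \<kappa> (of_real \<bar>Re \<mu>\<bar>) c \<eta>) + norm (sinh_gap \<kappa> (- of_real \<bar>Re \<mu>\<bar>) c \<eta>))"
proof -
  let ?b = "shifted_base (sinh c) (of_real \<phi>) \<eta>" and ?g = "\<bar>sinh \<eta> - sinh c\<bar>"
  have "sinh \<eta> \<noteq> sinh c" using \<eta> by auto
  hence g: "?g > 0" by simp
  have le: "?g / sqrt 2 \<le> norm ?b" by (rule norm_shifted_base_ge_sinh[OF \<phi>])
  have pos: "?g / sqrt 2 > 0" using g by simp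
  hence "norm (?b powr (- \<kappa>)) \<le> norm ?b powr (- Re \<kappa>) * exp (pi * \<bar>Im \<kappa>\<bar>)"
    using le norm_powr_le[of ?b "- \<kappa>"] by force
  also have "\<dots> \<le> (?g / sqrt 2) powr (- Re \<kappa>) * exp (pi * \<bar>Im \<kappa>\<bar>)"
    using le pos \<kappa> by (intro mult_right_mono powr_mono2') auto
  also have "(?g / sqrt 2) powr (- Re \<kappa>) = 2 powr (Re \<kappa> / 2) * ?g powr (- Re \<kappa>)"
    using g by (simp add: powr_def ln_div ln_sqrt flip: exp_add) (simp add: algebra_simps)
  finally have power: "norm (?b powr (- \<kappa>)) \<le> 2 powr (Re \<kappa> / 2) * ?g powr (- Re \<kappa>) * exp (pi * \<bar>Im \<kappa>\<bar>)" .
  have "Re (- (\<mu> * (of_real \<eta> + \<i> * of_real \<phi>))) = - (Re \<mu> * \<eta>) + Im \<mu> * \<phi>" by (simp add: algebra_simps)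
  also have "Im \<mu> * \<phi> \<le> norm \<mu> * \<phi>" using \<phi> abs_Im_le_cmod[of \<mu>] by (intro mult_right_mono) auto
  also have "\<dots> \<le> norm \<mu> * (pi / 2)" using \<phi> by (intro mult_left_mono) auto
  finally have "norm (exp (- (\<mu> * (of_real \<eta> + \<i> * of_real \<phi>)))) \<le> exp (- (Re \<mu> * \<eta>)) * exp (norm \<mu> * (pi / 2))"
    unfolding norm_exp_eq_Re exp_add[symmetric] by (simp only: exp_le_cancel_iff)
  also have "exp (- (Re \<mu> * \<eta>)) \<le> exp (- (\<bar>Re \<mu>\<bar> * \<eta>)) + exp (- (- \<bar>Re \<mu>\<bar> * \<eta>))"
    by (cases "Re \<mu> \<ge> 0") (auto simp: add_increasing add_increasing2)
  finally have "norm (exp (- (\<mu> * (of_real \<eta> + \<i> * of_real \<phi>)))) \<le>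
      (exp (- (\<bar>Re \<mu>\<bar> * \<eta>)) + exp (- (- \<bar>Re \<mu>\<bar> * \<eta>))) * exp (norm \<mu> * (pi / 2))" by (simp add: mult_right_mono)
  with power have "norm (shifted_integrand (sinh c) \<kappa> \<mu> (of_real \<phi>) \<eta>) \<le>
      2 powr (Re \<kappa> / 2) * ?g powr (- Re \<kappa>) * exp (pi * \<bar>Im \<kappa>\<bar>) *
      ((exp (- (\<bar>Re \<mu>\<bar> * \<eta>)) + exp (- (- \<bar>Re \<mu>\<bar> * \<eta>))) * exp (norm \<mu> * (pi / 2)))"
    unfolding shifted_integrand_def norm_mult by (rule mult_mono) auto
  thus ?thesis by (simp add: norm_sinh_gap algebra_simps)
qed

lemma tendsto_shifted_integrand:
  assumes "\<eta> \<noteq> c" and \<phi>: "(\<phi> \<longlongrightarrow> pi / 2) F"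
  shows "((\<lambda>n. shifted_integrand (sinh c) \<kappa> \<mu> (of_real (\<phi> n)) \<eta>) \<longlongrightarrow>
    shifted_integrand (sinh c) \<kappa> \<mu> (of_real (pi / 2)) \<eta>) F"
proof -
  have "sinh \<eta> \<noteq> sinh c" using assms(1) by auto
  hence "shifted_base (sinh c) (of_real (pi / 2)) \<eta> \<notin> \<real>\<^sub>\<le>\<^sub>0"
    unfolding shifted_base_half_pi by (intro Im_nonzero_notin_nonpos_Reals) simp
  moreover have "((\<lambda>n. shifted_base (sinh c) (of_real (\<phi> n)) \<eta>) \<longlongrightarrow> shifted_base (sinh c) (of_real (pi / 2)) \<eta>) F"
    unfolding shifted_base_def cosh_field_def by (intro tendsto_intros \<phi>) auto
  ultimately show ?thesis
    unfolding shifted_integrand_def by (intro tendsto_mult tendsto_powr_complex tendsto_intros \<phi>) auto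
qed

lemma shifted_integral_tendsto_boundary:
  assumes km: "\<bar>Re \<mu>\<bar> < Re \<kappa>" and \<kappa>: "Re \<kappa> < 1"
    and \<phi>: "\<And>n. 0 \<le> \<phi> n" "\<And>n. \<phi> n < pi / 2" "\<phi> \<longlonglongrightarrow> pi / 2"
  shows "(\<lambda>n. LINT \<eta>|lborel. shifted_integrand (sinh c) \<kappa> \<mu> (of_real (\<phi> n)) \<eta>) \<longlonglongrightarrow>
    (LINT \<eta>|lborel. shifted_integrand (sinh c) \<kappa> \<mu> (of_real (pi / 2)) \<eta>)"
proof -
  define f where "f \<phi> = shifted_integrand (sinh c) \<kappa> \<mu> (of_real \<phi>)" for \<phi> :: real
  define D where "D \<eta> = 2 powr (Re \<kappa> / 2) * exp (pi * \<bar>Im \<kappa>\<bar>) * exp (norm \<mu> * (pi / 2)) *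
      (norm (sinh_gap \<kappa> (of_real \<bar>Re \<mu>\<bar>) c \<eta>) + norm (sinh_gap \<kappa> (- of_real \<bar>Re \<mu>\<bar>) c \<eta>))" for \<eta>
  have "\<kappa> \<noteq> 0" using km by auto
  note at_boundary = shifted_integrand_half_pi[OF this, of c \<mu>, folded f_def]
  have ae_ne: "AE \<eta> in lborel. \<eta> \<noteq> c" by (rule AE_lborel_singleton)
  have "(\<lambda>n. integral\<^sup>L lborel (f (\<phi> n))) \<longlonglongrightarrow> integral\<^sup>L lborel (f (pi / 2))"
  proof (rule integral_dominated_convergence[where w = D])
    show "f (\<phi> n) \<in> borel_measurable lborel" for n
      using borel_measurable_continuous_onI[OF continuous_on_shifted_integrand] \<phi>(1,2)[of n] by (simp add: f_def)
    show "f (pi / 2) \<in> borel_measurable lborel"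
      unfolding at_boundary[abs_def] using borel_measurable_integrable[OF integrable_sinh_gap[OF \<kappa> km]]
      by measurable
    show "integrable lborel D" unfolding D_def using km \<kappa>
      by (intro integrable_mult_right Bochner_Integration.integrable_add integrable_norm integrable_sinh_gap) auto
    show "AE \<eta> in lborel. (\<lambda>n. f (\<phi> n) \<eta>) \<longlonglongrightarrow> f (pi / 2) \<eta>"
      using ae_ne unfolding f_def by eventually_elim (rule tendsto_shifted_integrand[OF _ \<phi>(3)])
    show "AE \<eta> in lborel. norm (f (\<phi> n) \<eta>) \<le> D \<eta>" for n
      using ae_ne
    proof eventually_elim
      case (elim \<eta>)
      thus ?case unfolding f_def D_def
        using \<phi>(1,2)[of n] km by (intro norm_shifted_integrand_le_sinh_gap) auto
    qed
  qed
  thus ?thesis unfolding f_def .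
qed

lemma shifted_integral_boundary:
  assumes km: "\<bar>Re \<mu>\<bar> < Re \<kappa>" and \<kappa>: "Re \<kappa> < 1"
  shows "(LINT \<eta>|lborel. shifted_integrand (sinh c) \<kappa> \<mu> 0 \<eta>) =
     exp (- (\<i> * of_real (pi / 2) * (\<mu> + \<kappa>))) * (LINT \<eta>:{c<..}|lborel. sinh_gap \<kappa> \<mu> c \<eta>) +
     exp (- (\<i> * of_real (pi / 2) * (\<mu> - \<kappa>))) * (LINT \<eta>:{..<c}|lborel. sinh_gap \<kappa> \<mu> c \<eta>)"
proof -
  define \<phi> where "\<phi> n = pi / 2 - 1 / real (Suc n)" for n
  have \<phi>: "0 \<le> \<phi> n" "\<phi> n < pi / 2" for n
  proof -
    have "1 / real (Suc n) \<le> 1" by simp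
    thus "0 \<le> \<phi> n" using pi_ge_two unfolding \<phi>_def by linarith
  qed (auto simp: \<phi>_def)
  have "\<phi> \<longlonglongrightarrow> pi / 2"
    unfolding \<phi>_def using tendsto_diff[OF tendsto_const LIMSEQ_inverse_real_of_nat, of "pi / 2"]
    by (simp add: inverse_eq_divide)
  note lim = shifted_integral_tendsto_boundary[OF km \<kappa> \<phi> this]
  have const: "(LINT \<eta>|lborel. shifted_integrand (sinh c) \<kappa> \<mu> (of_real (\<phi> n)) \<eta>) =
      (LINT \<eta>|lborel. shifted_integrand (sinh c) \<kappa> \<mu> 0 \<eta>)" for n
    using \<phi>[of n] by (intro shifted_integral_constant km) simp
  have eq: "(LINT \<eta>|lborel. shifted_integrand (sinh c) \<kappa> \<mu> 0 \<eta>) =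
      (LINT \<eta>|lborel. shifted_integrand (sinh c) \<kappa> \<mu> (of_real (pi / 2)) \<eta>)"
    by (rule LIMSEQ_unique[OF tendsto_const lim[of c, unfolded const]])
  have "\<kappa> \<noteq> 0" using km by auto
  note at_boundary = shifted_integrand_half_pi[OF this, of c \<mu>]
  show ?thesis unfolding eq at_boundary[abs_def] integral_sinh_gap_split[OF \<kappa> km] ..
qed

section \<open>The connection formula\<close>

definition scaled_P :: "complex \<Rightarrow> complex \<Rightarrow> complex \<Rightarrow> complex" where
  "scaled_P \<alpha> lam \<xi> = of_real (sqrt pi) * Gamma (\<alpha> + lam) * (2 * sinh \<xi>) powr (1 / 2) *
     tanh (\<xi> / 2) powr (lam - 1 / 2) * reg_hyp2F1 (\<alpha> + 1 / 2) (1 / 2 - \<alpha>) (lam + 1 / 2) ((1 - cosh \<xi>) / 2)"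

definition scaled_Q :: "complex \<Rightarrow> complex \<Rightarrow> complex \<Rightarrow> complex" where
  "scaled_Q \<alpha> lam w = Gamma (\<alpha> + 1 / 2) / (2 * of_real (sqrt pi)) * w powr \<alpha> *
      legendre_integral (\<alpha> + 1 / 2) (lam - 1 / 2) w"

definition expansion_arg :: "complex \<Rightarrow> complex" where
  "expansion_arg \<xi> = 1 / (1 - exp (2 * \<xi>))"

definition Q_wave :: "complex \<Rightarrow> complex \<Rightarrow> complex \<Rightarrow> complex" where
  "Q_wave \<alpha> lam \<xi> = exp (\<xi> * \<alpha>) * scaled_Q \<alpha> lam (expansion_arg \<xi>)"

lemma expansion_arg_notin_nonpos_Reals_iff: "expansion_arg \<xi> \<notin> \<real>\<^sub>\<le>\<^sub>0 \<longleftrightarrow> 1 - exp (2 * \<xi>) \<notin> \<real>\<^sub>\<le>\<^sub>0"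
  by (simp add: expansion_arg_def divide_inverse)

lemma sin_nonzero: "y \<noteq> 0 \<Longrightarrow> \<bar>y\<bar> < pi \<Longrightarrow> sin y \<noteq> 0"
  using sin_gt_zero[of "\<bar>y\<bar>"] by (auto simp: abs_if split: if_splits)

lemma expansion_arg_notin_nonpos_Reals:
  assumes "Im \<xi> \<noteq> 0" "\<bar>Im \<xi>\<bar> < pi"
  shows "expansion_arg \<xi> \<notin> \<real>\<^sub>\<le>\<^sub>0"
  unfolding expansion_arg_notin_nonpos_Reals_iff
proof
  assume "1 - exp (2 * \<xi>) \<in> \<real>\<^sub>\<le>\<^sub>0"
  hence cos_ge: "exp (2 * Re \<xi>) * cos (2 * Im \<xi>) \<ge> 1" and "sin (2 * Im \<xi>) = 0"
    by (simp_all add: complex_nonpos_Reals_iff Re_exp Im_exp)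
  hence "cos (Im \<xi>) = 0" using sin_nonzero[OF assms] by (simp add: sin_double)
  hence "cos (2 * Im \<xi>) = - 1" by (simp add: cos_double_cos)
  with cos_ge show False using exp_gt_zero[of "2 * Re \<xi>"] by simp
qed

lemma Re_expansion_arg_pos:
  assumes "Re \<xi> < 0"
  shows "Re (expansion_arg \<xi>) > 0"
proof -
  have "Re (exp (2 * \<xi>)) \<le> norm (exp (2 * \<xi>))" by (rule complex_Re_le_cmod)
  also have "\<dots> < 1" using assms by simp
  finally have pos: "Re (1 - exp (2 * \<xi>)) > 0" by simp
  hence "1 - exp (2 * \<xi>) \<noteq> 0" by (metis less_irrefl zero_complex.sel(1))
  thus ?thesis using pos unfolding expansion_arg_def Re_divide
    by (simp add: cmod_power2[symmetric] del: minus_complex.sel)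
qed

lemma holomorphic_on_expansion_arg [holomorphic_intros]:
  assumes "f holomorphic_on S" "\<And>z. z \<in> S \<Longrightarrow> expansion_arg (f z) \<notin> \<real>\<^sub>\<le>\<^sub>0"
  shows "(\<lambda>z. expansion_arg (f z)) holomorphic_on S"
proof -
  have "1 - exp (2 * f z) \<noteq> 0" if "z \<in> S" for z
    using assms(2)[OF that] by (auto simp: expansion_arg_def)
  thus ?thesis unfolding expansion_arg_def by (intro holomorphic_intros assms) auto
qed

lemma holomorphic_on_sinh [holomorphic_intros]: "f holomorphic_on S \<Longrightarrow> (\<lambda>z. sinh (f z)) holomorphic_on S"
  and holomorphic_on_cosh [holomorphic_intros]: "f holomorphic_on S \<Longrightarrow> (\<lambda>z. cosh (f z)) holomorphic_on S"
  unfolding sinh_field_def cosh_field_def by (auto intro!: holomorphic_intros)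

lemma holomorphic_on_scaled_Q:
  assumes S: "open S" and hol: "a holomorphic_on S" "l holomorphic_on S" "w holomorphic_on S"
    and w: "\<And>t. t \<in> S \<Longrightarrow> w t \<notin> \<real>\<^sub>\<le>\<^sub>0" and a: "\<And>t. t \<in> S \<Longrightarrow> Re (a t) > 0"
    and l: "\<And>t. t \<in> S \<Longrightarrow> \<bar>Re (l t) - 1 / 2\<bar> < Re (a t) + 1 / 2"
  shows "(\<lambda>t. scaled_Q (a t) (l t) (w t)) holomorphic_on S"
  unfolding scaled_Q_def
proof (intro holomorphic_on_mult holomorphic_on_divide holomorphic_on_legendre_integral[OF S] holomorphic_on_powr holomorphic_intros hol)
  fix t assume "t \<in> S"
  thus "a t + 1 / 2 \<notin> \<int>\<^sub>\<le>\<^sub>0" using a[of t] by (intro Re_pos_notin_nonpos_Ints) simp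
qed (use w l in auto)

lemma holomorphic_on_Q_wave:
  assumes S: "open S" and hol: "a holomorphic_on S" "l holomorphic_on S" "x holomorphic_on S"
    and x: "\<And>t. t \<in> S \<Longrightarrow> expansion_arg (x t) \<notin> \<real>\<^sub>\<le>\<^sub>0" and a: "\<And>t. t \<in> S \<Longrightarrow> Re (a t) > 0"
    and l: "\<And>t. t \<in> S \<Longrightarrow> \<bar>Re (l t) - 1 / 2\<bar> < Re (a t) + 1 / 2"
  shows "(\<lambda>t. Q_wave (a t) (l t) (x t)) holomorphic_on S"
  unfolding Q_wave_def
  by (intro holomorphic_on_mult holomorphic_on_scaled_Q[OF S] holomorphic_intros hol x a l)

lemma cnj_Q_wave:
  assumes "expansion_arg \<xi> \<notin> \<real>\<^sub>\<le>\<^sub>0"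
  shows "cnj (Q_wave \<alpha> lam \<xi>) = Q_wave (cnj \<alpha>) (cnj lam) (cnj \<xi>)"
proof -
  have "cnj (expansion_arg \<xi>) = expansion_arg (cnj \<xi>)" by (simp add: expansion_arg_def exp_cnj)
  moreover have "cnj (expansion_arg \<xi> powr \<alpha>) = cnj (expansion_arg \<xi>) powr cnj \<alpha>"
    using assms by (intro cnj_powr) (auto simp: complex_nonpos_Reals_iff)
  ultimately show ?thesis
    by (simp add: Q_wave_def scaled_Q_def exp_cnj cnj_Gamma cnj_legendre_integral[OF assms])
qed

lemma expansion_arg_neg_imaginary:
  assumes \<theta>: "0 < \<theta>" "\<theta> < pi"
  shows "expansion_arg (- (\<i> * of_real \<theta>)) = exp (\<i> * of_real (\<theta> - pi / 2) - of_real (ln (2 * sin \<theta>)))"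
    and "expansion_arg (- (\<i> * of_real \<theta>)) = 1 / 2 - \<i> * of_real (cos \<theta> / sin \<theta>) / 2"
proof -
  have sin_pos: "sin \<theta> > 0" using \<theta> by (simp add: sin_gt_zero)
  have cis_eqs: "exp (\<i> * of_real \<theta>) = Complex (cos \<theta>) (sin \<theta>)"
      "exp (- (\<i> * of_real \<theta>)) = Complex (cos \<theta>) (- sin \<theta>)"
    by (simp_all add: complex_eq_iff Re_exp Im_exp)
  hence sin_eq: "2 * \<i> * of_real (sin \<theta>) = exp (\<i> * of_real \<theta>) - exp (- (\<i> * of_real \<theta>))"
    by (simp add: complex_eq_iff)
  have diff_eq: "1 - exp (2 * - (\<i> * of_real \<theta>)) = 2 * \<i> * of_real (sin \<theta>) * exp (- (\<i> * of_real \<theta>))"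
    unfolding sin_eq left_diff_distrib exp_add[symmetric] by simp
  have eq: "expansion_arg (- (\<i> * of_real \<theta>)) = - \<i> * exp (\<i> * of_real \<theta>) / of_real (2 * sin \<theta>)"
    unfolding expansion_arg_def diff_eq using sin_pos by (simp add: exp_minus field_simps)
  have "exp (\<i> * of_real (\<theta> - pi / 2)) = - \<i> * exp (\<i> * of_real \<theta>)"
    unfolding cis_eqs by (simp add: complex_eq_iff Re_exp Im_exp cos_diff sin_diff)
  thus "expansion_arg (- (\<i> * of_real \<theta>)) = exp (\<i> * of_real (\<theta> - pi / 2) - of_real (ln (2 * sin \<theta>)))"
    unfolding eq exp_diff exp_of_real using sin_pos by simp
  show "expansion_arg (- (\<i> * of_real \<theta>)) = 1 / 2 - \<i> * of_real (cos \<theta> / sin \<theta>) / 2"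
    unfolding eq cis_eqs using sin_pos by (simp add: complex_eq_iff Re_divide Im_divide power2_eq_square)
qed

lemma
  assumes \<theta>: "0 < \<theta>" "\<theta> < pi"
  shows sinh_minus_ln_tan_half: "sinh (- ln (tan (\<theta> / 2))) = cos \<theta> / sin \<theta>"
    and cosh_minus_ln_tan_half: "cosh (- ln (tan (\<theta> / 2))) = 1 / sin \<theta>"
    and sinh_gap_arg_minus_ln_tan_half: "sinh_gap_arg (- ln (tan (\<theta> / 2))) = (1 - cos \<theta>) / 2"
proof -
  define s c where "s = sin (\<theta> / 2)" and "c = cos (\<theta> / 2)"
  have sc: "s > 0" "c > 0" "s\<^sup>2 + c\<^sup>2 = 1"
    unfolding s_def c_def using \<theta> by (auto intro: sin_gt_zero cos_gt_zero)
  have double: "sin \<theta> = 2 * s * c" "cos \<theta> = c\<^sup>2 - s\<^sup>2"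
    using sin_double[of "\<theta> / 2"] cos_double[of "\<theta> / 2"] by (simp_all add: s_def c_def)
  have tan: "tan (\<theta> / 2) = s / c" by (simp add: tan_def s_def c_def)
  have exps: "exp (- ln (tan (\<theta> / 2))) = c / s" "exp (- (- ln (tan (\<theta> / 2)))) = s / c"
    using sc unfolding tan by (simp_all add: exp_minus)
  show "sinh (- ln (tan (\<theta> / 2))) = cos \<theta> / sin \<theta>"
    unfolding sinh_field_def exps double using sc by (simp add: field_simps power2_eq_square)
  have "(c / s + s / c) / 2 = (s\<^sup>2 + c\<^sup>2) / (2 * s * c)" using sc by (simp add: field_simps power2_eq_square)
  thus cosh: "cosh (- ln (tan (\<theta> / 2))) = 1 / sin \<theta>"
    unfolding cosh_field_def exps double sc(3) .
  have "1 - (c\<^sup>2 - s\<^sup>2) = 2 * s\<^sup>2" using sc(3) by simp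
  thus "sinh_gap_arg (- ln (tan (\<theta> / 2))) = (1 - cos \<theta>) / 2"
    unfolding sinh_gap_arg_def cosh exps double using sc by (simp add: power2_eq_square)
qed

definition imaginary_amplitude :: "complex \<Rightarrow> real \<Rightarrow> complex" where
  "imaginary_amplitude \<alpha> \<theta> =
     Gamma (\<alpha> + 1 / 2) / (2 * of_real (sqrt pi)) * (of_real (2 * sin \<theta>) powr (- \<alpha>) * of_real 2 powr (\<alpha> + 1 / 2))"

lemma expansion_arg_neg_imaginary_powr:
  assumes \<theta>: "0 < \<theta>" "\<theta> < pi"
  shows "exp (- (\<i> * of_real \<theta>) * \<alpha>) * expansion_arg (- (\<i> * of_real \<theta>)) powr \<alpha> =
    exp (- (\<i> * of_real (pi / 2) * \<alpha>)) * of_real (2 * sin \<theta>) powr (- \<alpha>)"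
proof -
  have sin_pos: "2 * sin \<theta> > 0" using \<theta> by (simp add: sin_gt_zero)
  have "expansion_arg (- (\<i> * of_real \<theta>)) powr \<alpha> = exp (\<alpha> * (\<i> * of_real (\<theta> - pi / 2) - of_real (ln (2 * sin \<theta>))))"
    unfolding expansion_arg_neg_imaginary(1)[OF \<theta>] by (rule exp_powr) (use \<theta> in auto)
  thus ?thesis
    unfolding of_real_powr_exp[OF sin_pos] exp_add[symmetric]
    by (simp only: exp_add[symmetric]) (rule arg_cong[where f = exp], simp add: algebra_simps)
qed

lemma Q_wave_neg_imaginary_axis:
  assumes \<theta>: "0 < \<theta>" "\<theta> < pi" and \<alpha>: "Re \<alpha> < 1 / 2" and lam: "\<bar>Re lam - 1 / 2\<bar> < Re \<alpha> + 1 / 2"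
  defines "c \<equiv> - ln (tan (\<theta> / 2))" and "h \<equiv> \<i> * complex_of_real (pi / 2)"
  shows "Q_wave \<alpha> lam (- (\<i> * of_real \<theta>)) = imaginary_amplitude \<alpha> \<theta> *
    (exp (- (h * (lam + 2 * \<alpha>))) * (LINT \<eta>:{c<..}|lborel. sinh_gap (\<alpha> + 1 / 2) (lam - 1 / 2) c \<eta>) +
     exp (- (h * (lam - 1))) * (LINT \<eta>:{..<c}|lborel. sinh_gap (\<alpha> + 1 / 2) (lam - 1 / 2) c \<eta>))"
proof -
  define R L where "R = (LINT \<eta>:{c<..}|lborel. sinh_gap (\<alpha> + 1 / 2) (lam - 1 / 2) c \<eta>)"
    and "L = (LINT \<eta>:{..<c}|lborel. sinh_gap (\<alpha> + 1 / 2) (lam - 1 / 2) c \<eta>)"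
  have params: "\<bar>Re (lam - 1 / 2)\<bar> < Re (\<alpha> + 1 / 2)" "Re (\<alpha> + 1 / 2) < 1" using \<alpha> lam by auto
  have "legendre_integral (\<alpha> + 1 / 2) (lam - 1 / 2) (expansion_arg (- (\<i> * of_real \<theta>))) =
      of_real 2 powr (\<alpha> + 1 / 2) * (exp (- (h * (lam - 1 / 2 + (\<alpha> + 1 / 2)))) * R +
        exp (- (h * (lam - 1 / 2 - (\<alpha> + 1 / 2)))) * L)"
    unfolding expansion_arg_neg_imaginary(2)[OF \<theta>] sinh_minus_ln_tan_half[OF \<theta>, symmetric] c_def[symmetric]
      legendre_integral_eq_shifted shifted_integral_boundary[OF params] h_def L_def R_def ..
  moreover have "exp (- (h * \<alpha>)) * exp (- (h * (lam - 1 / 2 + (\<alpha> + 1 / 2)))) = exp (- (h * (lam + 2 * \<alpha>)))"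
    "exp (- (h * \<alpha>)) * exp (- (h * (lam - 1 / 2 - (\<alpha> + 1 / 2)))) = exp (- (h * (lam - 1)))"
    unfolding exp_add[symmetric] by (rule arg_cong[where f = exp], simp add: field_simps)+
  ultimately show ?thesis
    using expansion_arg_neg_imaginary_powr[OF \<theta>, of \<alpha>]
    unfolding Q_wave_def scaled_Q_def imaginary_amplitude_def L_def[symmetric] R_def[symmetric] h_def[symmetric] by algebra
qed

lemma Q_wave_imaginary_axis:
  assumes \<theta>: "0 < \<theta>" "\<theta> < pi" and \<alpha>: "Re \<alpha> < 1 / 2" and lam: "\<bar>Re lam - 1 / 2\<bar> < Re \<alpha> + 1 / 2"
  defines "c \<equiv> - ln (tan (\<theta> / 2))" and "h \<equiv> \<i> * complex_of_real (pi / 2)"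
  shows "Q_wave \<alpha> lam (\<i> * of_real \<theta>) = imaginary_amplitude \<alpha> \<theta> *
    (exp (h * (lam + 2 * \<alpha>)) * (LINT \<eta>:{c<..}|lborel. sinh_gap (\<alpha> + 1 / 2) (lam - 1 / 2) c \<eta>) +
     exp (h * (lam - 1)) * (LINT \<eta>:{..<c}|lborel. sinh_gap (\<alpha> + 1 / 2) (lam - 1 / 2) c \<eta>))"
proof -
  have "Im (- (\<i> * complex_of_real \<theta>)) \<noteq> 0" "\<bar>Im (- (\<i> * complex_of_real \<theta>))\<bar> < pi" using \<theta> by auto
  note notin = expansion_arg_notin_nonpos_Reals[OF this]
  have cnj_gap: "cnj (LINT \<eta>:A|lborel. sinh_gap \<kappa> \<mu> c \<eta>) = (LINT \<eta>:A|lborel. sinh_gap (cnj \<kappa>) (cnj \<mu>) c \<eta>)"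
    for A \<kappa> \<mu>
  proof -
    have "indicat_real A \<eta> *\<^sub>R sinh_gap (cnj \<kappa>) (cnj \<mu>) c \<eta> = cnj (indicat_real A \<eta> *\<^sub>R sinh_gap \<kappa> \<mu> c \<eta>)" for \<eta>
      by (simp add: cnj_sinh_gap scaleR_conv_of_real)
    thus ?thesis unfolding set_lebesgue_integral_def by (simp only: Bochner_Integration.integral_cnj)
  qed
  have cnj_powr_real: "cnj (of_real r powr a) = of_real r powr cnj a" if "r > 0" for r a
    using cnj_powr[of "of_real r" a] that by simp
  have "2 * sin \<theta> > 0" using \<theta> by (simp add: sin_gt_zero)
  hence cnj_amplitude: "cnj (imaginary_amplitude (cnj \<alpha>) \<theta>) = imaginary_amplitude \<alpha> \<theta>"
    unfolding imaginary_amplitude_def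
    by (simp add: cnj_Gamma cnj_powr_real[of 2, simplified] cnj_powr_real[of "2 * sin \<theta>", simplified])
  have "Q_wave \<alpha> lam (\<i> * of_real \<theta>) = cnj (Q_wave (cnj \<alpha>) (cnj lam) (- (\<i> * of_real \<theta>)))"
    unfolding cnj_Q_wave[OF notin] by simp
  also have "\<dots> = imaginary_amplitude \<alpha> \<theta> *
    (exp (h * (lam + 2 * \<alpha>)) * (LINT \<eta>:{c<..}|lborel. sinh_gap (\<alpha> + 1 / 2) (lam - 1 / 2) c \<eta>) +
     exp (h * (lam - 1)) * (LINT \<eta>:{..<c}|lborel. sinh_gap (\<alpha> + 1 / 2) (lam - 1 / 2) c \<eta>))"
    using \<alpha> lam by (subst Q_wave_neg_imaginary_axis[OF \<theta>])
      (simp_all add: exp_cnj cnj_amplitude cnj_gap h_def flip: c_def)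
  finally show ?thesis .
qed

lemma connection_phases:
  fixes \<alpha> lam :: complex
  defines "h \<equiv> \<i> * complex_of_real (pi / 2)"
  shows "exp (h * (lam - 1)) + exp (of_real pi * \<i> * lam) * exp (- (h * (lam - 1))) = 0"
    and "exp (h * (lam + 2 * \<alpha>)) + exp (of_real pi * \<i> * lam) * exp (- (h * (lam + 2 * \<alpha>))) =
      exp (h * lam) * (2 * cos (of_real pi * \<alpha>))"
proof -
  have phase: "exp (of_real pi * \<i> * lam) = exp (h * lam) * exp (h * lam)"
    unfolding exp_add[symmetric] by (rule arg_cong[where f = exp]) (simp add: h_def)
  have "exp h = \<i>" unfolding h_def cis_conv_exp[symmetric] by (simp add: complex_eq_iff)
  thus "exp (h * (lam - 1)) + exp (of_real pi * \<i> * lam) * exp (- (h * (lam - 1))) = 0"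
    unfolding phase right_diff_distrib exp_diff exp_minus by (simp add: field_simps)
  have "exp (h * (lam + 2 * \<alpha>)) = exp (h * lam) * exp (\<i> * (of_real pi * \<alpha>))"
    "exp (- (h * (lam + 2 * \<alpha>))) = exp (- (h * lam)) * exp (- (\<i> * (of_real pi * \<alpha>)))"
    unfolding exp_add[symmetric] by (rule arg_cong[where f = exp], simp add: h_def field_simps)+
  thus "exp (h * (lam + 2 * \<alpha>)) + exp (of_real pi * \<i> * lam) * exp (- (h * (lam + 2 * \<alpha>))) =
      exp (h * lam) * (2 * cos (of_real pi * \<alpha>))"
    unfolding phase by (simp add: cos_exp_eq exp_minus field_simps)
qed

lemma Gamma_reflection_half: "Re \<alpha> > - (1 / 2) \<Longrightarrow> Re \<alpha> < 1 / 2 \<Longrightarrow>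
  Gamma (\<alpha> + 1 / 2) * Gamma (1 / 2 - \<alpha>) * cos (of_real pi * \<alpha>) = of_real pi"
proof -
  assume \<alpha>: "Re \<alpha> > - (1 / 2)" "Re \<alpha> < 1 / 2"
  have shift: "of_real pi * (\<alpha> + 1 / 2) = of_real pi * \<alpha> + of_real (pi / 2)" by (simp add: algebra_simps)
  have sin_eq: "sin (of_real pi * (\<alpha> + 1 / 2)) = cos (of_real pi * \<alpha>)"
    unfolding shift sin_add by (simp add: sin_of_real cos_of_real flip: of_real_divide)
  have "1 - (\<alpha> + 1 / 2) = 1 / 2 - \<alpha>" by simp
  hence "Gamma (\<alpha> + 1 / 2) * Gamma (1 / 2 - \<alpha>) = of_real pi / cos (of_real pi * \<alpha>)"
    using Gamma_reflection_complex[of "\<alpha> + 1 / 2"] unfolding sin_eq by simp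
  moreover have "Gamma (\<alpha> + 1 / 2) \<noteq> 0" "Gamma (1 / 2 - \<alpha>) \<noteq> 0" using \<alpha> by (auto intro!: Gamma_nonzero_Re_pos)
  ultimately show ?thesis by (auto simp: field_simps)
qed

lemma norm_cos_arg_less_1:
  assumes "0 < \<theta>" "\<theta> < pi"
  shows "norm (complex_of_real ((1 - cos \<theta>) / 2)) < 1"
proof -
  have "cos \<theta> > cos pi" using assms by (intro cos_monotone_0_pi) auto
  moreover have "\<bar>(1 - cos \<theta>) / 2\<bar> = (1 - cos \<theta>) / 2" by (rule abs_of_nonneg) simp
  ultimately show ?thesis unfolding norm_of_real by simp
qed

lemma scaled_P_imaginary_axis:
  assumes \<theta>: "0 < \<theta>" "\<theta> < pi"
  shows "scaled_P \<alpha> lam (\<i> * of_real \<theta>) = of_real (sqrt pi) * Gamma (\<alpha> + lam) * exp (\<i> * of_real (pi / 2) * lam) *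
    of_real (2 * sin \<theta>) powr (1 / 2) * of_real (tan (\<theta> / 2)) powr (lam - 1 / 2) *
    hyp_series (\<alpha> + 1 / 2) (1 / 2 - \<alpha>) (lam + 1 / 2) (of_real ((1 - cos \<theta>) / 2))"
proof -
  have pos: "2 * sin \<theta> > 0" "tan (\<theta> / 2) > 0" using \<theta> by (auto intro: sin_gt_zero tan_gt_zero)
  have "2 * sinh (\<i> * of_real \<theta>) = \<i> * of_real (2 * sin \<theta>)"
    by (simp add: complex_eq_iff Re_sinh Im_sinh)
  moreover have "tanh (\<i> * of_real \<theta> / 2) = \<i> * of_real (tan (\<theta> / 2))"
  proof -
    have "sinh (\<i> * of_real \<theta> / 2) = \<i> * of_real (sin (\<theta> / 2))" "cosh (\<i> * of_real \<theta> / 2) = of_real (cos (\<theta> / 2))"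
      by (simp_all add: complex_eq_iff Re_sinh Im_sinh Re_cosh Im_cosh)
    thus ?thesis by (simp add: tanh_def tan_def)
  qed
  moreover have "(1 - cosh (\<i> * of_real \<theta>)) / 2 = complex_of_real ((1 - cos \<theta>) / 2)"
    by (simp add: complex_eq_iff Re_cosh Im_cosh)
  moreover have "exp (\<i> * of_real (pi / 2) * (1 / 2)) * exp (\<i> * of_real (pi / 2) * (lam - 1 / 2)) =
      exp (\<i> * of_real (pi / 2) * lam)"
    unfolding exp_add[symmetric] by (rule arg_cong[where f = exp]) (simp add: field_simps)
  ultimately show ?thesis
    unfolding scaled_P_def by (simp only: i_mult_of_real_powr(1) pos reg_hyp2F1_eq_series norm_cos_arg_less_1[OF \<theta>]) algebra
qed

lemma sinh_gap_right_integral_tan_half: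
  assumes \<theta>: "0 < \<theta>" "\<theta> < pi" and \<alpha>: "Re \<alpha> < 1 / 2" and lam: "Re (\<alpha> + lam) > 0"
  defines "c \<equiv> - ln (tan (\<theta> / 2))"
  shows "(LINT \<eta>:{c<..}|lborel. sinh_gap (\<alpha> + 1 / 2) (lam - 1 / 2) c \<eta>) =
    of_real (sin \<theta>) powr (\<alpha> + 1 / 2) * of_real (tan (\<theta> / 2)) powr (lam - 1 / 2) *
      (Gamma (1 / 2 - \<alpha>) * Gamma (\<alpha> + lam) *
      hyp_series (\<alpha> + 1 / 2) (1 / 2 - \<alpha>) (lam + 1 / 2) (of_real ((1 - cos \<theta>) / 2)))"
proof -
  have pos: "sin \<theta> > 0" "tan (\<theta> / 2) > 0" using \<theta> by (auto intro: sin_gt_zero tan_gt_zero)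
  have "Re (\<alpha> + 1 / 2) < 1" "Re (\<alpha> + 1 / 2 + (lam - 1 / 2)) > 0" using \<alpha> lam by auto
  note Euler = sinh_gap_Euler_integral(2)[OF this, of c]
  have "of_real (cosh c) powr (- (\<alpha> + 1 / 2)) = of_real (sin \<theta>) powr (\<alpha> + 1 / 2)"
    unfolding c_def cosh_minus_ln_tan_half[OF \<theta>]
    using of_real_powr_exp[of "1 / sin \<theta>"] of_real_powr_exp[OF pos(1)] pos(1)
    by (simp add: ln_div algebra_simps)
  moreover have "exp (- ((lam - 1 / 2) * of_real c)) = of_real (tan (\<theta> / 2)) powr (lam - 1 / 2)"
    unfolding c_def using of_real_powr_exp[OF pos(2)] by simp
  moreover have "1 - (\<alpha> + 1 / 2) = 1 / 2 - \<alpha>" "\<alpha> + 1 / 2 + (lam - 1 / 2) = \<alpha> + lam"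
      "1 + (lam - 1 / 2) = lam + 1 / 2"
    by simp_all
  ultimately show ?thesis
    using Euler unfolding c_def sinh_gap_arg_minus_ln_tan_half[OF \<theta>] by (simp only:)
qed

lemma connection_imaginary_axis_small:
  assumes \<theta>: "0 < \<theta>" "\<theta> < pi" and \<alpha>: "0 < Re \<alpha>" "Re \<alpha> < 1 / 2" and lam: "\<bar>Re lam - 1 / 2\<bar> < Re \<alpha> + 1 / 2"
  defines "\<xi> \<equiv> \<i> * complex_of_real \<theta>"
  shows "scaled_P \<alpha> lam \<xi> = Q_wave \<alpha> lam \<xi> + exp (of_real pi * \<i> * lam) * Q_wave \<alpha> lam (- \<xi>)"
proof -
  define c h where "c = - ln (tan (\<theta> / 2))" and "h = \<i> * complex_of_real (pi / 2)"
  define R L where "R = (LINT \<eta>:{c<..}|lborel. sinh_gap (\<alpha> + 1 / 2) (lam - 1 / 2) c \<eta>)"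
    and "L = (LINT \<eta>:{..<c}|lborel. sinh_gap (\<alpha> + 1 / 2) (lam - 1 / 2) c \<eta>)"
  define A where "A = imaginary_amplitude \<alpha> \<theta>"
  define F where "F = hyp_series (\<alpha> + 1 / 2) (1 / 2 - \<alpha>) (lam + 1 / 2) (of_real ((1 - cos \<theta>) / 2))"
  note waves = Q_wave_neg_imaginary_axis[OF \<theta> \<alpha>(2) lam] Q_wave_imaginary_axis[OF \<theta> \<alpha>(2) lam]
  have "Q_wave \<alpha> lam \<xi> + exp (of_real pi * \<i> * lam) * Q_wave \<alpha> lam (- \<xi>) =
      A * ((exp (h * (lam + 2 * \<alpha>)) + exp (of_real pi * \<i> * lam) * exp (- (h * (lam + 2 * \<alpha>)))) * R +
               (exp (h * (lam - 1)) + exp (of_real pi * \<i> * lam) * exp (- (h * (lam - 1)))) * L)"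
    unfolding waves \<xi>_def A_def R_def L_def c_def h_def by algebra
  also have "\<dots> = A * (exp (h * lam) * (2 * cos (of_real pi * \<alpha>)) * R)"
    unfolding h_def connection_phases by simp
  also have "R = of_real (sin \<theta>) powr (\<alpha> + 1 / 2) * of_real (tan (\<theta> / 2)) powr (lam - 1 / 2) *
      (Gamma (1 / 2 - \<alpha>) * Gamma (\<alpha> + lam) * F)"
    unfolding R_def F_def c_def using \<alpha> lam by (intro sinh_gap_right_integral_tan_half \<theta>) (auto simp: abs_less_iff)
  finally have waves_eq: "Q_wave \<alpha> lam \<xi> + exp (of_real pi * \<i> * lam) * Q_wave \<alpha> lam (- \<xi>) =
      Gamma (\<alpha> + 1 / 2) * Gamma (1 / 2 - \<alpha>) * cos (of_real pi * \<alpha>) / of_real (sqrt pi) * Gamma (\<alpha> + lam) *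
        exp (h * lam) *
      (of_real (2 * sin \<theta>) powr (- \<alpha>) * (of_real 2 powr (\<alpha> + 1 / 2) * of_real (sin \<theta>) powr (\<alpha> + 1 / 2))) *
      of_real (tan (\<theta> / 2)) powr (lam - 1 / 2) * F"
    by (simp add: A_def imaginary_amplitude_def)
  have "sqrt pi * sqrt pi = pi" by simp
  hence "of_real pi / of_real (sqrt pi) = complex_of_real (sqrt pi)"
    by (metis nonzero_mult_div_cancel_right of_real_divide real_sqrt_eq_zero_cancel_iff pi_neq_zero)
  hence "Gamma (\<alpha> + 1 / 2) * Gamma (1 / 2 - \<alpha>) * cos (of_real pi * \<alpha>) / of_real (sqrt pi) = of_real (sqrt pi)"
    using \<alpha> by (subst Gamma_reflection_half) auto
  moreover have "of_real 2 powr (\<alpha> + 1 / 2) * of_real (sin \<theta>) powr (\<alpha> + 1 / 2) =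
      complex_of_real (2 * sin \<theta>) powr (\<alpha> + 1 / 2)"
    using of_real_mult_powr[of 2 "of_real (sin \<theta>)"] by simp
  moreover have "of_real (2 * sin \<theta>) powr (- \<alpha>) * of_real (2 * sin \<theta>) powr (\<alpha> + 1 / 2) =
      complex_of_real (2 * sin \<theta>) powr (1 / 2)"
    by (simp flip: powr_add)
  ultimately show ?thesis unfolding waves_eq unfolding \<xi>_def scaled_P_imaginary_axis[OF \<theta>] F_def h_def by simp
qed

lemma scaled_mem_halfspace:
  fixes t r :: real
  assumes "r > - c" "0 < t" "t \<le> 1" "c \<ge> 0"
  shows "t * r > - c"
proof -
  have "- c \<le> t * (- c)" using assms by (simp add: mult_left_le_one_le)
  also have "\<dots> < t * r" using assms by (intro mult_strict_left_mono)
  finally show ?thesis .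
qed

definition connection_region :: "complex \<Rightarrow> complex \<Rightarrow> complex set" where
  "connection_region \<alpha> \<mu> =
    {t. Re (t * \<alpha>) > 0} \<inter> {t. Re (t * (\<alpha> + \<mu>)) > - (1 / 2)} \<inter> {t. Re (t * (\<alpha> - \<mu>)) > - (1 / 2)}"

lemma connection_region_iff:
  "t \<in> connection_region \<alpha> \<mu> \<longleftrightarrow> 0 < Re (t * \<alpha>) \<and> \<bar>Re (1 / 2 + t * \<mu>) - 1 / 2\<bar> < Re (t * \<alpha>) + 1 / 2"
  by (auto simp: connection_region_def algebra_simps abs_less_iff)

lemma open_connection_region: "open (connection_region \<alpha> \<mu>)"
  and connected_connection_region: "connected (connection_region \<alpha> \<mu>)"
proof -
  have "{t. Re (t * z) > c} = {t. cnj z \<bullet> t > c}" for z :: complex and c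
    by (auto simp: inner_complex_def algebra_simps)
  hence "open {t. Re (t * z) > c}" "convex {t. Re (t * z) > c}" for z :: complex and c
    by (simp_all add: open_halfspace_gt convex_halfspace_gt)
  thus "open (connection_region \<alpha> \<mu>)" "connected (connection_region \<alpha> \<mu>)"
    unfolding connection_region_def by (intro open_Int convex_connected convex_Int; simp only:)+
qed

lemma of_real_mem_connection_region:
  assumes "0 < Re \<alpha>" "\<bar>Re \<mu>\<bar> < Re \<alpha> + 1 / 2" "0 < t" "t \<le> 1"
  shows "of_real t \<in> connection_region \<alpha> \<mu>"
  using assms scaled_mem_halfspace[of "1 / 2" "Re (\<alpha> + \<mu>)" t] scaled_mem_halfspace[of "1 / 2" "Re (\<alpha> - \<mu>)" t]
  by (simp add: connection_region_def)

text \<open>The restriction \<open>Re \<alpha> < 1 / 2\<close> is removed by continuation along the segment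
  \<open>t \<mapsto> (t\<alpha>, 1 / 2 + t\<mu>)\<close>.\<close>

lemma connection_imaginary_axis:
  assumes \<theta>: "0 < \<theta>" "\<theta> < pi" and \<alpha>: "0 < Re \<alpha>" and lam: "\<bar>Re lam - 1 / 2\<bar> < Re \<alpha> + 1 / 2"
  defines "\<xi> \<equiv> \<i> * complex_of_real \<theta>"
  shows "scaled_P \<alpha> lam \<xi> = Q_wave \<alpha> lam \<xi> + exp (of_real pi * \<i> * lam) * Q_wave \<alpha> lam (- \<xi>)"
proof -
  define \<mu> T where "\<mu> = lam - 1 / 2" and "T = connection_region \<alpha> \<mu>"
  define Q where "Q = (\<lambda>t. Q_wave (t * \<alpha>) (1 / 2 + t * \<mu>) \<xi> +
     exp (of_real pi * \<i> * (1 / 2 + t * \<mu>)) * Q_wave (t * \<alpha>) (1 / 2 + t * \<mu>) (- \<xi>))"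
  have region: "0 < Re (t * \<alpha>)" "\<bar>Re (1 / 2 + t * \<mu>) - 1 / 2\<bar> < Re (t * \<alpha>) + 1 / 2" if "t \<in> T" for t
    using that unfolding T_def connection_region_iff by auto
  have real: "of_real t \<in> T" if "0 < t" "t \<le> 1" for t
    unfolding T_def using \<alpha> lam that by (intro of_real_mem_connection_region) (auto simp: \<mu>_def)
  have "(1 - cosh \<xi>) / 2 = complex_of_real ((1 - cos \<theta>) / 2)"
    by (simp add: \<xi>_def complex_eq_iff Re_cosh Im_cosh)
  hence arg: "norm ((1 - cosh \<xi>) / 2) < 1" using norm_cos_arg_less_1[OF \<theta>] by simp
  have P: "(\<lambda>t. scaled_P (t * \<alpha>) (1 / 2 + t * \<mu>) \<xi>) holomorphic_on T"
    unfolding scaled_P_def reg_hyp2F1_eq_series[OF arg]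
  proof (intro holomorphic_on_mult holomorphic_on_hyp_series holomorphic_intros)
    fix t assume "t \<in> T"
    thus "t * \<alpha> + (1 / 2 + t * \<mu>) \<notin> \<int>\<^sub>\<le>\<^sub>0"
      using region[of t] by (intro Re_pos_notin_nonpos_Ints) (auto simp: abs_less_iff)
  qed (use arg open_connection_region in \<open>auto simp: T_def\<close>)
  have notin: "expansion_arg \<xi> \<notin> \<real>\<^sub>\<le>\<^sub>0" "expansion_arg (- \<xi>) \<notin> \<real>\<^sub>\<le>\<^sub>0"
    unfolding \<xi>_def by (intro expansion_arg_notin_nonpos_Reals; use \<theta> in simp)+
  have Q: "Q holomorphic_on T" unfolding Q_def
    by (intro holomorphic_on_add holomorphic_on_mult holomorphic_on_Q_wave holomorphic_intros)
       (use notin region open_connection_region in \<open>auto simp: T_def\<close>)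
  have "scaled_P (1 * \<alpha>) (1 / 2 + 1 * \<mu>) \<xi> = Q 1"
  proof (rule holomorphic_eq_on_segment[OF P Q, of 0 "min 1 (1 / (2 * Re \<alpha>))" 1])
    fix t assume "0 < t" "t < min 1 (1 / (2 * Re \<alpha>))"
    hence t: "0 < t" "t \<le> 1" "t * Re \<alpha> < 1 / 2" using \<alpha> by (auto simp: field_simps)
    show "of_real t * 1 \<in> T \<and> scaled_P (of_real t * 1 * \<alpha>) (1 / 2 + of_real t * 1 * \<mu>) \<xi> = Q (of_real t * 1)"
      unfolding Q_def \<xi>_def using real[OF t(1,2)] region[of "of_real t"] t(3)
      by (auto intro!: connection_imaginary_axis_small \<theta>)
  qed (use \<alpha> real[of 1] in \<open>auto simp: T_def open_connection_region connected_connection_region\<close>)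
  thus ?thesis by (simp add: Q_def \<mu>_def)
qed

definition slit_strip :: "complex set" where
  "slit_strip = {\<xi>. \<bar>Im \<xi>\<bar> < pi \<and> (Re \<xi> > 0 \<or> Im \<xi> \<noteq> 0)}"

lemma D1_subset_slit_strip: "D1 \<subseteq> slit_strip"
  by (auto simp: D1_def slit_strip_def)

lemma Re_cosh_half_pos:
  assumes "\<bar>Im \<xi>\<bar> < pi"
  shows "Re (cosh (\<xi> / 2)) > 0"
proof -
  have "cos (Im \<xi> / 2) > 0" using assms by (intro cos_gt_zero_pi) auto
  thus ?thesis by (simp add: Re_cosh)
qed

lemma cosh_half_nonzero: "\<bar>Im \<xi>\<bar> < pi \<Longrightarrow> cosh (\<xi> / 2) \<noteq> 0"
  using Re_cosh_half_pos[of \<xi>] by auto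

lemma tanh_half_eq:
  "tanh (\<xi> / 2) = Complex (sinh (Re \<xi>)) (sin (Im \<xi>)) / of_real (2 * (norm (cosh (\<xi> / 2)))\<^sup>2)"
proof -
  define x y where "x = Re \<xi> / 2" and "y = Im \<xi> / 2"
  have double: "sinh (Re \<xi>) = 2 * sinh x * cosh x" "sin (Im \<xi>) = 2 * sin y * cos y"
    using sinh_double[of x] sin_double[of y] by (simp_all add: x_def y_def)
  have "sinh x * cosh x * (cos y)\<^sup>2 + sinh x * cosh x * (sin y)\<^sup>2 = sinh x * cosh x"
    "(cosh x)\<^sup>2 * (sin y * cos y) - (sinh x)\<^sup>2 * (sin y * cos y) = sin y * cos y"
    by (simp_all flip: distrib_left left_diff_distrib add: hyperbolic_pythagoras)
  hence product: "sinh (\<xi> / 2) * cnj (cosh (\<xi> / 2)) = Complex (sinh (Re \<xi>)) (sin (Im \<xi>)) / 2"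
    unfolding double by (simp add: complex_eq_iff Re_sinh Im_sinh Re_cosh Im_cosh x_def y_def power2_eq_square algebra_simps)
  show ?thesis
    unfolding tanh_def complex_div_cnj[of "sinh (\<xi> / 2)"] product by simp
qed

lemma Re_tanh_half_pos: "\<bar>Im \<xi>\<bar> < pi \<Longrightarrow> Re \<xi> > 0 \<Longrightarrow> Re (tanh (\<xi> / 2)) > 0"
  and Im_tanh_half_pos: "0 < Im \<xi> \<Longrightarrow> Im \<xi> < pi \<Longrightarrow> Im (tanh (\<xi> / 2)) > 0"
  using cosh_half_nonzero[of \<xi>] sin_gt_zero[of "Im \<xi>"] unfolding tanh_half_eq
  by (auto simp: Re_divide_of_real Im_divide_of_real)

lemma tanh_half_notin_nonpos_Reals:
  assumes "\<xi> \<in> slit_strip"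
  shows "tanh (\<xi> / 2) \<notin> \<real>\<^sub>\<le>\<^sub>0"
  using assms cosh_half_nonzero[of \<xi>] sin_nonzero[of "Im \<xi>"] unfolding tanh_half_eq
  by (auto simp: slit_strip_def complex_nonpos_Reals_iff Re_divide_of_real Im_divide_of_real divide_le_0_iff)

lemma two_sinh_notin_nonpos_Reals:
  assumes "\<xi> \<in> slit_strip"
  shows "2 * sinh \<xi> \<notin> \<real>\<^sub>\<le>\<^sub>0"
  using assms sin_nonzero[of "Im \<xi>"]
  by (cases "Im \<xi> = 0") (auto simp: slit_strip_def complex_nonpos_Reals_iff Re_sinh Im_sinh)

lemma cosh_in_cut_plane:
  assumes "\<bar>Im \<xi>\<bar> < pi"
  shows "(1 - cosh \<xi>) / 2 \<in> cut_plane"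
proof -
  have "1 - (1 - cosh \<xi>) / 2 = (cosh (\<xi> / 2))\<^sup>2" by (simp add: cosh_half_squared field_simps)
  moreover have "(cosh (\<xi> / 2))\<^sup>2 \<notin> \<real>\<^sub>\<le>\<^sub>0"
    using Re_cosh_half_pos[OF assms]
    by (auto simp: complex_nonpos_Reals_iff Re_power2 Im_power2 power2_eq_square mult_le_0_iff)
  ultimately show ?thesis by (simp add: cut_plane_iff)
qed

lemma holomorphic_on_scaled_P: "scaled_P \<alpha> lam holomorphic_on slit_strip"
proof -
  have "(\<lambda>\<xi>. tanh (\<xi> / 2)) holomorphic_on slit_strip"
    unfolding tanh_def using cosh_half_nonzero by (intro holomorphic_intros) (auto simp: slit_strip_def)
  moreover have "(\<lambda>\<xi>. reg_hyp2F1 a b c ((1 - cosh \<xi>) / 2)) holomorphic_on slit_strip" for a b c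
    using cosh_in_cut_plane
    by (intro holomorphic_on_compose_gen[OF _ holomorphic_on_reg_hyp2F1, unfolded o_def] holomorphic_intros)
       (auto simp: slit_strip_def)
  ultimately show ?thesis
    unfolding scaled_P_def[abs_def]
    by (intro holomorphic_on_mult holomorphic_on_powr holomorphic_intros two_sinh_notin_nonpos_Reals tanh_half_notin_nonpos_Reals)
qed

lemma scaled_P_uminus:
  assumes "- pi < Im \<xi>" "Im \<xi> < 0"
  shows "scaled_P \<alpha> lam (- \<xi>) = exp (of_real pi * \<i> * lam) * scaled_P \<alpha> lam \<xi>"
proof -
  have "Im (2 * sinh \<xi>) < 0" using assms sin_gt_zero[of "- Im \<xi>"] by (auto simp: Im_sinh mult_pos_neg)
  hence sinh: "(2 * sinh (- \<xi>)) powr (1 / 2) = exp (\<i> * of_real pi * (1 / 2)) * (2 * sinh \<xi>) powr (1 / 2)"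
    using powr_uminus_lower_half_plane[of "2 * sinh \<xi>" "1 / 2"] by simp
  have "Im (tanh (\<xi> / 2)) < 0" using Im_tanh_half_pos[of "- \<xi>"] assms by simp
  hence tanh: "tanh (- \<xi> / 2) powr (lam - 1 / 2) =
      exp (\<i> * of_real pi * (lam - 1 / 2)) * tanh (\<xi> / 2) powr (lam - 1 / 2)"
    using powr_uminus_lower_half_plane[of "tanh (\<xi> / 2)" "lam - 1 / 2"] by simp
  have phase: "exp (of_real pi * \<i> * lam) = exp (\<i> * of_real pi * (1 / 2)) * exp (\<i> * of_real pi * (lam - 1 / 2))"
    unfolding exp_add[symmetric] by (rule arg_cong[where f = exp]) (simp add: field_simps)
  show ?thesis unfolding scaled_P_def sinh tanh cosh_minus phase by (simp only: mult_ac)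
qed

lemma connection_upper_strip:
  assumes \<xi>: "0 < Im \<xi>" "Im \<xi> < pi" and \<alpha>: "0 < Re \<alpha>" and lam: "\<bar>Re lam - 1 / 2\<bar> < Re \<alpha> + 1 / 2"
  shows "scaled_P \<alpha> lam \<xi> = Q_wave \<alpha> lam \<xi> + exp (of_real pi * \<i> * lam) * Q_wave \<alpha> lam (- \<xi>)"
proof -
  define V where "V = {\<xi>. Im \<xi> > 0} \<inter> {\<xi>. Im \<xi> < pi}"
  have V: "open V" "connected V" unfolding V_def
    by (intro open_Int open_halfspace_Im_gt open_halfspace_Im_lt convex_connected convex_Int convex_halfspace_Im_gt convex_halfspace_Im_lt)+
  have P: "scaled_P \<alpha> lam holomorphic_on V"
    by (rule holomorphic_on_subset[OF holomorphic_on_scaled_P]) (auto simp: V_def slit_strip_def)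
  have notin: "expansion_arg \<xi> \<notin> \<real>\<^sub>\<le>\<^sub>0" "expansion_arg (- \<xi>) \<notin> \<real>\<^sub>\<le>\<^sub>0" if "\<xi> \<in> V" for \<xi>
    by (rule expansion_arg_notin_nonpos_Reals; use that in \<open>simp add: V_def\<close>)+
  have Q: "(\<lambda>\<xi>. Q_wave \<alpha> lam \<xi> + exp (of_real pi * \<i> * lam) * Q_wave \<alpha> lam (- \<xi>)) holomorphic_on V"
    by (intro holomorphic_on_add holomorphic_on_mult holomorphic_on_Q_wave[OF V(1)] holomorphic_intros)
       (use notin \<alpha> lam in auto)
  show ?thesis
    by (rule holomorphic_eq_on_segment[OF P Q V, of 0 pi \<i>])
       (use \<xi> connection_imaginary_axis[OF _ _ \<alpha> lam] in \<open>auto simp: V_def mult.commute\<close>)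
qed

theorem connection_formula:
  assumes \<xi>: "\<xi> \<in> D1" "Im \<xi> \<noteq> 0" and \<alpha>: "0 < Re \<alpha>" and lam: "\<bar>Re lam - 1 / 2\<bar> < Re \<alpha> + 1 / 2"
  shows "scaled_P \<alpha> lam \<xi> = Q_wave \<alpha> lam \<xi> + Kfac \<xi> lam * Q_wave \<alpha> lam (- \<xi>)"
proof (cases "Im \<xi> > 0")
  case True
  thus ?thesis using connection_upper_strip[OF True _ \<alpha> lam] \<xi> by (simp add: Kfac_def D1_def)
next
  case False
  hence Im: "- pi < Im \<xi>" "Im \<xi> < 0" using \<xi> by (auto simp: D1_def)
  have inverse: "exp (- (of_real pi * \<i> * lam)) * exp (of_real pi * \<i> * lam) = 1"
    by (simp flip: exp_add)
  have "exp (of_real pi * \<i> * lam) * scaled_P \<alpha> lam \<xi> =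
      Q_wave \<alpha> lam (- \<xi>) + exp (of_real pi * \<i> * lam) * Q_wave \<alpha> lam \<xi>"
    using connection_upper_strip[of "- \<xi>", OF _ _ \<alpha> lam] Im by (simp add: scaled_P_uminus)
  hence "scaled_P \<alpha> lam \<xi> = Q_wave \<alpha> lam \<xi> + exp (- (of_real pi * \<i> * lam)) * Q_wave \<alpha> lam (- \<xi>)"
    using inverse by algebra
  thus ?thesis using Im by (simp add: Kfac_def)
qed

lemma sqrt_z2m1_cosh:
  assumes "\<xi> \<in> D1"
  shows "sqrt_z2m1 (cosh \<xi>) = sinh \<xi>"
proof -
  have cos_pos: "cos (Im \<xi> / 2) > 0" using assms by (intro cos_gt_zero_pi) (auto simp: D1_def)
  have sqrt2: "(complex_of_real (sqrt 2))\<^sup>2 = 2" by (simp flip: of_real_power)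
  have "csqrt (cosh \<xi> - 1) = of_real (sqrt 2) * sinh (\<xi> / 2)"
    by (rule csqrt_unique)
       (use cos_pos assms in \<open>simp_all add: power_mult_distrib sqrt2 sinh_half_squared Re_sinh D1_def\<close>)
  moreover have "csqrt (cosh \<xi> + 1) = of_real (sqrt 2) * cosh (\<xi> / 2)"
    by (rule csqrt_unique)
       (use cos_pos assms in \<open>simp_all add: power_mult_distrib sqrt2 cosh_half_squared Re_cosh D1_def\<close>)
  ultimately show ?thesis
    using sinh_half_mult_cosh_half[of \<xi>] sqrt2 unfolding sqrt_z2m1_def by algebra
qed

lemma cosh_quotient_powr:
  assumes "\<xi> \<in> D1"
  shows "((cosh \<xi> + 1) / (cosh \<xi> - 1)) powr (a / 2) = tanh (\<xi> / 2) powr (- a)"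
proof -
  define T where "T = tanh (\<xi> / 2)"
  have Re_T: "Re T > 0" using Re_tanh_half_pos assms by (simp add: T_def D1_def)
  hence nonzero: "T \<noteq> 0" by auto
  have halves: "x / 2 / (y / 2) = x / y" for x y :: complex by simp
  have "(cosh \<xi> + 1) / (cosh \<xi> - 1) = (cosh (\<xi> / 2))\<^sup>2 / (sinh (\<xi> / 2))\<^sup>2"
    unfolding cosh_half_squared sinh_half_squared by (simp only: halves)
  also have "\<dots> = inverse (T * T)" by (simp add: T_def tanh_def power2_eq_square)
  also have "\<dots> = exp (- (Ln T + Ln T))" by (simp only: exp_minus exp_add exp_Ln[OF nonzero])
  also have "\<dots> powr (a / 2) = exp (a / 2 * (- (Ln T + Ln T)))"
    using Re_Ln_pos_lt[OF nonzero] Re_T by (intro exp_powr) auto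
  also have "\<dots> = T powr (- a)" using nonzero by (simp add: powr_def)
  finally show ?thesis by (simp add: T_def)
qed

lemma gegenbauer_C_eq_scaled_P:
  assumes "\<xi> \<in> D1"
  shows "gegenbauer_C lam \<nu> (cosh \<xi>) =
      rGamma lam * rGamma (\<nu> + 1) / (2 * sinh \<xi>) powr lam * scaled_P (\<nu> + lam) lam \<xi>"
proof -
  have power: "(2 * sinh \<xi>) powr (lam - 1 / 2) = (2 * sinh \<xi>) powr lam / (2 * sinh \<xi>) powr (1 / 2)"
    by (rule powr_diff)
  have params: "\<nu> + lam - 1 / 2 + 1 = \<nu> + lam + 1 / 2" "- (\<nu> + lam - 1 / 2) = 1 / 2 - (\<nu> + lam)"
     "1 - (1 / 2 - lam) = lam + 1 / 2" "- (1 / 2 - lam) = lam - 1 / 2" "\<nu> + 2 * lam = \<nu> + lam + lam"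
    by (simp_all add: field_simps)
  show ?thesis
    unfolding gegenbauer_C_def legendre_P_def sqrt_z2m1_cosh[OF assms] cosh_quotient_powr[OF assms] scaled_P_def power params
    by (simp add: field_simps)
qed

section \<open>Expansion with an integral remainder\<close>

lemma acoef_eq_pochhammer:
  fixes l :: "'a :: field_char_0"
  shows "acoef n (l - 1 / 2) = (- 1) ^ n * pochhammer l n * pochhammer (1 - l) n / (2 ^ n * fact n)"
proof -
  have "(\<Prod>k=1..n. 4 * (l - 1 / 2)\<^sup>2 - (2 * of_nat k - 1)\<^sup>2) = (- 4) ^ n * pochhammer l n * pochhammer (1 - l) n"
  proof (induction n)
    case (Suc n)
    have factor: "4 * (l - 1 / 2)\<^sup>2 - (2 * of_nat (Suc n) - 1)\<^sup>2 = - 4 * (l + of_nat n) * (1 - l + of_nat n)"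
      by (simp add: power2_eq_square algebra_simps)
    have "1 \<le> Suc n" by simp
    note split = prod.nat_ivl_Suc'[OF this]
    show ?case unfolding split factor Suc.IH pochhammer_Suc power_Suc by (simp only: mult_ac)
  qed simp
  moreover have "(8::'a) ^ n = 4 ^ n * 2 ^ n" "(- 4 :: 'a) ^ n = (- 1) ^ n * 4 ^ n"
    by (simp_all flip: power_mult_distrib)
  ultimately show ?thesis unfolding acoef_def by (simp add: mult.assoc)
qed

lemma sin_Gamma_reflection:
  assumes "lam \<notin> \<int>"
  shows "sin (of_real pi * lam) / of_real pi * (Gamma lam * Gamma (1 - lam)) = (1 :: complex)"
proof -
  have "1 - lam \<notin> \<int>" using assms by (metis Ints_1 Ints_diff diff_diff_eq2 add_diff_cancel_left')
  hence "Gamma lam * Gamma (1 - lam) \<noteq> 0"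
    using assms nonpos_Ints_Int by (auto simp: Gamma_eq_zero_iff)
  moreover have "Gamma lam * Gamma (1 - lam) = of_real pi / sin (of_real pi * lam)"
    by (rule Gamma_reflection_complex)
  ultimately show ?thesis by auto
qed

lemma sin_Beta_eq_pochhammer:
  assumes lam: "lam \<notin> \<int>"
  shows "sin (of_real pi * lam) / of_real pi * Beta (lam + of_nat n) (1 - lam + of_nat n) =
    pochhammer lam n * pochhammer (1 - lam) n / (fact (2 * n) :: complex)"
proof -
  have "1 - lam \<notin> \<int>" using lam by (metis Ints_1 Ints_diff diff_diff_eq2 add_diff_cancel_left')
  hence notin: "lam \<notin> \<int>\<^sub>\<le>\<^sub>0" "1 - lam \<notin> \<int>\<^sub>\<le>\<^sub>0" using lam nonpos_Ints_Int by blast+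
  have shift: "Gamma (z + of_nat n) = pochhammer z n * Gamma z" if "z \<notin> \<int>\<^sub>\<le>\<^sub>0" for z :: complex
    using pochhammer_Gamma[OF that, of n] that by (simp add: Gamma_eq_zero_iff)
  have "lam + of_nat n + (1 - lam + of_nat n) = 1 + of_nat (2 * n)" by simp
  hence "rGamma (lam + of_nat n + (1 - lam + of_nat n)) = inverse (fact (2 * n))"
    using Gamma_fact[of "2 * n", where 'a = complex] by (simp only: rGamma_inverse_Gamma)
  hence "Beta (lam + of_nat n) (1 - lam + of_nat n) =
      Gamma lam * Gamma (1 - lam) * (pochhammer lam n * pochhammer (1 - lam) n / fact (2 * n))"
    unfolding Beta_altdef shift[OF notin(1)] shift[OF notin(2)] by (simp add: divide_inverse)
  thus ?thesis
    using sin_Gamma_reflection[OF lam] by (simp only: mult.assoc[symmetric]) simp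
qed

lemma Euler_integral_elementary:
  assumes b: "Re b > 0" and d: "Re d > 0" and w: "w \<in> cut_plane"
  shows "(LINT x:{0<..<1}|lborel. Beta_kernel b d x * (1 - w * of_real x) powr (- (b + d))) =
      Beta b d * (1 - w) powr (- b)"
proof (rule analytic_continuation_open[where f = "\<lambda>w. LINT x:{0<..<1}|lborel. Beta_kernel b d x * (1 - w * of_real x) powr (- (b + d))"
      and g = "\<lambda>w. Beta b d * (1 - w) powr (- b)" and s = "ball 0 1" and s' = cut_plane])
  show "(\<lambda>w. LINT x:{0<..<1}|lborel. Beta_kernel b d x *
      (1 - w * of_real x) powr (- (b + d))) holomorphic_on cut_plane"
    by (rule holomorphic_on_Euler_integral[OF b d])
  show "(\<lambda>w. Beta b d * (1 - w) powr (- b)) holomorphic_on cut_plane"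
    by (intro holomorphic_intros) (auto simp: cut_plane_iff)
  fix v :: complex assume "v \<in> ball 0 1"
  hence v: "norm v < 1" by simp
  have "hyp_coeff (b + d) b (b + d) n * v ^ n = rGamma (b + d) * (pochhammer b n / fact n * v ^ n)" for n
    using pochhammer_rGamma[of "b + d" n] by (simp add: hyp_coeff_def)
  hence "hyp_series (b + d) b (b + d) v = rGamma (b + d) * (1 - v) powr (- b)"
    using sums_mult[OF binomial_series_complex[OF v], of "rGamma (b + d)" b]
    by (simp add: hyp_series_eq_suminf_hyp_coeff sums_iff)
  thus "(LINT x:{0<..<1}|lborel. Beta_kernel b d x * (1 - v * of_real x) powr (- (b + d))) =
      Beta b d * (1 - v) powr (- b)"
    using Euler_integral[of b "b + d" v "b + d"] b d v by (simp add: Beta_altdef)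
qed (use w ball_subset_cut_plane open_cut_plane connected_cut_plane in auto)

definition cosh_ratio_coeff :: "nat \<Rightarrow> complex \<Rightarrow> complex" where
  "cosh_ratio_coeff n lam = (- 4) ^ n * pochhammer lam n * pochhammer (1 - lam) n / fact (2 * n)"

definition cosh_ratio_weight :: "real \<Rightarrow> real \<Rightarrow> real" where
  "cosh_ratio_weight s x = 1 / (1 + 4 * x * (1 - x) * s)"

definition cosh_ratio_remainder :: "nat \<Rightarrow> complex \<Rightarrow> real \<Rightarrow> complex" where
  "cosh_ratio_remainder N lam s =
     (LINT x:{0<..<1}|lborel. Beta_kernel (lam + of_nat N) (1 - lam + of_nat N) x *
       of_real (cosh_ratio_weight s x))"

lemma cosh_ratio_weight_denominator: "x \<in> {0<..<1} \<Longrightarrow> s \<ge> 0 \<Longrightarrow> 1 \<le> 1 + 4 * x * (1 - x) * (s::real)"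
  by simp

lemma cosh_ratio_weight_bounds:
  assumes "x \<in> {0<..<1}" "s \<ge> 0"
  shows "0 < cosh_ratio_weight s x" "cosh_ratio_weight s x \<le> 1"
proof -
  have "0 < 1 / d" "1 / d \<le> 1" if "1 \<le> d" for d :: real using that by simp_all
  from this[OF cosh_ratio_weight_denominator[OF assms]] show "0 < cosh_ratio_weight s x" "cosh_ratio_weight s x \<le> 1"
    unfolding cosh_ratio_weight_def .
qed

lemma continuous_on_cosh_ratio_weight:
  assumes "s \<ge> 0"
  shows "continuous_on {0<..<1} (cosh_ratio_weight s)"
  unfolding cosh_ratio_weight_def
proof (intro continuous_intros ballI)
  fix x :: real assume "x \<in> {0<..<1}"
  from cosh_ratio_weight_denominator[OF this assms] show "1 + 4 * x * (1 - x) * s \<noteq> 0" by linarith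
qed

lemma set_integrable_cosh_ratio:
  assumes "Re a > 0" "Re b > 0" "s \<ge> 0"
  shows "set_integrable lborel {0<..<1} (\<lambda>x. Beta_kernel a b x * of_real (cosh_ratio_weight s x))"
proof (rule set_integrable_Beta_kernel_bounded(1)[OF assms(1,2), where K = 1])
  show "continuous_on {0<..<1} (\<lambda>x. complex_of_real (cosh_ratio_weight s x))"
    by (intro continuous_intros continuous_on_cosh_ratio_weight assms)
qed (use cosh_ratio_weight_bounds[OF _ assms(3)] in \<open>simp add: less_imp_le\<close>)

lemma holomorphic_on_cosh_ratio_remainder:
  assumes s: "s \<ge> 0"
  shows "(\<lambda>lam. cosh_ratio_remainder N lam s) holomorphic_on {lam. - real N < Re lam \<and> Re lam < 1 + real N}"
  unfolding cosh_ratio_remainder_def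
proof (rule holomorphic_on_Beta_kernel_integral)
  have "{lam. - real N < Re lam \<and> Re lam < 1 + real N} = {z. Re z > - real N} \<inter> {z. Re z < 1 + real N}" by auto
  thus "open {lam. - real N < Re lam \<and> Re lam < 1 + real N}"
    by (simp only: open_Int open_halfspace_Re_lt open_halfspace_Re_gt)
  show "continuous_on {0<..<1} (\<lambda>x. complex_of_real (cosh_ratio_weight s x))"
    by (intro continuous_intros continuous_on_cosh_ratio_weight s)
  show "\<exists>K. \<forall>\<^sub>F u in nhds z. \<forall>x\<in>{0<..<1}. norm (complex_of_real (cosh_ratio_weight s x)) \<le> K" for z :: complex
    using cosh_ratio_weight_bounds[OF _ s]
    by (intro exI[of _ 1] always_eventually allI ballI) (simp add: less_imp_le)
qed (auto intro!: holomorphic_intros)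

lemma cosh_ratio_weight_partial_fractions:
  assumes x: "x \<in> {0<..<1}"
  shows "cosh_ratio_weight ((sinh (\<eta> / 2))\<^sup>2) x =
    (exp (\<eta> / 2) / (1 - (1 - exp \<eta>) * x) + exp (- (\<eta> / 2)) / (1 - (1 - exp (- \<eta>)) * x)) / (2 * cosh (\<eta> / 2))"
proof -
  define a b where "a = exp (\<eta> / 2)" and "b = exp (- (\<eta> / 2))"
  have ab: "a > 0" "b > 0" "a * b = 1" by (simp_all add: a_def b_def flip: exp_add)
  have exps: "exp \<eta> = a * a" "exp (- \<eta>) = b * b" by (simp_all add: a_def b_def flip: exp_add)
  have sinh: "sinh (\<eta> / 2) = (a - b) / 2" and cosh: "2 * cosh (\<eta> / 2) = a + b"
    by (simp_all add: sinh_field_def cosh_field_def a_def b_def)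
  define A B where "A = 1 - (1 - a * a) * x" and "B = 1 - (1 - b * b) * x"
  have "A = (1 - x) + a * a * x" "B = (1 - x) + b * b * x" by (simp_all add: A_def B_def algebra_simps)
  hence AB: "A > 0" "B > 0" using x ab by (simp_all add: add_pos_pos)
  have "1 + 4 * x * (1 - x) * ((a - b) / 2)\<^sup>2 = 1 + x * (1 - x) * (a * a + b * b - 2 * (a * b))"
    by (simp add: power2_eq_square field_simps)
  also have "\<dots> = 1 - 2 * x * (1 - x) + x * (1 - x) * (a * a + b * b)"
    unfolding ab(3) by (simp add: algebra_simps)
  also have "\<dots> = A * B" unfolding A_def B_def using ab(3) by algebra
  finally have product: "1 + 4 * x * (1 - x) * ((a - b) / 2)\<^sup>2 = A * B" .
  have "a * B + b * A = a + b" unfolding A_def B_def using ab(3) by algebra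
  hence "(a / A + b / B) / (a + b) = 1 / (A * B)"
    using AB ab by (simp add: divide_simps)
  thus ?thesis
    unfolding cosh_ratio_weight_def sinh cosh exps product A_def B_def a_def[symmetric] b_def[symmetric] by simp
qed

lemma cosh_ratio_remainder_0:
  assumes lam: "0 < Re lam" "Re lam < 1"
  shows "cosh_ratio_remainder 0 lam ((sinh (\<eta> / 2))\<^sup>2) =
    Gamma lam * Gamma (1 - lam) * (cosh ((lam - 1 / 2) * of_real \<eta>) / of_real (cosh (\<eta> / 2)))"
proof -
  define u where "u y = complex_of_real (1 - exp y)" for y
  define I where "I y x = Beta_kernel lam (1 - lam) x * (1 - u y * of_real x) powr (- 1)" for y x
  have params: "Re lam > 0" "Re (1 - lam) > 0" using lam by auto
  have u: "u y \<in> cut_plane" for y by (simp add: u_def cut_plane_iff)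
  have I_int: "set_integrable lborel {0<..<1} (I y)" for y
    unfolding I_def by (rule set_integrable_Euler[OF params u])
  have I_val: "(LINT x:{0<..<1}|lborel. I y x) = Gamma lam * Gamma (1 - lam) * exp (- (lam * of_real y))" for y
  proof -
    have "(1 - u y) powr (- lam) = exp (- (lam * of_real y))"
      using of_real_powr_exp[of "exp y" "- lam"] by (simp add: u_def)
    thus ?thesis using Euler_integral_elementary[OF params u, of y] by (simp add: I_def Beta_def)
  qed
  have "Beta_kernel (lam + of_nat 0) (1 - lam + of_nat 0) x * of_real (cosh_ratio_weight ((sinh (\<eta> / 2))\<^sup>2) x) =
      of_real (exp (\<eta> / 2)) / (2 * of_real (cosh (\<eta> / 2))) * I \<eta> x +
        of_real (exp (- (\<eta> / 2))) / (2 * of_real (cosh (\<eta> / 2))) * I (- \<eta>) x"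
    if x: "x \<in> {0<..<1}" for x
  proof -
    have "(1 - u y * of_real x) powr (- 1) = 1 / complex_of_real (1 - (1 - exp y) * x)" for y
      by (simp add: u_def powr_minus inverse_eq_divide)
    thus ?thesis
      unfolding cosh_ratio_weight_partial_fractions[OF x] I_def
      by (simp add: add_divide_distrib distrib_left mult_ac del: of_real_diff)
  qed
  hence "cosh_ratio_remainder 0 lam ((sinh (\<eta> / 2))\<^sup>2) =
      (LINT x:{0<..<1}|lborel. of_real (exp (\<eta> / 2)) / (2 * of_real (cosh (\<eta> / 2))) * I \<eta> x +
        of_real (exp (- (\<eta> / 2))) / (2 * of_real (cosh (\<eta> / 2))) * I (- \<eta>) x)"
    unfolding cosh_ratio_remainder_def by (intro set_lebesgue_integral_cong) auto
  also have "\<dots> = Gamma lam * Gamma (1 - lam) *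
      (of_real (exp (\<eta> / 2)) * exp (- (lam * of_real \<eta>)) +
        of_real (exp (- (\<eta> / 2))) * exp (lam * of_real \<eta>)) / (2 * of_real (cosh (\<eta> / 2)))"
    by (subst set_integral_add(2)) (simp_all add: I_int I_val set_integrable_mult_right add_divide_distrib distrib_left mult_ac)
  also have "of_real (exp (\<eta> / 2)) * exp (- (lam * of_real \<eta>)) +
      of_real (exp (- (\<eta> / 2))) * exp (lam * of_real \<eta>) =
      2 * cosh ((lam - 1 / 2) * of_real \<eta>)"
    unfolding exp_of_real[symmetric] by (simp add: cosh_field_def algebra_simps flip: exp_add)
  finally show ?thesis by simp
qed

lemma cosh_ratio_remainder_Suc:
  assumes lam: "- real N < Re lam" "Re lam < 1 + real N" and s: "s \<ge> 0"
  shows "cosh_ratio_remainder N lam s =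
    Beta (lam + of_nat N) (1 - lam + of_nat N) - 4 * of_real s * cosh_ratio_remainder (Suc N) lam s"
proof -
  have params: "Re (lam + of_nat N) > 0" "Re (1 - lam + of_nat N) > 0"
    "Re (lam + of_nat (Suc N)) > 0" "Re (1 - lam + of_nat (Suc N)) > 0" using lam by auto
  have "Beta_kernel (lam + of_nat N) (1 - lam + of_nat N) x * of_real (cosh_ratio_weight s x) =
      Beta_kernel (lam + of_nat N) (1 - lam + of_nat N) x -
      4 * of_real s * (Beta_kernel (lam + of_nat (Suc N)) (1 - lam + of_nat (Suc N)) x *
        of_real (cosh_ratio_weight s x))"
    if x: "x \<in> {0<..<1}" for x
  proof -
    have "1 + 4 * x * (1 - x) * s \<noteq> 0" using cosh_ratio_weight_denominator[OF x s] by linarith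
    hence "cosh_ratio_weight s x = 1 - 4 * s * (x * (1 - x) * cosh_ratio_weight s x)"
      by (simp add: cosh_ratio_weight_def field_simps)
    from arg_cong[OF this, of complex_of_real]
    have weight: "complex_of_real (cosh_ratio_weight s x) =
        1 - 4 * of_real s * (of_real x * of_real (1 - x) * of_real (cosh_ratio_weight s x))"
      by (simp only: of_real_diff[of 1] of_real_mult of_real_1 of_real_numeral)
    have "Beta_kernel (lam + of_nat (Suc N)) (1 - lam + of_nat (Suc N)) x =
        Beta_kernel (lam + of_nat N) (1 - lam + of_nat N) x * (of_real x * of_real (1 - x))"
      using Beta_kernel_shift[OF x, of "lam + of_nat N" 1 "1 - lam + of_nat N" 1] by (simp add: add_ac)
    thus ?thesis by (subst weight) (simp only: right_diff_distrib left_diff_distrib mult_ac mult_1)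
  qed
  hence "cosh_ratio_remainder N lam s =
      (LINT x:{0<..<1}|lborel. Beta_kernel (lam + of_nat N) (1 - lam + of_nat N) x -
      4 * of_real s * (Beta_kernel (lam + of_nat (Suc N)) (1 - lam + of_nat (Suc N)) x *
        of_real (cosh_ratio_weight s x)))"
    unfolding cosh_ratio_remainder_def by (intro set_lebesgue_integral_cong) auto
  also have "\<dots> = Beta (lam + of_nat N) (1 - lam + of_nat N) - 4 * of_real s * cosh_ratio_remainder (Suc N) lam s"
    unfolding cosh_ratio_remainder_def
    by (subst set_integral_diff(2)[OF set_integrable_Beta_kernel[OF params(1,2)]
          set_integrable_mult_right[OF set_integrable_cosh_ratio[OF params(3,4) s]]])
       (simp only: Beta_kernel_integral[OF params(1,2)] set_integral_mult_right)
  finally show ?thesis .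
qed

lemma cosh_ratio_remainder_geometric_sum:
  assumes lam: "0 < Re lam" "Re lam < 1" and s: "s \<ge> 0"
  shows "cosh_ratio_remainder 0 lam s =
    (\<Sum>n<N. (- 4 * of_real s) ^ n * Beta (lam + of_nat n) (1 - lam + of_nat n)) +
      (- 4 * of_real s) ^ N * cosh_ratio_remainder N lam s"
proof (induction N)
  case (Suc N)
  have step: "cosh_ratio_remainder N lam s =
      Beta (lam + of_nat N) (1 - lam + of_nat N) + (- 4 * of_real s) * cosh_ratio_remainder (Suc N) lam s"
    using cosh_ratio_remainder_Suc[of N lam s] lam s by simp
  show ?case by (subst Suc.IH, subst step) (simp add: algebra_simps)
qed simp

text \<open>For \<open>N = 0\<close> this is a partial fraction decomposition; summing a geometric series gives all \<open>N\<close> when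
  \<open>0 < Re lam < 1\<close>, and analytic continuation in \<open>lam\<close> does the rest.\<close>

lemma cosh_ratio_expansion_strip:
  fixes \<eta> :: real
  assumes lam: "0 < Re lam" "Re lam < 1"
  defines "s \<equiv> (sinh (\<eta> / 2))\<^sup>2"
  shows "cosh ((lam - 1 / 2) * of_real \<eta>) / of_real (cosh (\<eta> / 2)) =
    (\<Sum>n<N. cosh_ratio_coeff n lam * of_real s ^ n) +
    sin (of_real pi * lam) / of_real pi * ((- 4 * of_real s) ^ N * cosh_ratio_remainder N lam s)"
proof -
  define q where "q = sin (of_real pi * lam) / of_real pi"
  have nonint: "lam \<notin> \<int>" using lam by (auto elim!: Ints_cases)
  have "cosh ((lam - 1 / 2) * of_real \<eta>) / of_real (cosh (\<eta> / 2)) = q * cosh_ratio_remainder 0 lam s"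
    unfolding s_def cosh_ratio_remainder_0[OF lam] using sin_Gamma_reflection[OF nonint]
    by (simp only: q_def mult.assoc[symmetric]) simp
  also have "\<dots> = (\<Sum>n<N. (- 4 * of_real s) ^ n * (q * Beta (lam + of_nat n) (1 - lam + of_nat n))) +
      q * ((- 4 * of_real s) ^ N * cosh_ratio_remainder N lam s)"
    using cosh_ratio_remainder_geometric_sum[OF lam, of s N]
    by (simp add: s_def distrib_left sum_distrib_left mult_ac)
  also have "(\<Sum>n<N. (- 4 * of_real s) ^ n * (q * Beta (lam + of_nat n) (1 - lam + of_nat n))) =
      (\<Sum>n<N. cosh_ratio_coeff n lam * of_real s ^ n)"
    unfolding q_def sin_Beta_eq_pochhammer[OF nonint] cosh_ratio_coeff_def power_mult_distrib
    by (simp only: mult_ac times_divide_eq_left times_divide_eq_right)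
  finally show ?thesis unfolding q_def .
qed

lemma cosh_ratio_expansion:
  fixes \<eta> :: real
  assumes lam: "- real N < Re lam" "Re lam < 1 + real N"
  defines "s \<equiv> (sinh (\<eta> / 2))\<^sup>2"
  shows "cosh ((lam - 1 / 2) * of_real \<eta>) / of_real (cosh (\<eta> / 2)) =
    (\<Sum>n<N. cosh_ratio_coeff n lam * of_real s ^ n) +
    sin (of_real pi * lam) / of_real pi * ((- 4 * of_real s) ^ N * cosh_ratio_remainder N lam s)"
proof (rule holomorphic_eq_on_segment[where l = 0 and r = 1 and v = 1 and z = lam
      and f = "\<lambda>lam. cosh ((lam - 1 / 2) * of_real \<eta>) / of_real (cosh (\<eta> / 2))"
      and g = "\<lambda>lam. (\<Sum>n<N. cosh_ratio_coeff n lam * of_real s ^ n) +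
        sin (of_real pi * lam) / of_real pi * ((- 4 * of_real s) ^ N * cosh_ratio_remainder N lam s)"])
  let ?S = "{lam. - real N < Re lam \<and> Re lam < 1 + real N}"
  have strip: "?S = {z. Re z > - real N} \<inter> {z. Re z < 1 + real N}" by auto
  show "open ?S" "connected ?S" unfolding strip
    by (intro open_Int open_halfspace_Re_lt open_halfspace_Re_gt convex_connected convex_Int
        convex_halfspace_Re_lt convex_halfspace_Re_gt)+
  show "(\<lambda>lam. cosh ((lam - 1 / 2) * of_real \<eta>) / of_real (cosh (\<eta> / 2))) holomorphic_on ?S"
    by (intro holomorphic_intros) auto
  show "(\<lambda>lam. (\<Sum>n<N. cosh_ratio_coeff n lam * of_real s ^ n) +
      sin (of_real pi * lam) / of_real pi *
        ((- 4 * of_real s) ^ N * cosh_ratio_remainder N lam s)) holomorphic_on ?S"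
    unfolding cosh_ratio_coeff_def pochhammer_prod
    by (intro holomorphic_intros holomorphic_on_cosh_ratio_remainder) (auto simp: s_def)
  fix t :: real assume "0 < t" "t < 1"
  hence "0 < Re (of_real t * 1)" "Re (of_real t * 1) < 1" by simp_all
  from cosh_ratio_expansion_strip[OF this]
  show "of_real t * 1 \<in> ?S \<and> cosh ((of_real t * 1 - 1 / 2) * of_real \<eta>) / of_real (cosh (\<eta> / 2)) =
      (\<Sum>n<N. cosh_ratio_coeff n (of_real t * 1) * of_real s ^ n) +
      sin (of_real pi * (of_real t * 1)) / of_real pi *
        ((- 4 * of_real s) ^ N * cosh_ratio_remainder N (of_real t * 1) s)"
    using \<open>0 < t\<close> \<open>t < 1\<close> unfolding s_def by (intro conjI) auto
qed (use lam in auto)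

definition terminant :: "real \<Rightarrow> complex \<Rightarrow> complex" where
  "terminant p c = (LINT v:{0<..}|lborel. Gamma_kernel (of_real p) v * (1 / (1 + c * of_real v)))"

lemma one_plus_mult_nonzero:
  assumes "c \<notin> \<real>\<^sub>\<le>\<^sub>0 \<or> c = 0" "v > 0"
  shows "1 + c * complex_of_real v \<noteq> 0"
proof
  assume "1 + c * complex_of_real v = 0"
  hence "c = of_real (- 1 / v)" using assms(2) by (simp add: field_simps add_eq_0_iff)
  thus False using assms by (simp add: complex_nonpos_Reals_iff)
qed

lemma continuous_on_terminant_weight:
  assumes "\<And>v. v > 0 \<Longrightarrow> 1 + c * complex_of_real v \<noteq> 0"
  shows "continuous_on {0<..} (\<lambda>v. 1 / (1 + c * complex_of_real v))"
  by (intro continuous_intros) (use assms in auto)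

lemma
  assumes p: "p > 0" and d: "d > 0" and lower: "\<And>v. v > 0 \<Longrightarrow> d \<le> norm (1 + c * complex_of_real v)"
  shows set_integrable_terminant: "set_integrable lborel {0<..} (\<lambda>v. Gamma_kernel (of_real p) v *
      (1 / (1 + c * of_real v)))"
    and norm_terminant_le: "norm (terminant p c) \<le> Gamma p / d"
proof -
  have cont: "continuous_on {0<..} (\<lambda>v. 1 / (1 + c * complex_of_real v))"
    by (rule continuous_on_terminant_weight) (use lower d in force)
  have bound: "norm (1 / (1 + c * complex_of_real v)) \<le> 1 / d" if "v > 0" for v
    using lower[OF that] d by (simp add: norm_divide frac_le)
  have "Re (complex_of_real p) > 0" using p by simp
  from set_integrable_Gamma_kernel_bounded[OF this cont bound]
  show "set_integrable lborel {0<..} (\<lambda>v. Gamma_kernel (of_real p) v * (1 / (1 + c * of_real v)))"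
    and "norm (terminant p c) \<le> Gamma p / d"
    by (simp_all add: terminant_def)
qed

lemma holomorphic_on_terminant:
  assumes p: "p > 0"
  shows "terminant p holomorphic_on - \<real>\<^sub>\<le>\<^sub>0"
  unfolding terminant_def[abs_def]
proof (rule holomorphic_on_Gamma_kernel_integral[OF _ open_slit_plane])
  fix c :: complex assume "c \<in> - \<real>\<^sub>\<le>\<^sub>0"
  hence c: "c \<notin> \<real>\<^sub>\<le>\<^sub>0" by simp
  thus "continuous_on {0<..} (\<lambda>v. 1 / (1 + c * complex_of_real v))"
    by (intro continuous_on_terminant_weight one_plus_mult_nonzero) auto
  obtain d where d: "d > 0" "\<forall>\<^sub>F u in nhds c. \<forall>v>0. d \<le> norm (1 + u * complex_of_real v)"
    using norm_one_plus_mult_lower_bound[OF c] .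
  from d(2) have "\<forall>\<^sub>F u in nhds c. \<forall>v>0. norm (1 / (1 + u * complex_of_real v)) \<le> 1 / d"
    by eventually_elim (use d(1) in \<open>auto simp: norm_divide intro!: frac_le\<close>)
  thus "\<exists>K. \<forall>\<^sub>F u in nhds c. \<forall>v>0. norm (1 / (1 + u * complex_of_real v)) \<le> K" ..
next
  fix v :: real assume "v > 0"
  thus "(\<lambda>c. 1 / (1 + c * complex_of_real v)) holomorphic_on - \<real>\<^sub>\<le>\<^sub>0"
    using one_plus_mult_nonzero by (intro holomorphic_intros) auto
qed (use p in simp)

lemma terminant_0: "p > 0 \<Longrightarrow> terminant p 0 = of_real (Gamma p)"
  using Gamma_kernel_integral[of "of_real p"] by (simp add: terminant_def Gamma_complex_of_real)

lemma continuous_on_terminant_divide: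
  assumes p: "p > 0" and c: "c \<notin> \<real>\<^sub>\<le>\<^sub>0 \<or> c = 0"
  shows "continuous_on {0<..} (\<lambda>t. terminant p (c / complex_of_real t))"
proof (cases "c = 0")
  case False
  hence "c / complex_of_real t \<in> - \<real>\<^sub>\<le>\<^sub>0" if "t > 0" for t
    using c that of_real_mult_notin_nonpos_Reals[of c "1 / t"] by simp
  thus ?thesis
    by (intro continuous_on_compose2[OF holomorphic_on_imp_continuous_on[OF holomorphic_on_terminant[OF p]]] continuous_intros) auto
qed simp

definition terminant_average :: "complex \<Rightarrow> real \<Rightarrow> complex \<Rightarrow> complex" where
  "terminant_average a p c = (LINT t:{0<..}|lborel. Gamma_kernel a t * terminant p (c / of_real t))"

lemma norm_terminant_average_le:
  assumes a: "Re a > 0" and p: "p > 0" and c: "c \<notin> \<real>\<^sub>\<le>\<^sub>0 \<or> c = 0"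
    and bound: "\<And>r. r > 0 \<Longrightarrow> norm (terminant p (of_real r * c)) \<le> K"
  shows "norm (terminant_average a p c) \<le> Gamma (Re a) * K"
  unfolding terminant_average_def
proof (rule set_integrable_Gamma_kernel_bounded(2)[OF a continuous_on_terminant_divide[OF p c]])
  show "norm (terminant p (c / of_real t)) \<le> K" if "t > 0" for t
    using bound[of "1 / t"] that by simp
qed

lemma terminant_average_0: "Re a > 0 \<Longrightarrow> p > 0 \<Longrightarrow> terminant_average a p 0 = Gamma a * of_real (Gamma p)"
  by (simp add: terminant_average_def terminant_0 Gamma_kernel_integral)

lemma terminant_locally_bounded:
  assumes p: "p > 0" and c: "c \<notin> \<real>\<^sub>\<le>\<^sub>0"
  shows "\<exists>K. \<forall>\<^sub>F u in nhds c. u \<notin> \<real>\<^sub>\<le>\<^sub>0 \<and> (\<forall>r>0. norm (terminant p (of_real r * u)) \<le> K)"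
proof -
  obtain d where d: "d > 0" "\<forall>\<^sub>F u in nhds c. \<forall>v>0. d \<le> norm (1 + u * complex_of_real v)"
    using norm_one_plus_mult_lower_bound[OF c] .
  have "\<forall>\<^sub>F u in nhds c. u \<in> - \<real>\<^sub>\<le>\<^sub>0" using c by (intro eventually_nhds_in_open open_slit_plane) simp
  with d(2) have "\<forall>\<^sub>F u in nhds c. u \<notin> \<real>\<^sub>\<le>\<^sub>0 \<and> (\<forall>r>0. norm (terminant p (of_real r * u)) \<le> Gamma p / d)"
  proof eventually_elim
    case (elim u)
    have "d \<le> norm (1 + of_real r * u * complex_of_real v)" if "r > 0" "v > 0" for r v
      using elim(1)[rule_format, of "r * v"] that by (simp add: mult_ac)
    thus ?case using elim(2) norm_terminant_le[OF p d(1)] by simp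
  qed
  thus ?thesis ..
qed

lemma holomorphic_on_terminant_average:
  assumes a: "Re a > 0" and p: "p > 0"
  shows "terminant_average a p holomorphic_on - \<real>\<^sub>\<le>\<^sub>0"
  unfolding terminant_average_def[abs_def]
proof (rule holomorphic_on_Gamma_kernel_integral[OF a open_slit_plane])
  fix c :: complex assume "c \<in> - \<real>\<^sub>\<le>\<^sub>0"
  hence c: "c \<notin> \<real>\<^sub>\<le>\<^sub>0" by simp
  thus "continuous_on {0<..} (\<lambda>t. terminant p (c / complex_of_real t))"
    by (intro continuous_on_terminant_divide p) simp
  obtain K where "\<forall>\<^sub>F u in nhds c. u \<notin> \<real>\<^sub>\<le>\<^sub>0 \<and> (\<forall>r>0. norm (terminant p (of_real r * u)) \<le> K)"
    using terminant_locally_bounded[OF p c] by blast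
  hence "\<forall>\<^sub>F u in nhds c. \<forall>t>0. norm (terminant p (u / of_real t)) \<le> K"
  proof eventually_elim
    case (elim u)
    have "norm (terminant p (u / of_real t)) \<le> K" if "t > 0" for t
      using conjunct2[OF elim, rule_format, of "1 / t"] that by simp
    thus ?case by blast
  qed
  thus "\<exists>K. \<forall>\<^sub>F u in nhds c. \<forall>t>0. norm (terminant p (u / of_real t)) \<le> K" ..
next
  fix t :: real assume t: "t > 0"
  have "(\<lambda>c. c / complex_of_real t) holomorphic_on - \<real>\<^sub>\<le>\<^sub>0" using t by (intro holomorphic_intros) simp
  moreover have "(\<lambda>c. c / complex_of_real t) ` (- \<real>\<^sub>\<le>\<^sub>0) \<subseteq> - \<real>\<^sub>\<le>\<^sub>0"
    using of_real_mult_notin_nonpos_Reals[of _ "1 / t"] t by auto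
  ultimately have "terminant p \<circ> (\<lambda>c. c / of_real t) holomorphic_on - \<real>\<^sub>\<le>\<^sub>0"
    by (rule holomorphic_on_compose_gen[OF _ holomorphic_on_terminant[OF p]])
  thus "(\<lambda>c. terminant p (c / of_real t)) holomorphic_on - \<real>\<^sub>\<le>\<^sub>0" by (simp add: o_def)
qed

lemma terminant_average_locally_bounded:
  assumes a: "Re a > 0" and p: "p > 0" and c: "c \<notin> \<real>\<^sub>\<le>\<^sub>0"
  shows "\<exists>K. \<forall>\<^sub>F u in nhds c. \<forall>r>0. norm (terminant_average a p (of_real r * u)) \<le> K"
proof -
  obtain K where "\<forall>\<^sub>F u in nhds c. u \<notin> \<real>\<^sub>\<le>\<^sub>0 \<and> (\<forall>r>0. norm (terminant p (of_real r * u)) \<le> K)"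
    using terminant_locally_bounded[OF p c] by blast
  hence "\<forall>\<^sub>F u in nhds c. \<forall>r>0. norm (terminant_average a p (of_real r * u)) \<le> Gamma (Re a) * K"
  proof eventually_elim
    case (elim u)
    have "norm (terminant p (of_real s * (of_real r * u))) \<le> K" if "r > 0" "s > 0" for r s
      using conjunct2[OF elim, rule_format, of "s * r"] that by (simp add: mult.assoc)
    thus ?case using elim of_real_mult_notin_nonpos_Reals by (intro allI impI norm_terminant_average_le a p) auto
  qed
  thus ?thesis ..
qed

definition Stieltjes_kernel :: "complex \<Rightarrow> real \<Rightarrow> real \<Rightarrow> real \<Rightarrow> real \<Rightarrow> complex" where
  "Stieltjes_kernel \<kappa> p w y s = of_real (w + s) powr (- \<kappa>) * of_real (s powr (p - 1) / (1 + y * s))"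

lemma terminant_of_real_divide:
  assumes r: "r > 0" and y: "y \<ge> 0"
  shows "terminant p (of_real (y / r)) =
    (LINT s:{0<..}|lborel. of_real (r powr p * (s powr (p - 1) * exp (- (r * s))) / (1 + y * s)))"
proof -
  have "y / r \<ge> 0" using r y by simp
  hence slit: "complex_of_real (y / r) \<notin> \<real>\<^sub>\<le>\<^sub>0 \<or> complex_of_real (y / r) = 0"
    by (auto simp: complex_nonpos_Reals_iff)
  have "terminant p (of_real (y / r)) = (LINT s:{0<..}|lborel.
      r *\<^sub>R (Gamma_kernel (of_real p) (r * s) * (1 / (1 + of_real (y / r) * of_real (r * s)))))"
    unfolding terminant_def
    by (rule set_integral_Ioi_scale[OF r])
       (intro continuous_intros continuous_on_terminant_weight one_plus_mult_nonzero slit)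
  also have "\<dots> = (LINT s:{0<..}|lborel. of_real (r powr p * (s powr (p - 1) * exp (- (r * s))) / (1 + y * s)))"
  proof (intro set_lebesgue_integral_cong allI impI)
    fix s :: real assume s: "s \<in> {0<..}"
    have "1 + complex_of_real (y / r) * of_real (r * s) = of_real (1 + y * s)" using r by simp
    moreover have "Gamma_kernel (of_real p) (r * s) = of_real ((r * s) powr (p - 1) * exp (- (r * s)))"
      using s r by (intro Gamma_kernel_pos_real) simp
    moreover have "r * (r * s) powr (p - 1) = r powr p * s powr (p - 1)"
      using r s powr_add[of r 1 "p - 1"] by (simp add: powr_mult)
    ultimately show "r *\<^sub>R (Gamma_kernel (of_real p) (r * s) * (1 / (1 + of_real (y / r) * of_real (r * s)))) =
        complex_of_real (r powr p * (s powr (p - 1) * exp (- (r * s))) / (1 + y * s))"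
      by (simp add: scaleR_conv_of_real mult.assoc[symmetric] flip: of_real_mult)
  qed auto
  finally show ?thesis .
qed

definition Stieltjes_integrand :: "complex \<Rightarrow> real \<Rightarrow> real \<Rightarrow> real \<Rightarrow> real \<Rightarrow> real \<Rightarrow> complex" where
  "Stieltjes_integrand \<kappa> p w y t s = Gamma_kernel (\<kappa> - of_real p) t *
     of_real ((t / w) powr p * (s powr (p - 1) * exp (- (t / w * s))) / (1 + y * s))"

lemma norm_Stieltjes_integrand_le:
  assumes "w > 0" "y \<ge> 0" "t > 0" "s > 0"
  shows "norm (Stieltjes_integrand \<kappa> p w y t s) \<le>
    t powr (Re \<kappa> - p - 1) * exp (- t) * (t / w) powr p * (s powr (p - 1) * exp (- (t / w * s)))"
proof -
  define X where "X = (t / w) powr p * (s powr (p - 1) * exp (- (t / w * s)))"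
  have "X \<ge> 0" by (simp add: X_def)
  moreover have "1 + y * s \<ge> 1" using assms by simp
  ultimately have le: "X / (1 + y * s) \<le> X / 1" and nonneg: "0 \<le> X / (1 + y * s)"
    by (intro divide_left_mono divide_nonneg_nonneg; simp)+
  have "t powr (Re \<kappa> - p - 1) * exp (- t) * \<bar>X / (1 + y * s)\<bar> \<le> t powr (Re \<kappa> - p - 1) * exp (- t) * X"
    unfolding abs_of_nonneg[OF nonneg] using le by (intro mult_left_mono) auto
  thus ?thesis
    unfolding Stieltjes_integrand_def norm_mult norm_of_real norm_Gamma_kernel[OF assms(3)] X_def
    by (simp add: mult.assoc)
qed

lemma continuous_on_Stieltjes_integrand:
  assumes "w > 0" "y \<ge> 0"
  shows "continuous_on ({0<..} \<times> {0<..}) (\<lambda>(t, s). Stieltjes_integrand \<kappa> p w y t s)"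
    and "t > 0 \<Longrightarrow> continuous_on {0<..} (Stieltjes_integrand \<kappa> p w y t)"
proof -
  have "1 + y * s \<noteq> 0" if "s > 0" for s using assms that by (simp add: add_pos_nonneg less_imp_neq[symmetric])
  thus "continuous_on ({0<..} \<times> {0<..}) (\<lambda>(t, s). Stieltjes_integrand \<kappa> p w y t s)"
    unfolding Stieltjes_integrand_def case_prod_beta using assms
    by (intro continuous_intros continuous_on_compose2[OF continuous_on_Gamma_kernel]) auto
  thus "continuous_on {0<..} (Stieltjes_integrand \<kappa> p w y t)" if "t > 0"
    by (rule continuous_on_compose2[of _ "\<lambda>(t, s). Stieltjes_integrand \<kappa> p w y t s" _ "\<lambda>s. (t, s)", unfolded prod.case])
       (use that in \<open>auto intro!: continuous_intros\<close>)
qed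

lemma Stieltjes_integrand_integral_right:
  assumes w: "w > 0" and y: "y \<ge> 0" and t: "t > 0"
  shows "(LINT s:{0<..}|lborel. Stieltjes_integrand \<kappa> p w y t s) =
    Gamma_kernel (\<kappa> - of_real p) t * terminant p (of_real (y * w) / of_real t)"
proof -
  have arg: "complex_of_real (y * w) / of_real t = of_real (y / (t / w))" by simp
  have "t / w > 0" using w t by simp
  note terminant = terminant_of_real_divide[OF this y]
  show ?thesis unfolding arg terminant Stieltjes_integrand_def set_integral_mult_right ..
qed

lemma Stieltjes_integrand_integral_left:
  assumes w: "w > 0" and \<kappa>: "Re \<kappa> > 0" and s: "s > 0"
  shows "(LINT t:{0<..}|lborel. Stieltjes_integrand \<kappa> p w y t s) =
    Gamma \<kappa> * of_real w powr (\<kappa> - of_real p) * Stieltjes_kernel \<kappa> p w y s"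
proof -
  define C where "C = complex_of_real w powr (- of_real p) * of_real (s powr (p - 1) / (1 + y * s))"
  have "Stieltjes_integrand \<kappa> p w y t s = C * (of_real t powr (\<kappa> - 1) * exp (- (of_real (1 + s / w) * of_real t)))"
    if t: "t > 0" for t
  proof -
    have "(t / w) powr p = t powr p * w powr (- p)" using t w by (simp add: powr_divide powr_minus_divide)
    hence "complex_of_real ((t / w) powr p) = of_real t powr of_real p * of_real w powr (- of_real p)"
      using t w powr_of_real[of t p] powr_of_real[of w "- p"] by simp
    moreover have "of_real t powr (\<kappa> - of_real p - 1) * of_real t powr of_real p = complex_of_real t powr (\<kappa> - 1)"
      by (simp flip: powr_add)
    moreover have "exp (- complex_of_real t) * of_real (exp (- (t / w * s))) =
        exp (- (of_real (1 + s / w) * of_real t))"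
      unfolding exp_of_real[symmetric] exp_add[symmetric] by (rule arg_cong[where f = exp]) (simp add: field_simps)
    ultimately show ?thesis
      unfolding Stieltjes_integrand_def Gamma_kernel_def C_def of_real_mult of_real_divide by algebra
  qed
  hence "(LINT t:{0<..}|lborel. Stieltjes_integrand \<kappa> p w y t s) =
      (LINT t:{0<..}|lborel. C * (of_real t powr (\<kappa> - 1) * exp (- (of_real (1 + s / w) * of_real t))))"
    by (intro set_lebesgue_integral_cong) auto
  also have "\<dots> = C * (Gamma \<kappa> * of_real (1 + s / w) powr (- \<kappa>))"
    unfolding set_integral_mult_right
    using w s \<kappa> by (subst Gamma_set_integral) (auto simp: add_pos_pos)
  also have "of_real (1 + s / w) powr (- \<kappa>) = of_real w powr \<kappa> * of_real (w + s) powr (- \<kappa>)"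
  proof -
    have "complex_of_real (w + s) = of_real w * of_real (1 + s / w)" using w by (simp add: field_simps)
    hence "of_real (w + s) powr (- \<kappa>) = of_real w powr (- \<kappa>) * complex_of_real (1 + s / w) powr (- \<kappa>)"
      by (simp only: of_real_mult_powr[OF w])
    thus ?thesis using w by (simp add: powr_minus)
  qed
  also have "C * (Gamma \<kappa> * (of_real w powr \<kappa> * of_real (w + s) powr (- \<kappa>))) =
      Gamma \<kappa> * of_real w powr (\<kappa> - of_real p) * Stieltjes_kernel \<kappa> p w y s"
    unfolding diff_conv_add_uminus powr_add by (simp add: C_def Stieltjes_kernel_def)
  finally show ?thesis .
qed

lemma
  assumes w: "w > 0" and y: "y \<ge> 0" and p: "p > 0" and \<kappa>: "Re \<kappa> > p"
  shows set_integrable_Stieltjes_kernel: "set_integrable lborel {0<..} (Stieltjes_kernel \<kappa> p w y)"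
    and Stieltjes_kernel_integral: "Gamma \<kappa> * of_real w powr (\<kappa> - of_real p) *
        (LINT s:{0<..}|lborel. Stieltjes_kernel \<kappa> p w y s) =
      terminant_average (\<kappa> - of_real p) p (of_real (y * w))"
proof -
  let ?f = "Stieltjes_integrand \<kappa> p w y"
    and ?h = "\<lambda>t s. t powr (Re \<kappa> - p - 1) * exp (- t) * (t / w) powr p * (s powr (p - 1) * exp (- (t / w * s)))"
  have h_int: "set_integrable lborel {0<..} (?h t)" if "t > 0" for t
    using that w p by (intro set_integrable_mult_right set_integrable_powr_exp) auto
  have f_int: "set_integrable lborel {0<..} (?f t)" if "t \<in> {0<..}" for t
    by (rule set_integrable_dominated[OF h_int])
       (use that norm_Stieltjes_integrand_le[OF w y] continuous_on_Stieltjes_integrand(2)[OF w y] in auto)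
  have norm_le: "(LINT s:{0<..}|lborel. norm (?f t s)) \<le> t powr (Re \<kappa> - p - 1) * exp (- t) * Gamma p"
    if "t \<in> {0<..}" for t
  proof -
    have "(LINT s:{0<..}|lborel. norm (?f t s)) \<le> (LINT s:{0<..}|lborel. ?h t s)"
      using that by (intro set_integral_mono set_integrable_norm f_int h_int norm_Stieltjes_integrand_le w y) auto
    also have "\<dots> = t powr (Re \<kappa> - p - 1) * exp (- t) * ((t / w) powr p * (Gamma p * (t / w) powr (- p)))"
      using Gamma_set_integral_real[OF p, of "t / w"] that w by simp
    also have "(t / w) powr p * (Gamma p * (t / w) powr (- p)) = Gamma p"
      using that w by (simp add: powr_minus)
    finally show ?thesis .
  qed
  have dom: "set_integrable lborel {0<..} (\<lambda>t. t powr (Re \<kappa> - p - 1) * exp (- t) * Gamma p)"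
    using set_integrable_powr_exp[of "Re \<kappa> - p" 1] \<kappa> by (intro set_integrable_mult_left) simp
  note Fubini = set_integral_Fubini[OF _ _ continuous_on_Stieltjes_integrand(1)[OF w y] f_int norm_le dom, simplified]
  have "Re \<kappa> > 0" using p \<kappa> by simp
  note left = Stieltjes_integrand_integral_left[OF w this]
  have "set_integrable lborel {0<..} (\<lambda>s. Gamma \<kappa> * of_real w powr (\<kappa> - of_real p) * Stieltjes_kernel \<kappa> p w y s)"
    by (rule set_integrable_cong[THEN iffD1, OF _ _ _ Fubini(3)]) (use left in auto)
  thus "set_integrable lborel {0<..} (Stieltjes_kernel \<kappa> p w y)"
    using Gamma_nonzero_Re_pos[OF \<open>Re \<kappa> > 0\<close>] w by (simp add: set_integrable_mult_right_iff)
  have "terminant_average (\<kappa> - of_real p) p (of_real (y * w)) =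
      (LINT t:{0<..}|lborel. LINT s:{0<..}|lborel. ?f t s)"
    unfolding terminant_average_def
    by (intro set_lebesgue_integral_cong allI impI Stieltjes_integrand_integral_right[OF w y, symmetric]) auto
  also have "\<dots> = (LINT s:{0<..}|lborel. LINT t:{0<..}|lborel. ?f t s)" by (rule Fubini(1))
  also have "\<dots> = (LINT s:{0<..}|lborel. Gamma \<kappa> * of_real w powr (\<kappa> - of_real p) * Stieltjes_kernel \<kappa> p w y s)"
    by (intro set_lebesgue_integral_cong allI impI left) auto
  finally show "Gamma \<kappa> * of_real w powr (\<kappa> - of_real p) * (LINT s:{0<..}|lborel. Stieltjes_kernel \<kappa> p w y s) =
      terminant_average (\<kappa> - of_real p) p (of_real (y * w))"
    by (simp only: set_integral_mult_right)
qed

definition Q_remainder :: "complex \<Rightarrow> complex \<Rightarrow> nat \<Rightarrow> complex \<Rightarrow> complex" where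
  "Q_remainder \<alpha> lam N w = sin (of_real pi * lam) / of_real (pi * sqrt pi) * (- 4 * w) ^ N *
     (LINT x:{0<..<1}|lborel. Beta_kernel (lam + of_nat N) (1 - lam + of_nat N) x *
        terminant_average (\<alpha> - of_nat N) (real N + 1 / 2) (of_real (4 * x * (1 - x)) * w))"

lemma four_mult_complement_pos: "x \<in> {0<..<1} \<Longrightarrow> 4 * x * (1 - x) > (0::real)"
  by simp

lemma continuous_on_terminant_average_scaled:
  assumes a: "Re a > 0" and p: "p > 0" and w: "w \<notin> \<real>\<^sub>\<le>\<^sub>0"
  shows "continuous_on {0<..<1} (\<lambda>x. terminant_average a p (of_real (4 * x * (1 - x)) * w))"
  by (rule continuous_on_compose2[OF holomorphic_on_imp_continuous_on[OF holomorphic_on_terminant_average[OF a p]]])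
     (use of_real_mult_notin_nonpos_Reals[OF w four_mult_complement_pos] in
       \<open>auto intro!: continuous_intros simp del: of_real_mult\<close>)

lemma norm_Q_remainder_le:
  assumes \<alpha>: "Re \<alpha> > real N" and lam: "- real N < Re lam" "Re lam < 1 + real N" and w: "w \<notin> \<real>\<^sub>\<le>\<^sub>0"
    and bound: "\<And>r. r > 0 \<Longrightarrow> norm (terminant (real N + 1 / 2) (of_real r * w)) \<le> K"
  shows "norm (Q_remainder \<alpha> lam N w) \<le> norm (sin (of_real pi * lam)) / (pi * sqrt pi) * (4 * norm w) ^ N *
    (Beta (Re lam + real N) (1 - Re lam + real N) * (Gamma (Re \<alpha> - real N) * K))"
proof -
  have params: "Re (lam + of_nat N) > 0" "Re (1 - lam + of_nat N) > 0" and a: "Re (\<alpha> - of_nat N) > 0"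
    using lam \<alpha> by auto
  have p: "real N + 1 / 2 > 0" by simp
  have average: "norm (terminant_average (\<alpha> - of_nat N) (real N + 1 / 2) (of_real (4 * x * (1 - x)) * w)) \<le>
      Gamma (Re \<alpha> - real N) * K"
    if x: "x \<in> {0<..<1}" for x
  proof -
    note y = four_mult_complement_pos[OF x]
    have "norm (terminant (real N + 1 / 2) (of_real r * (of_real (4 * x * (1 - x)) * w))) \<le> K" if "r > 0" for r
      using bound[OF mult_pos_pos[OF that y]] by (simp only: of_real_mult mult.assoc)
    from norm_terminant_average_le[OF a p disjI1[OF of_real_mult_notin_nonpos_Reals[OF w y]] this] show ?thesis by simp
  qed
  have "norm (LINT x:{0<..<1}|lborel. Beta_kernel (lam + of_nat N) (1 - lam + of_nat N) x *
        terminant_average (\<alpha> - of_nat N) (real N + 1 / 2) (of_real (4 * x * (1 - x)) * w))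
      \<le> Beta (Re lam + real N) (1 - Re lam + real N) * (Gamma (Re \<alpha> - real N) * K)"
    using set_integrable_Beta_kernel_bounded(2)[OF params continuous_on_terminant_average_scaled[OF a p w] average] by simp
  moreover have "norm (sin (of_real pi * lam) / of_real (pi * sqrt pi) * (- 4 * w) ^ N) =
      norm (sin (of_real pi * lam)) / (pi * sqrt pi) * (4 * norm w) ^ N"
    by (simp add: norm_mult norm_divide norm_power)
  ultimately show ?thesis
    unfolding Q_remainder_def norm_mult[of _ "set_lebesgue_integral _ _ _"]
    by (simp only:) (intro mult_left_mono, auto)
qed

lemma holomorphic_on_Q_remainder:
  assumes \<alpha>: "Re \<alpha> > real N" and lam: "- real N < Re lam" "Re lam < 1 + real N"
  shows "Q_remainder \<alpha> lam N holomorphic_on - \<real>\<^sub>\<le>\<^sub>0"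
proof -
  have a: "Re (\<alpha> - of_nat N) > 0" and p: "real N + 1 / 2 > 0" using \<alpha> by auto
  let ?f = "\<lambda>w x. terminant_average (\<alpha> - of_nat N) (real N + 1 / 2) (of_real (4 * x * (1 - x)) * w)"
  have "(\<lambda>w. LINT x:{0<..<1}|lborel. Beta_kernel (lam + of_nat N) (1 - lam + of_nat N) x *
      ?f w x) holomorphic_on - \<real>\<^sub>\<le>\<^sub>0"
  proof (rule holomorphic_on_Beta_kernel_integral[OF open_slit_plane])
    show "continuous_on {0<..<1} (?f w)" if "w \<in> - \<real>\<^sub>\<le>\<^sub>0" for w
      using that by (intro continuous_on_terminant_average_scaled a p) simp
    show "\<exists>K. \<forall>\<^sub>F u in nhds w. \<forall>x\<in>{0<..<1}. norm (?f u x) \<le> K" if "w \<in> - \<real>\<^sub>\<le>\<^sub>0" for w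
    proof -
      have "w \<notin> \<real>\<^sub>\<le>\<^sub>0" using that by simp
      from terminant_average_locally_bounded[OF a p this] obtain K where
        "\<forall>\<^sub>F u in nhds w. \<forall>r>0. norm (terminant_average (\<alpha> - of_nat N) (real N + 1 / 2) (of_real r * u)) \<le> K" by blast
      hence "\<forall>\<^sub>F u in nhds w. \<forall>x\<in>{0<..<1}. norm (?f u x) \<le> K"
        by (rule eventually_mono) (use four_mult_complement_pos in blast)
      thus ?thesis ..
    qed
    fix x :: real assume "x \<in> {0<..<1}"
    hence y: "4 * x * (1 - x) > 0" by (rule four_mult_complement_pos)
    have "(\<lambda>w. of_real r * w) holomorphic_on - \<real>\<^sub>\<le>\<^sub>0" for r by (intro holomorphic_intros)
    moreover have "(\<lambda>w. complex_of_real r * w) ` (- \<real>\<^sub>\<le>\<^sub>0) \<subseteq> - \<real>\<^sub>\<le>\<^sub>0" if "r > 0" for r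
      using of_real_mult_notin_nonpos_Reals[OF _ that] by auto
    ultimately have "terminant_average (\<alpha> - of_nat N) (real N + 1 / 2) \<circ>
        (\<lambda>w. of_real (4 * x * (1 - x)) * w) holomorphic_on - \<real>\<^sub>\<le>\<^sub>0"
      using y by (intro holomorphic_on_compose_gen[OF _ holomorphic_on_terminant_average[OF a p]])
    thus "(\<lambda>w. ?f w x) holomorphic_on - \<real>\<^sub>\<le>\<^sub>0" by (simp only: o_def)
  qed (use lam in auto)
  thus ?thesis unfolding Q_remainder_def[abs_def] by (intro holomorphic_intros) auto
qed

lemma Gamma_nat_plus_half: "Gamma (real n + 1 / 2) = sqrt pi * fact (2 * n) / (4 ^ n * fact n)"
proof -
  have "(1 / 2 :: real) \<notin> \<int>\<^sub>\<le>\<^sub>0" by (auto elim!: nonpos_Ints_cases)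
  hence "Gamma (real n + 1 / 2) = sqrt pi * pochhammer (1 / 2) n"
    using pochhammer_Gamma[of "1 / 2 :: real" n] Gamma_one_half_real by (simp add: add.commute)
  thus ?thesis by (simp add: fact_double power_mult)
qed

lemma cosh_ratio_coeff_Gamma:
  "cosh_ratio_coeff n lam * of_real (Gamma (real n + 1 / 2)) = of_real (sqrt pi) * (2 ^ n * acoef n (lam - 1 / 2))"
proof -
  have "(- 4 :: complex) ^ n = (- 1) ^ n * 4 ^ n" by (simp flip: power_mult_distrib)
  thus ?thesis unfolding cosh_ratio_coeff_def acoef_eq_pochhammer Gamma_nat_plus_half by simp
qed

lemma two_arsinh_sqrt_image: "(\<lambda>s::real. 2 * arsinh (sqrt s)) ` {0<..} = {0<..}"
proof (intro equalityI subsetI)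
  fix x :: real assume "x \<in> {0<..}"
  thus "x \<in> (\<lambda>s. 2 * arsinh (sqrt s)) ` {0<..}"
    by (intro image_eqI[of _ _ "(sinh (x / 2))\<^sup>2"]) (auto simp: arsinh_sinh_real)
qed auto

lemma has_field_derivative_two_arsinh_sqrt:
  fixes s :: real
  assumes "s > 0"
  shows "((\<lambda>s. 2 * arsinh (sqrt s)) has_field_derivative 1 / (sqrt s * sqrt (1 + s))) (at s)"
proof -
  have "((\<lambda>s. arsinh (sqrt s)) has_field_derivative 1 / sqrt ((sqrt s)\<^sup>2 + 1) * (inverse (sqrt s) / 2)) (at s)"
    using assms by (intro DERIV_chain2[OF arsinh_real_has_field_derivative] DERIV_real_sqrt) auto
  from DERIV_cmult[OF this, of 2] show ?thesis using assms by (simp add: field_simps)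
qed

lemma legendre_integral_substitution:
  assumes w: "w > 0" and k: "\<bar>Re \<mu>\<bar> < Re \<kappa>"
  shows "legendre_integral \<kappa> \<mu> (of_real w) = (LINT s:{0<..}|lborel. 2 * (Stieltjes_kernel \<kappa> (1 / 2) w 0 s *
    (cosh (\<mu> * of_real (2 * arsinh (sqrt s))) / of_real (cosh (2 * arsinh (sqrt s) / 2)))))"
proof -
  define F where "F = legendre_integrand \<kappa> \<mu> (of_real w)"
  have w_notin: "complex_of_real w \<notin> \<real>\<^sub>\<le>\<^sub>0" using w by simp
  have cont: "continuous_on A F" for A unfolding F_def by (rule continuous_on_legendre_integrand[OF w_notin])
  have "legendre_integral \<kappa> \<mu> (of_real w) = (LINT \<eta>:{0<..}|lborel. F \<eta> + F (- \<eta>))"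
    unfolding legendre_integral_def F_def
    by (rule integral_fold_real_line[OF integrable_legendre_integrand[OF w_notin k]])
  also have "\<dots> = (LINT s:{0<..}|lborel. 2 * (Stieltjes_kernel \<kappa> (1 / 2) w 0 s *
      (cosh (\<mu> * of_real (2 * arsinh (sqrt s))) / of_real (cosh (2 * arsinh (sqrt s) / 2)))))"
  proof (rule set_integral_substitution(2)[OF _ _ two_arsinh_sqrt_image has_field_derivative_two_arsinh_sqrt])
    show "inj_on (\<lambda>s::real. 2 * arsinh (sqrt s)) {0<..}"
      by (rule inj_onI) (metis mult_cancel_left real_sqrt_eq_iff sinh_arsinh_real zero_neq_numeral)
    fix s :: real assume "s \<in> {0<..}"
    hence s: "s > 0" by simp
    have "s powr (- (1 / 2)) = inverse (sqrt s)" using s by (simp add: powr_minus powr_half_sqrt)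
    hence "s powr (1 / 2 - 1) = 1 / sqrt s" by (simp add: inverse_eq_divide)
    moreover have "\<bar>1 / (sqrt s * sqrt (1 + s))\<bar> = 1 / (sqrt s * sqrt (1 + s))"
      using s by (intro abs_of_nonneg) auto
    moreover have "F (2 * arsinh (sqrt s)) + F (- (2 * arsinh (sqrt s))) =
        of_real (w + s) powr (- \<kappa>) * (2 * cosh (\<mu> * of_real (2 * arsinh (sqrt s))))"
      using s unfolding F_def legendre_integrand_def by (simp add: cosh_field_def distrib_left)
    moreover have "cosh (2 * arsinh (sqrt s) / 2) = sqrt (1 + s)"
      using s by (simp add: cosh_arsinh_real add.commute)
    ultimately show "2 * (Stieltjes_kernel \<kappa> (1 / 2) w 0 s *
          (cosh (\<mu> * of_real (2 * arsinh (sqrt s))) / of_real (cosh (2 * arsinh (sqrt s) / 2)))) =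
        \<bar>1 / (sqrt s * sqrt (1 + s))\<bar> *\<^sub>R (F (2 * arsinh (sqrt s)) + F (- (2 * arsinh (sqrt s))))"
      unfolding Stieltjes_kernel_def by (simp add: scaleR_conv_of_real)
  qed (auto intro!: continuous_intros cont continuous_on_compose2[OF cont[of UNIV]])
  finally show ?thesis .
qed

lemma Stieltjes_kernel_shift:
  assumes "s > 0"
  shows "Stieltjes_kernel \<kappa> p w y s * of_real s ^ n = Stieltjes_kernel \<kappa> (real n + p) w y s"
proof -
  have "s powr (real n + p - 1) = s powr (p - 1) * s ^ n"
    using assms powr_add[of s "p - 1" "real n"] by (simp add: powr_realpow algebra_simps)
  thus ?thesis by (simp add: Stieltjes_kernel_def)
qed

lemma
  assumes w: "w > 0" and p: "p > 0" and \<kappa>: "Re \<kappa> > p" and lam: "- real N < Re lam" "Re lam < 1 + real N"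
  shows set_integrable_Stieltjes_cosh_ratio_remainder:
      "set_integrable lborel {0<..} (\<lambda>s. Stieltjes_kernel \<kappa> p w 0 s * cosh_ratio_remainder N lam s)"
    and Stieltjes_cosh_ratio_remainder_swap:
      "(LINT s:{0<..}|lborel. Stieltjes_kernel \<kappa> p w 0 s * cosh_ratio_remainder N lam s) =
       (LINT x:{0<..<1}|lborel. Beta_kernel (lam + of_nat N) (1 - lam + of_nat N) x *
          (LINT s:{0<..}|lborel. Stieltjes_kernel \<kappa> p w (4 * x * (1 - x)) s))"
proof -
  let ?T = "Stieltjes_kernel \<kappa> p w" and ?B = "Beta_kernel (lam + of_nat N) (1 - lam + of_nat N)"
  define f where "f s x = ?T 0 s * (?B x * of_real (cosh_ratio_weight s x))" for s x
  have params: "Re (lam + of_nat N) > 0" "Re (1 - lam + of_nat N) > 0" using lam by auto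
  have f_right: "(LINT x:{0<..<1}|lborel. f s x) = ?T 0 s * cosh_ratio_remainder N lam s" for s
    unfolding f_def cosh_ratio_remainder_def by (rule set_integral_mult_right)
  have "f s x = ?B x * ?T (4 * x * (1 - x)) s" for s x
    by (simp add: f_def Stieltjes_kernel_def cosh_ratio_weight_def)
  hence f_left: "(LINT s:{0<..}|lborel. f s x) = ?B x * (LINT s:{0<..}|lborel. ?T (4 * x * (1 - x)) s)" for x
    by simp
  have "1 + 4 * x * (1 - x) * s \<noteq> 0" if "0 < s" "0 < x" "x < 1" for s x :: real
    using cosh_ratio_weight_denominator[of x s] that by (metis greaterThanLessThan_iff less_imp_le not_one_le_zero)
  hence cont: "continuous_on ({0<..} \<times> {0<..<1}) (\<lambda>(s, x). f s x)"
    unfolding f_def Stieltjes_kernel_def Beta_kernel_def cosh_ratio_weight_def case_prod_beta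
    by (intro continuous_on_mult continuous_on_of_real_powr continuous_intros) (use w in auto)
  have bound: "norm (f s x) \<le> norm (?T 0 s) * norm (?B x)" if "s \<in> {0<..}" "x \<in> {0<..<1}" for s x
  proof -
    have "\<bar>cosh_ratio_weight s x\<bar> \<le> 1" using cosh_ratio_weight_bounds[of x s] that by auto
    hence "norm (?T 0 s) * (norm (?B x) * \<bar>cosh_ratio_weight s x\<bar>) \<le> norm (?T 0 s) * (norm (?B x) * 1)"
      by (intro mult_left_mono) auto
    thus ?thesis by (simp add: f_def norm_mult)
  qed
  note T_int = set_integrable_Stieltjes_kernel[OF w order_refl p \<kappa>]
  note Fubini = set_integral_Fubini_product_bound[OF _ _ cont set_integrable_norm[OF T_int]
      set_integrable_norm[OF set_integrable_Beta_kernel[OF params]] bound, simplified, unfolded f_right f_left]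
  show "set_integrable lborel {0<..} (\<lambda>s. ?T 0 s * cosh_ratio_remainder N lam s)" by (rule Fubini(2))
  show "(LINT s:{0<..}|lborel. ?T 0 s * cosh_ratio_remainder N lam s) =
      (LINT x:{0<..<1}|lborel. ?B x * (LINT s:{0<..}|lborel. ?T (4 * x * (1 - x)) s))" by (rule Fubini(1))
qed

lemma Stieltjes_cosh_ratio_remainder_integral:
  assumes w: "w > 0" and p: "p > 0" and \<kappa>: "Re \<kappa> > p" and lam: "- real N < Re lam" "Re lam < 1 + real N"
  shows "Gamma \<kappa> * of_real w powr (\<kappa> - of_real p) *
      (LINT s:{0<..}|lborel. Stieltjes_kernel \<kappa> p w 0 s * cosh_ratio_remainder N lam s) =
    (LINT x:{0<..<1}|lborel. Beta_kernel (lam + of_nat N) (1 - lam + of_nat N) x *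
       terminant_average (\<kappa> - of_real p) p (of_real (4 * x * (1 - x)) * of_real w))"
proof -
  let ?G = "Gamma \<kappa> * of_real w powr (\<kappa> - of_real p)" and ?B = "Beta_kernel (lam + of_nat N) (1 - lam + of_nat N)"
  have "?G * (LINT s:{0<..}|lborel. Stieltjes_kernel \<kappa> p w 0 s * cosh_ratio_remainder N lam s) =
      (LINT x:{0<..<1}|lborel. ?G * (?B x * (LINT s:{0<..}|lborel. Stieltjes_kernel \<kappa> p w (4 * x * (1 - x)) s)))"
    unfolding Stieltjes_cosh_ratio_remainder_swap[OF assms] by (rule set_integral_mult_right[symmetric])
  also have "\<dots> = (LINT x:{0<..<1}|lborel. ?B x *
      terminant_average (\<kappa> - of_real p) p (of_real (4 * x * (1 - x)) * of_real w))"
  proof (intro set_lebesgue_integral_cong allI impI)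
    fix x :: real assume "x \<in> {0<..<1}"
    hence "4 * x * (1 - x) \<ge> 0" by simp
    from Stieltjes_kernel_integral[OF w this p \<kappa>]
    show "?G * (?B x * (LINT s:{0<..}|lborel. Stieltjes_kernel \<kappa> p w (4 * x * (1 - x)) s)) =
        ?B x * terminant_average (\<kappa> - of_real p) p (of_real (4 * x * (1 - x)) * of_real w)"
      unfolding mult.left_commute[of _ "?B x"] by (simp only: of_real_mult)
  qed auto
  finally show ?thesis .
qed

lemma Stieltjes_kernel_mult_cosh_ratio:
  assumes s: "s > 0" and lam: "- real N < Re lam" "Re lam < 1 + real N"
  shows "Stieltjes_kernel \<kappa> (1 / 2) w 0 s *
      (cosh ((lam - 1 / 2) * of_real (2 * arsinh (sqrt s))) / of_real (cosh (2 * arsinh (sqrt s) / 2))) =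
    (\<Sum>n<N. cosh_ratio_coeff n lam * Stieltjes_kernel \<kappa> (real n + 1 / 2) w 0 s) +
    sin (of_real pi * lam) / of_real pi * (- 4) ^ N *
      (Stieltjes_kernel \<kappa> (real N + 1 / 2) w 0 s * cosh_ratio_remainder N lam s)"
proof -
  have "(sinh (2 * arsinh (sqrt s) / 2))\<^sup>2 = s" using s by simp
  note expansion = cosh_ratio_expansion[OF lam, of "2 * arsinh (sqrt s)", unfolded this]
  show ?thesis
    unfolding expansion power_mult_distrib Stieltjes_kernel_shift[OF s, symmetric]
    by (simp only: distrib_left sum_distrib_left mult_ac)
qed

lemma legendre_integral_expansion:
  fixes \<kappa> lam :: complex and N :: nat
  assumes w: "w > 0" and \<kappa>: "Re \<kappa> > real N + 1 / 2" and lam: "- real N < Re lam" "Re lam < 1 + real N"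
  shows "legendre_integral \<kappa> (lam - 1 / 2) (of_real w) =
    (\<Sum>n<N. 2 * cosh_ratio_coeff n lam * (LINT s:{0<..}|lborel. Stieltjes_kernel \<kappa> (real n + 1 / 2) w 0 s)) +
    2 * (sin (of_real pi * lam) / of_real pi) * (- 4) ^ N *
      (LINT s:{0<..}|lborel. Stieltjes_kernel \<kappa> (real N + 1 / 2) w 0 s * cosh_ratio_remainder N lam s)"
proof -
  define T where "T n = Stieltjes_kernel \<kappa> (real n + 1 / 2) w 0" for n :: nat
  define q where "q = sin (of_real pi * lam) / complex_of_real pi * (- 4) ^ N"
  let ?J = "cosh_ratio_remainder N lam"
  have "\<bar>Re (lam - 1 / 2)\<bar> < Re \<kappa>" using \<kappa> lam by (simp add: abs_less_iff)
  note substitution = legendre_integral_substitution[OF w this]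
  have T_int: "set_integrable lborel {0<..} (T n)" if "n \<le> N" for n
  proof -
    have "real n \<le> real N" using that by simp
    thus ?thesis unfolding T_def using w \<kappa> by (intro set_integrable_Stieltjes_kernel) auto
  qed
  have sum_int: "set_integrable lborel {0<..} (\<lambda>s. \<Sum>n<N. cosh_ratio_coeff n lam * T n s)"
    using T_int by (intro set_integrable_sum set_integrable_mult_right) auto
  have sum_val: "(LINT s:{0<..}|lborel. \<Sum>n<N. cosh_ratio_coeff n lam * T n s) =
      (\<Sum>n<N. cosh_ratio_coeff n lam * (LINT s:{0<..}|lborel. T n s))"
    using T_int by (subst set_integral_sum) auto
  have rem_int: "set_integrable lborel {0<..} (\<lambda>s. T N s * ?J s)"
    unfolding T_def using w \<kappa> lam by (intro set_integrable_Stieltjes_cosh_ratio_remainder) auto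
  have "legendre_integral \<kappa> (lam - 1 / 2) (of_real w) =
      (LINT s:{0<..}|lborel. 2 * ((\<Sum>n<N. cosh_ratio_coeff n lam * T n s) + q * (T N s * ?J s)))"
    unfolding substitution T_def q_def
    by (intro set_lebesgue_integral_cong allI impI arg_cong2[where f = "(*)"] refl Stieltjes_kernel_mult_cosh_ratio lam) auto
  also have "\<dots> = 2 * ((\<Sum>n<N. cosh_ratio_coeff n lam * (LINT s:{0<..}|lborel. T n s)) +
      q * (LINT s:{0<..}|lborel. T N s * ?J s))"
    unfolding set_integral_mult_right
    by (subst set_integral_add(2)[OF sum_int set_integrable_mult_right[OF rem_int]]) (simp only: sum_val set_integral_mult_right)
  finally show ?thesis unfolding T_def q_def by (simp only: distrib_left sum_distrib_left mult.assoc)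
qed

lemma of_real_powr_eq_power_mult:
  "w > 0 \<Longrightarrow> of_real w powr \<alpha> = of_real w ^ n * complex_of_real w powr (\<alpha> - of_nat n)"
  using powr_add[of "of_real w" "of_nat n" "\<alpha> - of_nat n"] by (simp add: powr_nat')

lemma Gamma_powr_mult_Stieltjes_kernel_integral:
  assumes w: "w > 0" and \<alpha>: "Re \<alpha> > real n"
  shows "Gamma (\<alpha> + 1 / 2) * of_real w powr \<alpha> *
      (cosh_ratio_coeff n lam * (LINT s:{0<..}|lborel. Stieltjes_kernel (\<alpha> + 1 / 2) (real n + 1 / 2) w 0 s)) =
    of_real (sqrt pi) * (acoef n (lam - 1 / 2) * Gamma (\<alpha> - of_nat n) * (2 * of_real w) ^ n)"
    (is "?G * (?c * ?T) = _")
proof -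
  have shift: "\<alpha> + 1 / 2 - complex_of_real (real n + 1 / 2) = \<alpha> - of_nat n" by simp
  have "Re (\<alpha> + 1 / 2) > real n + 1 / 2" using \<alpha> by simp
  hence "?G * ?T = of_real w ^ n * terminant_average (\<alpha> - of_nat n) (real n + 1 / 2) 0"
    using Stieltjes_kernel_integral[OF w order_refl, of "real n + 1 / 2" "\<alpha> + 1 / 2"]
    by (simp add: shift mult_ac of_real_powr_eq_power_mult[OF w, of \<alpha> n])
  also have "\<dots> = of_real w ^ n * (Gamma (\<alpha> - of_nat n) * of_real (Gamma (real n + 1 / 2)))"
    using \<alpha> by (simp add: terminant_average_0)
  finally have "?G * (?c * ?T) = ?c * of_real (Gamma (real n + 1 / 2)) * (of_real w ^ n * Gamma (\<alpha> - of_nat n))"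
    by (simp only: mult_ac)
  thus ?thesis unfolding cosh_ratio_coeff_Gamma power_mult_distrib by (simp only: mult_ac)
qed

lemma Gamma_powr_mult_Stieltjes_remainder_integral:
  assumes w: "w > 0" and \<alpha>: "Re \<alpha> > real N" and lam: "- real N < Re lam" "Re lam < 1 + real N"
  shows "Gamma (\<alpha> + 1 / 2) * of_real w powr \<alpha> * (sin (of_real pi * lam) / of_real pi * (- 4) ^ N *
      (LINT s:{0<..}|lborel. Stieltjes_kernel (\<alpha> + 1 / 2) (real N + 1 / 2) w 0 s * cosh_ratio_remainder N lam s)) =
    of_real (sqrt pi) * Q_remainder \<alpha> lam N (of_real w)" (is "?G * (?c * _ * ?R) = _")
proof -
  define J where "J = (LINT x:{0<..<1}|lborel. Beta_kernel (lam + of_nat N) (1 - lam + of_nat N) x *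
    terminant_average (\<alpha> - of_nat N) (real N + 1 / 2) (of_real (4 * x * (1 - x)) * of_real w))"
  have shift: "\<alpha> + 1 / 2 - complex_of_real (real N + 1 / 2) = \<alpha> - of_nat N" by simp
  have "Re (\<alpha> + 1 / 2) > real N + 1 / 2" using \<alpha> by simp
  from Stieltjes_cosh_ratio_remainder_integral[OF w _ this lam]
  have "Gamma (\<alpha> + 1 / 2) * of_real w powr (\<alpha> - of_nat N) * ?R = J"
    unfolding shift J_def by simp
  hence "?G * (?c * (- 4) ^ N * ?R) = ?c * (- 4) ^ N * of_real w ^ N * J"
    by (simp add: of_real_powr_eq_power_mult[OF w, of \<alpha> N] mult_ac)
  thus ?thesis
    unfolding Q_remainder_def J_def[symmetric] power_mult_distrib[of "- 4"] by simp
qed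

lemma scaled_Q_expansion_pos:
  assumes w: "w > 0" and \<alpha>: "Re \<alpha> > real N" and lam: "- real N < Re lam" "Re lam < 1 + real N"
  shows "scaled_Q \<alpha> lam (of_real w) =
    (\<Sum>n<N. acoef n (lam - 1 / 2) * Gamma (\<alpha> - of_nat n) * (2 * of_real w) ^ n) + Q_remainder \<alpha> lam N (of_real w)"
proof -
  define C where "C = Gamma (\<alpha> + 1 / 2) * complex_of_real w powr \<alpha>"
  define T where "T n = (LINT s:{0<..}|lborel. Stieltjes_kernel (\<alpha> + 1 / 2) (real n + 1 / 2) w 0 s)" for n :: nat
  define R where "R = (LINT s:{0<..}|lborel. Stieltjes_kernel (\<alpha> + 1 / 2) (real N + 1 / 2) w 0 s *
    cosh_ratio_remainder N lam s)"
  have "Re (\<alpha> + 1 / 2) > real N + 1 / 2" using \<alpha> by simp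
  note expansion = legendre_integral_expansion[OF w this lam]
  have "C * (cosh_ratio_coeff n lam * T n) =
      of_real (sqrt pi) * (acoef n (lam - 1 / 2) * Gamma (\<alpha> - of_nat n) * (2 * of_real w) ^ n)" if "n < N" for n
    unfolding C_def T_def using \<alpha> that
    by (intro Gamma_powr_mult_Stieltjes_kernel_integral w) (metis less_trans of_nat_less_iff)
  hence main: "(\<Sum>n<N. C * (cosh_ratio_coeff n lam * T n)) =
      of_real (sqrt pi) * (\<Sum>n<N. acoef n (lam - 1 / 2) * Gamma (\<alpha> - of_nat n) * (2 * of_real w) ^ n)"
    unfolding sum_distrib_left by (intro sum.cong) auto
  have remainder: "C * (sin (of_real pi * lam) / of_real pi * (- 4) ^ N * R) =
      of_real (sqrt pi) * Q_remainder \<alpha> lam N (of_real w)"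
    unfolding C_def R_def by (rule Gamma_powr_mult_Stieltjes_remainder_integral[OF w \<alpha> lam])
  have "C * legendre_integral (\<alpha> + 1 / 2) (lam - 1 / 2) (of_real w) =
      2 * ((\<Sum>n<N. C * (cosh_ratio_coeff n lam * T n)) + C * (sin (of_real pi * lam) / of_real pi * (- 4) ^ N * R))"
    unfolding expansion T_def R_def by (simp only: distrib_left sum_distrib_left mult_ac)
  thus ?thesis
    unfolding main remainder scaled_Q_def by (simp add: C_def field_simps)
qed

theorem scaled_Q_expansion:
  assumes w: "w \<notin> \<real>\<^sub>\<le>\<^sub>0" and \<alpha>: "Re \<alpha> > real N" and lam: "- real N < Re lam" "Re lam < 1 + real N"
  shows "scaled_Q \<alpha> lam w =
    (\<Sum>n<N. acoef n (lam - 1 / 2) * Gamma (\<alpha> - of_nat n) * (2 * w) ^ n) + Q_remainder \<alpha> lam N w"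
proof (rule holomorphic_eq_on_segment[where S = "- \<real>\<^sub>\<le>\<^sub>0" and l = 0 and r = 1 and v = 1 and f = "scaled_Q \<alpha> lam"
      and g = "\<lambda>w. (\<Sum>n<N. acoef n (lam - 1 / 2) * Gamma (\<alpha> - of_nat n) * (2 * w) ^ n) + Q_remainder \<alpha> lam N w"])
  show "scaled_Q \<alpha> lam holomorphic_on - \<real>\<^sub>\<le>\<^sub>0"
    using holomorphic_on_scaled_Q[OF open_slit_plane, of "\<lambda>_. \<alpha>" "\<lambda>_. lam" "\<lambda>w. w"] \<alpha> lam
    by (auto simp: abs_less_iff)
  show "(\<lambda>w. (\<Sum>n<N. acoef n (lam - 1 / 2) * Gamma (\<alpha> - of_nat n) * (2 * w) ^ n) +
      Q_remainder \<alpha> lam N w) holomorphic_on - \<real>\<^sub>\<le>\<^sub>0"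
    by (intro holomorphic_intros holomorphic_on_Q_remainder \<alpha> lam)
  fix t :: real assume t: "0 < t" "t < 1"
  show "of_real t * 1 \<in> - \<real>\<^sub>\<le>\<^sub>0 \<and> scaled_Q \<alpha> lam (of_real t * 1) =
      (\<Sum>n<N. acoef n (lam - 1 / 2) * Gamma (\<alpha> - of_nat n) * (2 * (of_real t * 1)) ^ n) +
        Q_remainder \<alpha> lam N (of_real t * 1)"
    using scaled_Q_expansion_pos[OF t(1) \<alpha> lam] t by simp
qed (use w open_slit_plane connected_slit_plane in auto)

section \<open>Bounds for the remainder\<close>

lemma norm_terminant_le_Re:
  assumes p: "p > 0" and c: "Re c \<ge> 0"
  shows "norm (terminant p c) \<le> Gamma p"
proof -
  have "1 \<le> norm (1 + c * complex_of_real v)" if "v > 0" for v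
  proof -
    have "1 \<le> Re (1 + c * complex_of_real v)" using c that by simp
    also have "\<dots> \<le> norm (1 + c * complex_of_real v)" by (rule complex_Re_le_cmod)
    finally show ?thesis .
  qed
  from norm_terminant_le[OF p zero_less_one this] show ?thesis by simp
qed

lemma norm_terminant_le_Im:
  assumes p: "p > 0" and c: "Im c \<noteq> 0"
  shows "norm (terminant p c) \<le> norm c / \<bar>Im c\<bar> * Gamma p"
proof -
  have norm_pos: "norm c > 0" using c by auto
  have "\<bar>Im c\<bar> / norm c \<le> norm (1 + c * complex_of_real v)" for v
  proof -
    have "Im ((1 + c * of_real v) * cnj c) = - Im c" by (simp add: algebra_simps)
    hence "\<bar>Im c\<bar> \<le> norm ((1 + c * of_real v) * cnj c)"
      using abs_Im_le_cmod[of "(1 + c * of_real v) * cnj c"] by simp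
    also have "\<dots> = norm (1 + c * of_real v) * norm c" by (simp only: norm_mult complex_mod_cnj)
    finally show ?thesis using norm_pos by (simp only: pos_divide_le_eq)
  qed
  moreover have "\<bar>Im c\<bar> / norm c > 0" using c norm_pos by simp
  ultimately show ?thesis using norm_terminant_le[OF p, of "\<bar>Im c\<bar> / norm c" c] by (simp add: field_simps)
qed

lemma sqrt_odds_image: "(\<lambda>x. sqrt (x / (1 - x))) ` {0<..<1} = {0<..}"
proof (intro equalityI subsetI)
  fix r :: real assume "r \<in> {0<..}"
  hence r: "r > 0" by simp
  have denominator: "1 + r\<^sup>2 > 0" by (simp add: add_pos_nonneg)
  hence "1 - r\<^sup>2 / (1 + r\<^sup>2) = 1 / (1 + r\<^sup>2)" by (simp add: field_simps)
  hence "r = sqrt (r\<^sup>2 / (1 + r\<^sup>2) / (1 - r\<^sup>2 / (1 + r\<^sup>2)))" using denominator r by simp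
  moreover have "r\<^sup>2 / (1 + r\<^sup>2) \<in> {0<..<1}" using r denominator by simp
  ultimately show "r \<in> (\<lambda>x. sqrt (x / (1 - x))) ` {0<..<1}" by (rule image_eqI)
qed auto

lemma inj_on_sqrt_odds: "inj_on (\<lambda>x::real. sqrt (x / (1 - x))) {0<..<1}"
proof (rule inj_onI)
  fix x y :: real assume x: "x \<in> {0<..<1}" and y: "y \<in> {0<..<1}" and "sqrt (x / (1 - x)) = sqrt (y / (1 - y))"
  hence "x * (1 - y) = y * (1 - x)" by (simp add: frac_eq_eq)
  thus "x = y" by (simp add: algebra_simps)
qed

lemma has_field_derivative_sqrt_odds:
  assumes x: "x \<in> {0<..<1}"
  shows "((\<lambda>x. sqrt (x / (1 - x))) has_field_derivative x powr (1 / 2 - 1) * (1 - x) powr (- 3 / 2) / 2) (at x)"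
proof -
  have "((\<lambda>x. x / (1 - x)) has_field_derivative 1 / (1 - x)\<^sup>2) (at x)"
    using x by (auto intro!: derivative_eq_intros simp: power2_eq_square)
  hence "((\<lambda>x. sqrt (x / (1 - x))) has_field_derivative inverse (sqrt (x / (1 - x))) / 2 * (1 / (1 - x)\<^sup>2)) (at x)"
    using x by (intro DERIV_chain2[OF DERIV_real_sqrt]) auto
  moreover have "inverse (sqrt (x / (1 - x))) = x powr (- (1 / 2)) * (1 - x) powr (1 / 2)"
    using x by (simp add: powr_minus_divide powr_half_sqrt real_sqrt_divide)
  moreover have "1 / (1 - x)\<^sup>2 = (1 - x) powr (- 2)"
    using x by (simp add: powr_minus_divide)
  moreover have "(1 - x) powr (1 / 2) * (1 - x) powr (- 2) = (1 - x) powr (- 3 / 2)"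
    unfolding powr_add[symmetric] by simp
  ultimately show ?thesis by (simp add: mult_ac)
qed

lemma
  assumes p: "p > (0::real)"
  shows set_integrable_one_plus_square_powr: "set_integrable lborel {0<..} (\<lambda>r::real. (1 + r\<^sup>2) powr (- (p + 1) / 2))"
    and one_plus_square_powr_integral: "(LINT r:{0<..}|lborel. (1 + r\<^sup>2) powr (- (p + 1) / 2)) =
        Beta (1 / 2) (p / 2) / 2"
proof -
  define g :: "real \<Rightarrow> real" where "g x = sqrt (x / (1 - x))" for x
  have "1 / 2 * (x powr (1 / 2 - 1) * (1 - x) powr (p / 2 - 1)) =
      \<bar>x powr (1 / 2 - 1) * (1 - x) powr (- 3 / 2) / 2\<bar> *\<^sub>R (1 + (g x)\<^sup>2) powr (- (p + 1) / 2)"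
        if "x \<in> {0<..<1}" for x
  proof -
    have square: "1 + (g x)\<^sup>2 = inverse (1 - x)" using that by (simp add: g_def field_simps)
    have "(1 + (g x)\<^sup>2) powr (- (p + 1) / 2) = (1 - x) powr ((p + 1) / 2)"
      unfolding square using that by (simp add: powr_def ln_inverse ln_div field_simps)
    moreover have "(1 - x) powr (- 3 / 2) * (1 - x) powr ((p + 1) / 2) = (1 - x) powr (p / 2 - 1)"
      unfolding powr_add[symmetric] by (rule arg_cong[where f = "(powr) (1 - x)"]) (simp add: field_simps)
    ultimately show ?thesis by simp
  qed
  note integrand = this
  have "1 + r\<^sup>2 \<noteq> 0" for r :: real by (metis add_pos_nonneg less_irrefl zero_le_power2 zero_less_one)
  hence cont: "continuous_on {0<..} (\<lambda>r::real. (1 + r\<^sup>2) powr (- (p + 1) / 2))" by (intro continuous_intros) auto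
  have deriv_cont: "continuous_on {0<..<1} (\<lambda>x::real. x powr (1 / 2 - 1) * (1 - x) powr (- 3 / 2) / 2)"
    by (intro continuous_intros) auto
  note substitution = set_integral_substitution[OF _ _ sqrt_odds_image has_field_derivative_sqrt_odds inj_on_sqrt_odds cont deriv_cont
      integrand[unfolded g_def], simplified]
  have Beta: "set_integrable lborel {0<..<1} (\<lambda>x. x powr (1 / 2 - 1) * (1 - x) powr (p / 2 - 1))"
    using p by (intro set_integrable_Beta) auto
  show "set_integrable lborel {0<..} (\<lambda>r::real. (1 + r\<^sup>2) powr (- (p + 1) / 2))"
    using substitution(1) set_integrable_mult_right[OF Beta, of "1 / 2"] by simp
  show "(LINT r:{0<..}|lborel. (1 + r\<^sup>2) powr (- (p + 1) / 2)) = Beta (1 / 2) (p / 2) / 2"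
    using substitution(2) Beta_set_integral_real[of "1 / 2" "p / 2"] p by simp
qed

lemma Gamma_mult_Beta_eq_chi:
  assumes "p > 0"
  shows "Gamma (p + 1) * (Beta (1 / 2) (p / 2) / 2) = chi p * Gamma p"
proof -
  have plus1: "Gamma (p + 1) = p * Gamma p" "Gamma (p / 2 + 1) = p / 2 * Gamma (p / 2)"
    using assms by (intro Gamma_plus1; auto dest: nonpos_Ints_nonpos)+
  show ?thesis
    unfolding chi_def Beta_def Gamma_one_half_real add.commute[of "1 / 2" "p / 2"] plus1 by (simp add: mult_ac)
qed

lemma exp_set_integral:
  assumes "Re y > 0"
  shows "(LINT r:{0<..}|lborel. exp (- (y * complex_of_real r))) = 1 / y"
proof -
  have "(LINT r:{0<..}|lborel. exp (- (y * complex_of_real r))) =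
      (LINT r:{0<..}|lborel. complex_of_real r powr (1 - 1) * exp (- (y * of_real r)))"
    by (intro set_lebesgue_integral_cong) auto
  also have "\<dots> = 1 / y"
    using assms by (subst Gamma_set_integral) (auto simp: powr_minus inverse_eq_divide)
  finally show ?thesis .
qed

lemma norm_one_minus_i_powr:
  "norm ((1 - \<i> * of_real r) powr (- complex_of_real a)) = (1 + r\<^sup>2) powr (- a / 2)"
proof -
  have "1 - \<i> * complex_of_real r \<noteq> 0" by (simp add: complex_eq_iff)
  hence "norm ((1 - \<i> * of_real r) powr (- complex_of_real a)) = norm (1 - \<i> * complex_of_real r) powr (- a)"
    using norm_powr_real_powr'[of "- complex_of_real a"] by (simp add: powr_def)
  also have "norm (1 - \<i> * complex_of_real r) = (1 + r\<^sup>2) powr (1 / 2)"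
    by (simp add: cmod_def powr_half_sqrt add_nonneg_nonneg)
  finally show ?thesis by (simp add: powr_powr)
qed

lemma Gamma_kernel_phase_integral:
  assumes p: "p > -1"
  shows "(LINT v:{0<..}|lborel. Gamma_kernel (of_real (p + 1)) v * exp (\<i> * (z + of_real v) * of_real r)) =
    exp (\<i> * z * of_real r) * (of_real (Gamma (p + 1)) * (1 - \<i> * of_real r) powr (- of_real (p + 1)))"
proof -
  have "exp (- of_real v) * exp (\<i> * (z + of_real v) * of_real r) =
      exp (\<i> * z * of_real r) * exp (- ((1 - \<i> * of_real r) * complex_of_real v))" for v
    unfolding exp_add[symmetric] by (rule arg_cong[where f = exp]) (simp add: algebra_simps)
  hence "Gamma_kernel (of_real (p + 1)) v * exp (\<i> * (z + of_real v) * of_real r) = exp (\<i> * z * of_real r) *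
      (of_real v powr (of_real (p + 1) - 1) * exp (- ((1 - \<i> * of_real r) * of_real v)))" for v
    unfolding Gamma_kernel_def mult.assoc by (simp only: mult.left_commute)
  hence "(LINT v:{0<..}|lborel. Gamma_kernel (of_real (p + 1)) v * exp (\<i> * (z + of_real v) * of_real r)) =
      exp (\<i> * z * of_real r) * (LINT v:{0<..}|lborel. of_real v powr (of_real (p + 1) - 1) *
        exp (- ((1 - \<i> * of_real r) * of_real v)))"
    by (simp only: set_integral_mult_right)
  also have "(LINT v:{0<..}|lborel. of_real v powr (of_real (p + 1) - 1) *
      exp (- ((1 - \<i> * of_real r) * of_real v))) =
      of_real (Gamma (p + 1)) * (1 - \<i> * of_real r) powr (- of_real (p + 1))"
    unfolding Gamma_complex_of_real[symmetric] by (rule Gamma_set_integral) (use p in auto)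
  finally show ?thesis .
qed

text \<open>Insert \<open>1 / (z + v) = - \<i> \<integral> e\<^bsup>i(z + v)r\<^esup> dr\<close> and integrate over \<open>v\<close> first.\<close>

lemma Gamma_kernel_resolvent_integral:
  assumes p: "p > 0" and z: "Im z > 0"
  shows "\<i> * (LINT v:{0<..}|lborel. Gamma_kernel (of_real (p + 1)) v * (1 / (z + of_real v))) =
    (LINT r:{0<..}|lborel. exp (\<i> * z * of_real r) *
      (of_real (Gamma (p + 1)) * (1 - \<i> * of_real r) powr (- of_real (p + 1))))"
proof -
  define f where "f v r = Gamma_kernel (of_real (p + 1)) v * exp (\<i> * (z + of_real v) * of_real r)" for v r
  have right: "(LINT r:{0<..}|lborel. f v r) = \<i> * (Gamma_kernel (of_real (p + 1)) v * (1 / (z + of_real v)))"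
    for v
  proof -
    have "(LINT r:{0<..}|lborel. exp (\<i> * (z + of_real v) * of_real r)) = 1 / (- (\<i> * (z + of_real v)))"
      using exp_set_integral[of "- (\<i> * (z + of_real v))"] z by simp
    also have "\<dots> = \<i> * (1 / (z + of_real v))" by (simp add: divide_inverse)
    finally show ?thesis unfolding f_def by (simp only: set_integral_mult_right mult.left_commute)
  qed
  have left: "(LINT v:{0<..}|lborel. f v r) =
      exp (\<i> * z * of_real r) * (of_real (Gamma (p + 1)) * (1 - \<i> * of_real r) powr (- of_real (p + 1)))" for r
    unfolding f_def by (rule Gamma_kernel_phase_integral) (use p in simp)
  have "set_integrable lborel {0<..} (\<lambda>v. norm (Gamma_kernel (of_real (p + 1)) v))"
    using set_integrable_norm[OF set_integrable_Gamma_kernel_bounded(1)[of "of_real (p + 1)" "\<lambda>_. 1" 1]] p by simp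
  moreover have "continuous_on ({0<..} \<times> {0<..}) (\<lambda>(v, r). f v r)"
    unfolding f_def case_prod_beta
    by (intro continuous_intros continuous_on_compose2[OF continuous_on_Gamma_kernel]) auto
  moreover have "norm (f v r) \<le> norm (Gamma_kernel (of_real (p + 1)) v) * exp (- (Im z * r))" for v r
    by (simp add: f_def norm_mult)
  ultimately have "(LINT v:{0<..}|lborel. LINT r:{0<..}|lborel. f v r) =
      (LINT r:{0<..}|lborel. LINT v:{0<..}|lborel. f v r)"
    by (intro set_integral_Fubini_product_bound(1)[OF _ _ _ _ set_integrable_exp[OF z]]) auto
  thus ?thesis unfolding right left by (simp only: set_integral_mult_right)
qed

lemma norm_Gamma_kernel_resolvent_integral_le:
  assumes p: "p > 0" and z: "Im z > 0"
  shows "norm (LINT v:{0<..}|lborel. Gamma_kernel (of_real (p + 1)) v * (1 / (z + of_real v))) \<le> chi p * Gamma p"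
proof -
  let ?H = "\<lambda>r. exp (\<i> * z * of_real r) * (of_real (Gamma (p + 1)) * (1 - \<i> * of_real r) powr (- of_real (p + 1)))"
  have "norm (LINT v:{0<..}|lborel. Gamma_kernel (of_real (p + 1)) v * (1 / (z + of_real v))) =
      norm (LINT r:{0<..}|lborel. ?H r)"
    using arg_cong[OF Gamma_kernel_resolvent_integral[OF p z], of norm] unfolding norm_mult by simp
  also have "\<dots> \<le> (LINT r:{0<..}|lborel. Gamma (p + 1) * (1 + r\<^sup>2) powr (- (p + 1) / 2))"
  proof (rule norm_set_integral_le)
    show "set_integrable lborel {0<..} (\<lambda>r. Gamma (p + 1) * (1 + r\<^sup>2) powr (- (p + 1) / 2))"
      by (intro set_integrable_mult_right set_integrable_one_plus_square_powr p)
    show "continuous_on {0<..} ?H"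
      by (intro continuous_intros continuous_on_powr_slit Re_pos_notin_nonpos_Reals) auto
    fix r :: real assume "r \<in> {0<..}"
    hence "norm (exp (\<i> * z * of_real r)) \<le> 1" using z by simp
    thus "norm (?H r) \<le> Gamma (p + 1) * (1 + r\<^sup>2) powr (- (p + 1) / 2)"
      unfolding norm_mult norm_one_minus_i_powr norm_of_real
      using Gamma_real_pos[of "p + 1"] p by (simp add: mult_left_le_one_le)
  qed auto
  also have "\<dots> = chi p * Gamma p"
    unfolding set_integral_mult_right one_plus_square_powr_integral[OF p] by (rule Gamma_mult_Beta_eq_chi[OF p])
  finally show ?thesis .
qed

lemma terminant_eq_Gamma_minus_resolvent_integral:
  assumes p: "p > 0" and c: "Im c \<noteq> 0"
  shows "terminant p c = of_real (Gamma p) -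
      (LINT v:{0<..}|lborel. Gamma_kernel (of_real (p + 1)) v * (1 / (1 / c + of_real v)))"
proof -
  have c_nonzero: "c \<noteq> 0" and Im_z: "Im (1 / c) \<noteq> 0" using c by (auto simp: Im_divide)
  have denominator: "\<bar>Im (1 / c)\<bar> \<le> norm (1 / c + of_real v)" for v
    using abs_Im_le_cmod[of "1 / c + of_real v"] by simp
  have "set_integrable lborel {0<..} (\<lambda>v. Gamma_kernel (of_real p) v * 1)"
    using p by (intro set_integrable_Gamma_kernel_bounded(1)[where K = 1]) auto
  moreover have "set_integrable lborel {0<..} (\<lambda>v. Gamma_kernel (of_real (p + 1)) v * (1 / (1 / c + of_real v)))"
  proof (rule set_integrable_Gamma_kernel_bounded(1))
    have "1 / c + of_real v \<noteq> 0" for v using denominator[of v] Im_z by auto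
    thus "continuous_on {0<..} (\<lambda>v. 1 / (1 / c + complex_of_real v))" by (intro continuous_intros) auto
    show "norm (1 / (1 / c + of_real v)) \<le> 1 / \<bar>Im (1 / c)\<bar>" for v
      unfolding norm_divide norm_one using denominator Im_z by (intro frac_le) auto
  qed (use p in auto)
  moreover have "Gamma_kernel (of_real p) v * (1 / (1 + c * of_real v)) =
      Gamma_kernel (of_real p) v * 1 - Gamma_kernel (of_real (p + 1)) v * (1 / (1 / c + of_real v))"
        if v: "v > 0" for v
  proof -
    have "1 + c * of_real v \<noteq> 0" using c v by (auto simp: complex_eq_iff)
    hence "1 / (1 + c * of_real v) = 1 - of_real v * (1 / (1 / c + of_real v))"
      using c_nonzero by (simp add: divide_simps mult.commute)
    moreover have "Gamma_kernel (of_real (p + 1)) v = Gamma_kernel (of_real p) v * of_real v"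
      using v powr_add[of "complex_of_real v" "of_real p - 1" 1] by (simp add: Gamma_kernel_def)
    ultimately show ?thesis by (simp add: right_diff_distrib)
  qed
  hence "terminant p c = (LINT v:{0<..}|lborel.
      Gamma_kernel (of_real p) v * 1 - Gamma_kernel (of_real (p + 1)) v * (1 / (1 / c + of_real v)))"
    unfolding terminant_def by (intro set_lebesgue_integral_cong) auto
  ultimately show ?thesis
    using Gamma_kernel_integral[of "of_real p"] p by (simp add: set_integral_diff(2) Gamma_complex_of_real)
qed

lemma cnj_terminant: "cnj (terminant p c) = terminant p (cnj c)"
proof -
  have "cnj (indicat_real {0<..} v *\<^sub>R (Gamma_kernel (of_real p) v * (1 / (1 + c * of_real v)))) =
      indicat_real {0<..} v *\<^sub>R (Gamma_kernel (of_real p) v * (1 / (1 + cnj c * of_real v)))" for v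
    by (auto simp: indicator_def Gamma_kernel_pos_real)
  thus ?thesis
    unfolding terminant_def set_lebesgue_integral_def by (simp only: Bochner_Integration.integral_cnj[symmetric])
qed

lemma norm_terminant_le_chi:
  assumes p: "p > 0" and c: "Im c \<noteq> 0"
  shows "norm (terminant p c) \<le> (1 + chi p) * Gamma p"
proof -
  have lower: "norm (terminant p c) \<le> (1 + chi p) * Gamma p" if "Im c < 0" for c
  proof -
    have "c \<noteq> 0" "Im (1 / c) > 0" using that
      by (auto simp: Im_divide sum_power2_gt_zero_iff intro!: divide_neg_pos)
    hence "norm (terminant p c) \<le> norm (complex_of_real (Gamma p)) + chi p * Gamma p"
      using terminant_eq_Gamma_minus_resolvent_integral[OF p, of c] that
        norm_Gamma_kernel_resolvent_integral_le[OF p \<open>Im (1 / c) > 0\<close>]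
      by (smt (verit) norm_triangle_ineq4)
    thus ?thesis using Gamma_real_pos[OF p] by (simp add: algebra_simps)
  qed
  show ?thesis
  proof (cases "Im c < 0")
    case False
    hence "Im (cnj c) < 0" using c by simp
    from lower[OF this] show ?thesis by (simp flip: cnj_terminant)
  qed (rule lower)
qed

definition acoef_quotient :: "nat \<Rightarrow> real \<Rightarrow> real" where
  "acoef_quotient k l = Gamma (l + real k) * Gamma (1 - l + real k) / (pi * 2 ^ k * fact k)"

lemma acoef_quotient_pos: "- real k < l \<Longrightarrow> l < 1 + real k \<Longrightarrow> acoef_quotient k l > 0"
  unfolding acoef_quotient_def by (intro divide_pos_pos mult_pos_pos Gamma_real_pos) auto

lemma acoef_of_int_eq_0:
  assumes "- int k < i" "i < 1 + int k"
  shows "acoef k (of_int i - 1 / 2) = (0 :: 'a :: field_char_0)"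
proof -
  have "pochhammer (of_int i :: 'a) k = 0 \<or> pochhammer (1 - of_int i :: 'a) k = 0"
  proof (cases "i \<le> 0")
    case True
    hence "(of_int i :: 'a) = - of_nat (nat (- i))" "nat (- i) < k" using assms by auto
    thus ?thesis unfolding pochhammer_eq_0_iff by blast
  next
    case False
    hence "(1 - of_int i :: 'a) = - of_nat (nat (i - 1))" "nat (i - 1) < k" using assms by auto
    thus ?thesis unfolding pochhammer_eq_0_iff by blast
  qed
  thus ?thesis unfolding acoef_eq_pochhammer by auto
qed

lemma acoef_eq_sin_mult_quotient:
  assumes l: "- real k < l" "l < 1 + real k"
  shows "acoef k (l - 1 / 2) = (- 1) ^ k * sin (pi * l) * acoef_quotient k l"
proof (cases "l \<in> \<int>")
  case True
  then obtain i where i: "l = of_int i" by (auto elim: Ints_cases)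
  hence "real_of_int (- int k) < real_of_int i" "real_of_int i < real_of_int (1 + int k)" using l by simp_all
  hence "- int k < i" "i < 1 + int k" by (simp_all only: of_int_less_iff)
  hence "acoef k (l - 1 / 2) = 0" unfolding i by (rule acoef_of_int_eq_0)
  moreover have "sin (pi * l) = 0" using True by (simp add: sin_times_pi_eq_0 mult.commute[of pi])
  ultimately show ?thesis by simp
next
  case False
  hence "complex_of_real l \<notin> \<int>" by simp
  note Beta = sin_Beta_eq_pochhammer[OF this, of k]
  have "complex_of_real l + of_nat k + (1 - of_real l + of_nat k) = 1 + of_nat (2 * k)" by simp
  hence "Gamma (complex_of_real l + of_nat k + (1 - of_real l + of_nat k)) = fact (2 * k)"
    by (simp only: Gamma_fact)
  hence "complex_of_real (sin (pi * l) / pi * (Gamma (l + real k) * Gamma (1 - l + real k))) / fact (2 * k) =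
      of_real (pochhammer l k * pochhammer (1 - l) k) / fact (2 * k)"
    using Beta unfolding Beta_def
    by (simp add: Gamma_complex_of_real[symmetric] sin_of_real[symmetric] pochhammer_of_real[symmetric])
  hence "sin (pi * l) / pi * (Gamma (l + real k) * Gamma (1 - l + real k)) = pochhammer l k * pochhammer (1 - l) k"
    by (simp only: divide_cancel_right fact_nonzero simp_thms of_real_eq_iff)
  thus ?thesis unfolding acoef_eq_pochhammer acoef_quotient_def by (simp add: field_simps)
qed

lemma eventually_at_notin_Ints: "\<forall>\<^sub>F t in at (l::real). t \<notin> \<int>"
proof -
  have "l \<in> {of_int (\<lceil>l\<rceil> - 1)<..<of_int (\<lfloor>l\<rfloor> + 1)}" by simp linarith
  hence "\<forall>\<^sub>F t in at l. t \<in> {of_int (\<lceil>l\<rceil> - 1)<..<of_int (\<lfloor>l\<rfloor> + 1)} - {l}"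
    by (intro eventually_at_in_open) auto
  thus ?thesis
  proof eventually_elim
    case (elim t)
    show ?case
    proof
      assume "t \<in> \<int>"
      then obtain i where i: "t = of_int i" by (auto elim: Ints_cases)
      hence "\<lceil>l\<rceil> \<le> i" "i \<le> \<lfloor>l\<rfloor>" using elim by auto
      hence "t = l" unfolding i by linarith
      thus False using elim by simp
    qed
  qed
qed

lemma acoef_over_sin_eq_quotient:
  assumes l: "- real k < l" "l < 1 + real k"
  shows "acoef_over_sin k l = acoef_quotient k l"
proof -
  have quotient: "\<bar>acoef k (t - 1 / 2)\<bar> / \<bar>sin (pi * t)\<bar> = acoef_quotient k t"
    if t: "- real k < t" "t < 1 + real k" and "t \<notin> \<int>" for t
  proof -
    have "sin (pi * t) \<noteq> 0" using \<open>t \<notin> \<int>\<close> sin_times_pi_eq_0[of t] by (simp add: mult.commute)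
    thus ?thesis unfolding acoef_eq_sin_mult_quotient[OF t]
      using acoef_quotient_pos[OF t] by (simp add: abs_mult power_abs)
  qed
  show ?thesis
  proof (cases "l \<in> \<int>")
    case False
    thus ?thesis using quotient[OF l False] by (simp add: acoef_over_sin_def)
  next
    case True
    have "(acoef_quotient k \<longlongrightarrow> acoef_quotient k l) (at l)" unfolding acoef_quotient_def
      by (intro tendsto_intros tendsto_Gamma) (use l in \<open>auto dest: nonpos_Ints_nonpos\<close>)
    moreover have "\<forall>\<^sub>F t in at l. t \<in> {- real k<..<1 + real k}"
      using l by (intro eventually_at_in_open') auto
    hence "\<forall>\<^sub>F t in at l. acoef_quotient k t = \<bar>acoef k (t - 1 / 2)\<bar> / \<bar>sin (pi * t)\<bar>"
      using eventually_at_notin_Ints by eventually_elim (simp add: quotient)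
    ultimately have "((\<lambda>t. \<bar>acoef k (t - 1 / 2)\<bar> / \<bar>sin (pi * t)\<bar>) \<longlongrightarrow> acoef_quotient k l) (at l)"
      by (rule Lim_transform_eventually)
    hence "Lim (at l) (\<lambda>t. \<bar>acoef k (t - 1 / 2)\<bar> / \<bar>sin (pi * t)\<bar>) = acoef_quotient k l"
      by (intro tendsto_Lim) auto
    thus ?thesis using True by (simp add: acoef_over_sin_def)
  qed
qed

definition neglected_term_bound :: "nat \<Rightarrow> complex \<Rightarrow> complex \<Rightarrow> complex \<Rightarrow> real" where
  "neglected_term_bound N \<alpha> lam z =
     norm (sin (of_real pi * lam)) * acoef_over_sin N (Re lam) * Gamma (Re \<alpha> - real N) * norm z ^ N"

lemma neglected_term_bound_nonneg:
  assumes "Re \<alpha> > real N" "- real N < Re lam" "Re lam < 1 + real N"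
  shows "neglected_term_bound N \<alpha> lam z \<ge> 0"
  using assms acoef_quotient_pos[of N "Re lam"] Gamma_real_pos[of "Re \<alpha> - real N"]
  unfolding neglected_term_bound_def acoef_over_sin_eq_quotient[OF assms(2,3)] by simp

lemma norm_Q_remainder_le_neglected_term:
  assumes \<alpha>: "Re \<alpha> > real N" and lam: "- real N < Re lam" "Re lam < 1 + real N" and w: "w \<notin> \<real>\<^sub>\<le>\<^sub>0"
    and bound: "\<And>r. r > 0 \<Longrightarrow> norm (terminant (real N + 1 / 2) (of_real r * w)) \<le> C * Gamma (real N + 1 / 2)"
  shows "norm (Q_remainder \<alpha> lam N w) \<le> neglected_term_bound N \<alpha> lam (2 * w) * C"
proof -
  have "Re lam + real N + (1 - Re lam + real N) = 1 + real (2 * N)" by simp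
  hence Beta: "Beta (Re lam + real N) (1 - Re lam + real N) =
      Gamma (Re lam + real N) * Gamma (1 - Re lam + real N) / fact (2 * N)"
    by (simp only: Beta_def Gamma_fact)
  show ?thesis
    using norm_Q_remainder_le[OF \<alpha> lam w bound]
    unfolding neglected_term_bound_def acoef_over_sin_eq_quotient[OF lam] acoef_quotient_def Beta Gamma_nat_plus_half
    by (simp add: norm_mult power_mult_distrib field_simps)
qed

lemma two_expansion_arg: "2 * expansion_arg \<xi> = - exp (- \<xi>) / sinh \<xi>"
proof -
  have "exp (2 * \<xi>) = exp \<xi> * exp \<xi>" "exp \<xi> * exp (- \<xi>) = 1" by (simp_all flip: exp_add)
  moreover have "2 * sinh \<xi> = exp \<xi> - exp (- \<xi>)" by (simp add: sinh_field_def)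
  ultimately have factor: "1 - exp (2 * \<xi>) = - (2 * exp \<xi> * sinh \<xi>)" by algebra
  show ?thesis unfolding expansion_arg_def factor exp_minus
    by (cases "sinh \<xi> = 0") (auto simp: field_simps)
qed

lemma two_expansion_arg_uminus: "2 * expansion_arg (- \<xi>) = exp \<xi> / sinh \<xi>"
  using two_expansion_arg[of "- \<xi>"] by simp

lemma norm_second_Q_remainder_le:
  assumes \<xi>: "\<xi> \<in> D1" and \<alpha>: "Re \<alpha> > real M" and lam: "- real M < Re lam" "Re lam < 1 + real M"
  shows "norm (Q_remainder \<alpha> lam M (expansion_arg (- \<xi>))) \<le> neglected_term_bound M \<alpha> lam (exp \<xi> / sinh \<xi>)"
proof -
  have w: "Re (expansion_arg (- \<xi>)) > 0" using \<xi> by (intro Re_expansion_arg_pos) (simp add: D1_def)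
  have "norm (Q_remainder \<alpha> lam M (expansion_arg (- \<xi>))) \<le>
      neglected_term_bound M \<alpha> lam (2 * expansion_arg (- \<xi>)) * 1"
  proof (rule norm_Q_remainder_le_neglected_term[OF \<alpha> lam Re_pos_notin_nonpos_Reals[OF w]])
    fix r :: real assume "r > 0"
    hence "Re (of_real r * expansion_arg (- \<xi>)) \<ge> 0" using w by simp
    from norm_terminant_le_Re[OF _ this]
    show "norm (terminant (real M + 1 / 2) (of_real r * expansion_arg (- \<xi>))) \<le> 1 * Gamma (real M + 1 / 2)" by simp
  qed
  thus ?thesis by (simp only: two_expansion_arg_uminus mult_1_right)
qed

lemma chi_nonneg: "p > 0 \<Longrightarrow> chi p \<ge> 0"
  unfolding chi_def by (intro divide_nonneg_nonneg mult_nonneg_nonneg less_imp_le[OF Gamma_real_pos]) auto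

lemma C1_factor_le: "C1_factor N \<xi> \<le> 1 + chi (real N + 1 / 2)"
  using chi_nonneg[of "real N + 1 / 2"] by (auto simp: C1_factor_def)

lemma sin_double_nonzero:
  assumes "Im \<xi> \<noteq> 0" "\<bar>Im \<xi>\<bar> < pi" "Re (exp (2 * \<xi>)) > 1"
  shows "sin (2 * Im \<xi>) \<noteq> 0"
proof
  assume "sin (2 * Im \<xi>) = 0"
  hence "cos (Im \<xi>) = 0" using sin_nonzero[OF assms(1,2)] by (simp add: sin_double)
  hence "cos (2 * Im \<xi>) = - 1" by (simp add: cos_double_cos)
  thus False using assms(3) exp_gt_zero[of "2 * Re \<xi>"] by (simp add: Re_exp)
qed

lemma expansion_arg_norm_over_Im:
  assumes "sin (2 * Im \<xi>) \<noteq> 0"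
  shows "Im (expansion_arg \<xi>) \<noteq> 0"
    and "norm (expansion_arg \<xi>) / \<bar>Im (expansion_arg \<xi>)\<bar> = norm (1 - exp (- 2 * \<xi>)) * \<bar>1 / sin (2 * Im \<xi>)\<bar>"
proof -
  define z where "z = 1 - exp (2 * \<xi>)"
  have Im_z: "Im z = - (exp (2 * Re \<xi>) * sin (2 * Im \<xi>))" by (simp add: z_def Im_exp)
  hence z: "z \<noteq> 0" using assms by auto
  have Im_w: "Im (expansion_arg \<xi>) = - Im z / (norm z)\<^sup>2"
    unfolding expansion_arg_def z_def[symmetric] by (simp add: Im_divide cmod_power2)
  show "Im (expansion_arg \<xi>) \<noteq> 0" unfolding Im_w using z Im_z assms by simp
  have "z = - (exp (2 * \<xi>) * (1 - exp (- 2 * \<xi>)))" by (simp add: z_def algebra_simps flip: exp_add)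
  hence norm_z: "norm z = exp (2 * Re \<xi>) * norm (1 - exp (- 2 * \<xi>))" by (simp add: norm_mult)
  have "norm (expansion_arg \<xi>) = 1 / norm z" by (simp add: expansion_arg_def z_def norm_divide)
  hence "norm (expansion_arg \<xi>) / \<bar>Im (expansion_arg \<xi>)\<bar> = norm z / \<bar>Im z\<bar>"
    unfolding Im_w using z by (simp add: power2_eq_square)
  also have "\<dots> = norm (1 - exp (- 2 * \<xi>)) * \<bar>1 / sin (2 * Im \<xi>)\<bar>"
    unfolding norm_z Im_z by (simp add: abs_mult)
  finally show "norm (expansion_arg \<xi>) / \<bar>Im (expansion_arg \<xi>)\<bar> =
      norm (1 - exp (- 2 * \<xi>)) * \<bar>1 / sin (2 * Im \<xi>)\<bar>" .
qed

lemma norm_terminant_expansion_arg_le: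
  assumes \<xi>: "Im \<xi> \<noteq> 0" "\<bar>Im \<xi>\<bar> < pi" and r: "r > 0"
  shows "norm (terminant (real N + 1 / 2) (of_real r * expansion_arg \<xi>)) \<le> C1_factor N \<xi> * Gamma (real N + 1 / 2)"
proof (cases "Re (exp (2 * \<xi>)) \<le> 1")
  case True
  hence "Re (1 - exp (2 * \<xi>)) \<ge> 0" by simp
  hence "Re (of_real r * expansion_arg \<xi>) \<ge> 0"
    unfolding expansion_arg_def using r by (simp add: Re_divide del: minus_complex.sel)
  from norm_terminant_le_Re[OF _ this] show ?thesis using True by (simp add: C1_factor_def)
next
  case False
  hence sin: "sin (2 * Im \<xi>) \<noteq> 0" using sin_double_nonzero[OF \<xi>] by simp
  note arg = expansion_arg_norm_over_Im[OF sin]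
  have Im: "Im (of_real r * expansion_arg \<xi>) \<noteq> 0" using arg(1) r by simp
  have "norm (of_real r * expansion_arg \<xi>) / \<bar>Im (of_real r * expansion_arg \<xi>)\<bar> =
      norm (1 - exp (- 2 * \<xi>)) * \<bar>1 / sin (2 * Im \<xi>)\<bar>"
    unfolding arg(2)[symmetric] using r by (simp add: norm_mult abs_mult)
  thus ?thesis
    using norm_terminant_le_Im[OF _ Im, of "real N + 1 / 2"] norm_terminant_le_chi[OF _ Im, of "real N + 1 / 2"] False sin
    by (simp add: C1_factor_def min_def)
qed

lemma norm_first_Q_remainder_le:
  assumes \<xi>: "\<xi> \<in> D1" "Im \<xi> \<noteq> 0" and \<alpha>: "Re \<alpha> > real N" and lam: "- real N < Re lam" "Re lam < 1 + real N"
  shows "norm (Q_remainder \<alpha> lam N (expansion_arg \<xi>)) \<le>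
      neglected_term_bound N \<alpha> lam (exp (- \<xi>) / sinh \<xi>) * C1_factor N \<xi>"
proof -
  have Im: "\<bar>Im \<xi>\<bar> < pi" using \<xi> by (simp add: D1_def)
  have "norm (Q_remainder \<alpha> lam N (expansion_arg \<xi>)) \<le>
      neglected_term_bound N \<alpha> lam (2 * expansion_arg \<xi>) * C1_factor N \<xi>"
    by (intro norm_Q_remainder_le_neglected_term expansion_arg_notin_nonpos_Reals norm_terminant_expansion_arg_le \<xi>(2) Im \<alpha> lam)
  thus ?thesis unfolding two_expansion_arg by (simp add: neglected_term_bound_def norm_divide)
qed

lemma terminant_pos_real:
  assumes "p > 0" "c > 0"
  shows "\<exists>r>0. terminant p (of_real c) = of_real r"
  unfolding terminant_def
proof (rule set_integral_pos_real[of _ _ 0 1])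
  show "set_integrable lborel {0<..} (\<lambda>v. Gamma_kernel (of_real p) v * (1 / (1 + complex_of_real c * of_real v)))"
  proof (rule set_integrable_terminant[OF assms(1) zero_less_one])
    fix v :: real assume "v > 0"
    hence "1 \<le> \<bar>1 + c * v\<bar>" using assms by simp
    also have "\<dots> = norm (1 + complex_of_real c * of_real v)"
      by (metis norm_of_real of_real_1 of_real_add of_real_mult)
    finally show "1 \<le> norm (1 + complex_of_real c * of_real v)" .
  qed
  fix v :: real assume "v \<in> {0<..}"
  moreover from this have "1 + c * v > 0" using assms by (simp add: add_pos_pos)
  ultimately show "\<exists>r>0. Gamma_kernel (of_real p) v * (1 / (1 + complex_of_real c * of_real v)) = of_real r"
    by (intro exI[of _ "v powr (p - 1) * exp (- v) * (1 / (1 + c * v))"]) (simp add: Gamma_kernel_pos_real)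
qed auto

lemma norm_terminant_average_of_real_le:
  assumes "a > 0" "p > 0" "c > 0"
  shows "norm (terminant_average (of_real a) p (of_real c)) \<le> Gamma a * Gamma p"
  using norm_terminant_average_le[of "of_real a" p "of_real c" "Gamma p"] norm_terminant_le_Re[of p] assms by simp

lemma terminant_average_pos_real:
  assumes a: "a > 0" and p: "p > 0" and c: "c > 0"
  shows "\<exists>r>0. terminant_average (of_real a) p (of_real c) = of_real r"
  unfolding terminant_average_def
proof (rule set_integral_pos_real[of _ _ 0 1])
  show "set_integrable lborel {0<..} (\<lambda>t. Gamma_kernel (of_real a) t * terminant p (of_real c / of_real t))"
  proof (rule set_integrable_Gamma_kernel_bounded(1))
    show "continuous_on {0<..} (\<lambda>t. terminant p (of_real c / of_real t))"
      using c by (intro continuous_on_terminant_divide p) simp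
    show "norm (terminant p (of_real c / of_real t)) \<le> Gamma p" if "t > 0" for t
      using c that by (intro norm_terminant_le_Re p) simp
  qed (use a in simp)
  fix t :: real assume "t \<in> {0<..}"
  hence t: "t > 0" by simp
  then obtain r where "r > 0" "terminant p (of_real (c / t)) = of_real r"
    using terminant_pos_real[OF p, of "c / t"] c by auto
  thus "\<exists>r>0. Gamma_kernel (of_real a) t * terminant p (of_real c / of_real t) = of_real r"
    using t by (intro exI[of _ "t powr (a - 1) * exp (- t) * r"]) (simp add: Gamma_kernel_pos_real)
qed auto

lemma Q_remainder_of_real:
  assumes w: "w > 0" and a: "a > real N" and l: "- real N < l" "l < 1 + real N"
  shows "\<exists>r>0. Q_remainder (of_real a) (of_real l) N (of_real w) = of_real ((- 1) ^ N * sin (pi * l) * r)"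
proof -
  let ?B = "Beta_kernel (of_real l + of_nat N) (1 - of_real l + of_nat N)"
    and ?D = "\<lambda>x. terminant_average (of_real a - of_nat N) (real N + 1 / 2)
        (of_real (4 * x * (1 - x)) * of_real w)"
  have a_eq: "of_real a - of_nat N = complex_of_real (a - real N)" by simp
  have D: "?D x = terminant_average (of_real (a - real N)) (real N + 1 / 2) (of_real (4 * x * (1 - x) * w))" for x
    unfolding a_eq of_real_mult ..
  have arg_pos: "4 * x * (1 - x) * w > 0" if "x \<in> {0<..<1}" for x using that w by simp
  have "\<exists>r>0. (LINT x:{0<..<1}|lborel. ?B x * ?D x) = of_real r"
  proof (rule set_integral_pos_real[of _ _ 0 1])
    show "set_integrable lborel {0<..<1} (\<lambda>x. ?B x * ?D x)"
    proof (rule set_integrable_Beta_kernel_bounded(1))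
      show "continuous_on {0<..<1} ?D" using a w by (intro continuous_on_terminant_average_scaled) auto
      show "norm (?D x) \<le> Gamma (a - real N) * Gamma (real N + 1 / 2)" if "x \<in> {0<..<1}" for x
        unfolding D using a arg_pos[OF that] by (intro norm_terminant_average_of_real_le) auto
    qed (use l in auto)
    fix x :: real assume x: "x \<in> {0<..<1}"
    have "?B = Beta_kernel (of_real (l + real N)) (of_real (1 - l + real N))" by simp
    hence B: "?B x = of_real (x powr (l + real N - 1) * (1 - x) powr (1 - l + real N - 1))"
      by (simp only: Beta_kernel_of_real[OF x])
    obtain r where r: "r > 0" "?D x = of_real r"
      using terminant_average_pos_real[OF _ _ arg_pos[OF x], of "a - real N" "real N + 1 / 2"] a
      unfolding D by auto
    have "?B x * ?D x = of_real (x powr (l + real N - 1) * (1 - x) powr (1 - l + real N - 1) * r)"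
      unfolding B r(2) by simp
    moreover have "x powr (l + real N - 1) * (1 - x) powr (1 - l + real N - 1) * r > 0" using x r(1) by simp
    ultimately show "\<exists>r>0. ?B x * ?D x = of_real r" by blast
  qed auto
  then obtain r where r: "r > 0" "(LINT x:{0<..<1}|lborel. ?B x * ?D x) = of_real r" by blast
  have "Q_remainder (of_real a) (of_real l) N (of_real w) =
      of_real (sin (pi * l) / (pi * sqrt pi) * (- 4 * w) ^ N * r)"
    unfolding Q_remainder_def r(2) by (simp add: sin_of_real[symmetric])
  also have "sin (pi * l) / (pi * sqrt pi) * (- 4 * w) ^ N * r =
      (- 1) ^ N * sin (pi * l) * ((4 * w) ^ N * r / (pi * sqrt pi))"
    using power_mult_distrib[of "- 1" "4 * w" N] by (simp add: mult_ac)
  finally show ?thesis using w r(1) by (intro exI[of _ "(4 * w) ^ N * r / (pi * sqrt pi)"]) simp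
qed

section \<open>The Gegenbauer function\<close>

text \<open>Off the real axis, with \<open>K = Kfac \<xi> lam\<close>, this is \<^const>\<open>Q_remainder\<close> at the first argument
  divided by \<open>\<Gamma>(\<nu> + 1)\<close>; it stays continuous across the real axis, where that argument lies on
  the cut.\<close>

definition first_remainder :: "complex \<Rightarrow> nat \<Rightarrow> complex \<Rightarrow> complex \<Rightarrow> complex \<Rightarrow> complex" where
  "first_remainder K N \<xi> lam \<nu> =
     (scaled_P (\<nu> + lam) lam \<xi> - K * Q_wave (\<nu> + lam) lam (- \<xi>)) / (exp (\<xi> * (\<nu> + lam)) * Gamma (\<nu> + 1)) -
     (\<Sum>n<N. acoef n (lam - 1 / 2) * (Gamma (\<nu> + lam - of_nat n) / Gamma (\<nu> + 1)) * (- exp (- \<xi>) / sinh \<xi>) ^ n)"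

definition second_remainder :: "nat \<Rightarrow> complex \<Rightarrow> complex \<Rightarrow> complex \<Rightarrow> complex" where
  "second_remainder M \<xi> lam \<nu> = Q_remainder (\<nu> + lam) lam M (expansion_arg (- \<xi>)) / Gamma (\<nu> + 1)"

lemma scaled_Q_expansion_divided:
  assumes "w \<notin> \<real>\<^sub>\<le>\<^sub>0" "Re \<alpha> > real N" "- real N < Re lam" "Re lam < 1 + real N"
  shows "scaled_Q \<alpha> lam w / G =
    (\<Sum>n<N. acoef n (lam - 1 / 2) * (Gamma (\<alpha> - of_nat n) / G) * (2 * w) ^ n) + Q_remainder \<alpha> lam N w / G"
  unfolding scaled_Q_expansion[OF assms] add_divide_distrib sum_divide_distrib by simp

lemma first_remainder_nonreal:
  assumes \<xi>: "\<xi> \<in> D1" "Im \<xi> \<noteq> 0" and \<alpha>: "Re (\<nu> + lam) > real N" and lam: "- real N < Re lam" "Re lam < 1 + real N"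
  shows "first_remainder (Kfac \<xi> lam) N \<xi> lam \<nu> = Q_remainder (\<nu> + lam) lam N (expansion_arg \<xi>) / Gamma (\<nu> + 1)"
proof -
  have Im: "\<bar>Im \<xi>\<bar> < pi" using \<xi> by (simp add: D1_def)
  have "scaled_P (\<nu> + lam) lam \<xi> - Kfac \<xi> lam * Q_wave (\<nu> + lam) lam (- \<xi>) =
      exp (\<xi> * (\<nu> + lam)) * scaled_Q (\<nu> + lam) lam (expansion_arg \<xi>)"
    using connection_formula[OF \<xi>, of "\<nu> + lam" lam] \<alpha> lam by (simp add: Q_wave_def)
  hence "first_remainder (Kfac \<xi> lam) N \<xi> lam \<nu> = scaled_Q (\<nu> + lam) lam (expansion_arg \<xi>) / Gamma (\<nu> + 1) -
      (\<Sum>n<N. acoef n (lam - 1 / 2) * (Gamma (\<nu> + lam - of_nat n) / Gamma (\<nu> + 1)) * (2 * expansion_arg \<xi>) ^ n)"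
    unfolding first_remainder_def two_expansion_arg by simp
  thus ?thesis
    unfolding scaled_Q_expansion_divided[OF expansion_arg_notin_nonpos_Reals[OF \<xi>(2) Im] \<alpha> lam] by simp
qed

lemma open_D1: "open D1"
proof -
  have strip: "D1 = {\<xi>. Re \<xi> > 0} \<inter> {\<xi>. Im \<xi> < pi} \<inter> {\<xi>. Im \<xi> > - pi}" by (auto simp: D1_def)
  show ?thesis
    unfolding strip by (intro open_Int open_halfspace_Re_gt open_halfspace_Im_gt open_halfspace_Im_lt)
qed

lemma sinh_nonzero_D1: "\<xi> \<in> D1 \<Longrightarrow> sinh \<xi> \<noteq> 0"
  using two_sinh_notin_nonpos_Reals[of \<xi>] D1_subset_slit_strip by auto

lemma continuous_on_first_remainder:
  assumes \<alpha>: "Re (\<nu> + lam) > real N" and lam: "- real N < Re lam" "Re lam < 1 + real N"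
    and nonzero: "Gamma (\<nu> + 1) \<noteq> 0"
  shows "continuous_on D1 (\<lambda>\<xi>. first_remainder K N \<xi> lam \<nu>)"
proof -
  have "(\<lambda>\<xi>. Q_wave (\<nu> + lam) lam (- \<xi>)) holomorphic_on D1"
  proof (intro holomorphic_on_Q_wave[OF open_D1] holomorphic_intros)
    show "expansion_arg (- \<xi>) \<notin> \<real>\<^sub>\<le>\<^sub>0" if "\<xi> \<in> D1" for \<xi>
      using that by (intro Re_pos_notin_nonpos_Reals Re_expansion_arg_pos) (simp add: D1_def)
  qed (use \<alpha> lam in auto)
  moreover have "(\<lambda>\<xi>. scaled_P (\<nu> + lam) lam \<xi>) holomorphic_on D1"
    using holomorphic_on_subset[OF holomorphic_on_scaled_P D1_subset_slit_strip] .
  moreover have "sinh holomorphic_on D1" using holomorphic_on_sinh[OF holomorphic_on_ident] .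
  ultimately show ?thesis
    unfolding first_remainder_def using nonzero sinh_nonzero_D1
    by (intro continuous_intros holomorphic_on_imp_continuous_on) auto
qed

lemma norm_first_remainder_nonreal_le:
  assumes \<xi>: "\<xi> \<in> D1" "Im \<xi> \<noteq> 0" and \<alpha>: "Re (\<nu> + lam) > real N" and lam: "- real N < Re lam" "Re lam < 1 + real N"
  shows "norm (first_remainder (Kfac \<xi> lam) N \<xi> lam \<nu>) \<le>
    neglected_term_bound N (\<nu> + lam) lam (exp (- \<xi>) / sinh \<xi>) * C1_factor N \<xi> / norm (Gamma (\<nu> + 1))"
  unfolding first_remainder_nonreal[OF assms] norm_divide[of _ "Gamma (\<nu> + 1)"]
  by (intro divide_right_mono norm_first_Q_remainder_le[OF \<xi> \<alpha> lam]) simp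

lemma norm_first_remainder_boundary_le:
  assumes x: "x > 0" and s: "s = 1 \<or> s = - 1" and \<alpha>: "Re (\<nu> + lam) > real N"
    and lam: "- real N < Re lam" "Re lam < 1 + real N" and nonzero: "Gamma (\<nu> + 1) \<noteq> 0"
  shows "norm (first_remainder (exp (of_real s * (of_real pi * \<i> * lam))) N (of_real x) lam \<nu>) \<le>
    neglected_term_bound N (\<nu> + lam) lam (exp (- of_real x) / sinh (of_real x)) * (1 + chi (real N + 1 / 2)) /
      norm (Gamma (\<nu> + 1))"
proof -
  define K where "K = exp (of_real s * (of_real pi * \<i> * lam))"
  define B where "B \<xi> = neglected_term_bound N (\<nu> + lam) lam (exp (- \<xi>) / sinh \<xi>) *
    (1 + chi (real N + 1 / 2)) / norm (Gamma (\<nu> + 1))" for \<xi>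
  define \<zeta> where "\<zeta> t = complex_of_real x + \<i> * of_real (s * t)" for t
  have D1: "complex_of_real x \<in> D1" using x by (simp add: D1_def)
  have "(\<zeta> \<longlongrightarrow> complex_of_real x + \<i> * of_real (s * 0)) (at_right 0)"
    unfolding \<zeta>_def by (intro tendsto_intros)
  hence \<zeta>: "(\<zeta> \<longlongrightarrow> of_real x) (at_right 0)" by simp
  have "isCont (\<lambda>\<xi>. first_remainder K N \<xi> lam \<nu>) (of_real x)"
    using continuous_on_first_remainder[OF \<alpha> lam nonzero] D1 open_D1 by (simp add: continuous_on_eq_continuous_at)
  from isCont_tendsto_compose[OF this \<zeta>] have remainder_lim:
    "((\<lambda>t. norm (first_remainder K N (\<zeta> t) lam \<nu>)) \<longlongrightarrow> norm (first_remainder K N (of_real x) lam \<nu>)) (at_right 0)"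
    by (rule tendsto_norm)
  have "isCont B (of_real x)"
    unfolding B_def neglected_term_bound_def sinh_field_def
    by (intro continuous_intros) (use sinh_nonzero_D1[OF D1] nonzero in \<open>auto simp: sinh_field_def\<close>)
  from isCont_tendsto_compose[OF this \<zeta>] have bound_lim: "((\<lambda>t. B (\<zeta> t)) \<longlongrightarrow> B (of_real x)) (at_right 0)" .
  have "\<forall>\<^sub>F t in at_right 0. t \<in> {0<..<pi}" by (rule eventually_at_right_real) simp
  hence "\<forall>\<^sub>F t in at_right 0. norm (first_remainder K N (\<zeta> t) lam \<nu>) \<le> B (\<zeta> t)"
  proof eventually_elim
    case (elim t)
    have \<zeta>_t: "\<zeta> t \<in> D1" "Im (\<zeta> t) \<noteq> 0" "Kfac (\<zeta> t) lam = K"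
      using elim s x by (auto simp: D1_def Kfac_def K_def \<zeta>_def)
    have "norm (first_remainder K N (\<zeta> t) lam \<nu>) \<le>
        neglected_term_bound N (\<nu> + lam) lam (exp (- \<zeta> t) / sinh (\<zeta> t)) * C1_factor N (\<zeta> t) / norm (Gamma (\<nu> + 1))"
      using norm_first_remainder_nonreal_le[OF \<zeta>_t(1,2) \<alpha> lam] unfolding \<zeta>_t(3) .
    also have "\<dots> \<le> B (\<zeta> t)"
      unfolding B_def by (intro divide_right_mono mult_left_mono C1_factor_le neglected_term_bound_nonneg \<alpha> lam) simp
    finally show ?case .
  qed
  hence "norm (first_remainder K N (of_real x) lam \<nu>) \<le> B (of_real x)"
    by (rule tendsto_le[OF _ bound_lim remainder_lim, rotated]) simp
  thus ?thesis unfolding K_def B_def .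
qed

lemma first_remainder_average:
  "first_remainder ((k + k') / 2) N \<xi> lam \<nu> = (first_remainder k N \<xi> lam \<nu> + first_remainder k' N \<xi> lam \<nu>) / 2"
  unfolding first_remainder_def by (simp add: add_divide_distrib diff_divide_distrib algebra_simps)

lemma norm_first_remainder_le:
  assumes \<xi>: "\<xi> \<in> D1" and \<alpha>: "Re (\<nu> + lam) > real N" and lam: "- real N < Re lam" "Re lam < 1 + real N"
    and nonzero: "Gamma (\<nu> + 1) \<noteq> 0"
  shows "norm (first_remainder (Kfac \<xi> lam) N \<xi> lam \<nu>) \<le>
    neglected_term_bound N (\<nu> + lam) lam (exp (- \<xi>) / sinh \<xi>) * C1_factor N \<xi> / norm (Gamma (\<nu> + 1))"
proof (cases "Im \<xi> = 0")
  case False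
  show ?thesis by (rule norm_first_remainder_nonreal_le[OF \<xi> False \<alpha> lam])
next
  case True
  hence \<xi>_eq: "\<xi> = of_real (Re \<xi>)" and Re_pos: "Re \<xi> > 0" using \<xi> by (simp_all add: D1_def complex_eq_iff)
  hence factor: "C1_factor N \<xi> = 1 + chi (real N + 1 / 2)" using True by (simp add: C1_factor_def Re_exp)
  define R where "R s = first_remainder (exp (of_real s * (of_real pi * \<i> * lam))) N \<xi> lam \<nu>" for s
  define B where "B = neglected_term_bound N (\<nu> + lam) lam (exp (- \<xi>) / sinh \<xi>) * C1_factor N \<xi> /
    norm (Gamma (\<nu> + 1))"
  have "norm (R s) \<le> B" if "s = 1 \<or> s = - 1" for s
    using norm_first_remainder_boundary_le[OF Re_pos that \<alpha> lam nonzero]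
    unfolding R_def B_def factor \<xi>_eq[symmetric] .
  hence R: "norm (R 1) \<le> B" "norm (R (- 1)) \<le> B" by simp_all
  have "Kfac \<xi> lam = (exp (of_real 1 * (of_real pi * \<i> * lam)) + exp (of_real (- 1) * (of_real pi * \<i> * lam))) / 2"
    using True by (simp add: Kfac_def cos_exp_eq mult_ac)
  hence average: "first_remainder (Kfac \<xi> lam) N \<xi> lam \<nu> = (R 1 + R (- 1)) / 2"
    by (simp only: first_remainder_average R_def)
  have "norm (first_remainder (Kfac \<xi> lam) N \<xi> lam \<nu>) = norm (R 1 + R (- 1)) / 2"
    unfolding average by (simp add: norm_divide)
  also have "\<dots> \<le> B" using norm_triangle_mono[OF R] by simp
  finally show ?thesis unfolding B_def .
qed

lemma norm_second_remainder_le: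
  assumes \<xi>: "\<xi> \<in> D1" and \<alpha>: "Re (\<nu> + lam) > real M" and lam: "- real M < Re lam" "Re lam < 1 + real M"
  shows "norm (second_remainder M \<xi> lam \<nu>) \<le>
    neglected_term_bound M (\<nu> + lam) lam (exp \<xi> / sinh \<xi>) / norm (Gamma (\<nu> + 1))"
  unfolding second_remainder_def norm_divide[of _ "Gamma (\<nu> + 1)"]
  by (intro divide_right_mono norm_second_Q_remainder_le[OF assms]) simp

lemma gegenbauer_expansion:
  assumes \<xi>: "\<xi> \<in> D1" and \<alpha>: "Re (\<nu> + lam) > real M" and lam: "- real M < Re lam" "Re lam < 1 + real M"
  shows "gegenbauer_C lam \<nu> (cosh \<xi>) =
         exp (\<xi> * (\<nu> + lam)) * rGamma lam / (2 * sinh \<xi>) powr lam *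
           ((\<Sum>n<N. acoef n (lam - 1 / 2) * (Gamma (\<nu> + lam - of_nat n) / Gamma (\<nu> + 1))
                      * (- exp (- \<xi>) / sinh \<xi>) ^ n)
            + first_remainder (Kfac \<xi> lam) N \<xi> lam \<nu>)
         + Kfac \<xi> lam * (exp (- \<xi> * (\<nu> + lam)) * rGamma lam / (2 * sinh \<xi>) powr lam) *
           ((\<Sum>m<M. acoef m (lam - 1 / 2) * (Gamma (\<nu> + lam - of_nat m) / Gamma (\<nu> + 1))
                      * (exp \<xi> / sinh \<xi>) ^ m)
            + second_remainder M \<xi> lam \<nu>)"
proof -
  define G E E' p K P Q where "G = Gamma (\<nu> + 1)" and "E = exp (\<xi> * (\<nu> + lam))" and "E' = exp (- \<xi> * (\<nu> + lam))"
    and "p = (2 * sinh \<xi>) powr lam" and "K = Kfac \<xi> lam" and "P = scaled_P (\<nu> + lam) lam \<xi>"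
    and "Q = scaled_Q (\<nu> + lam) lam (expansion_arg (- \<xi>))"
  have "Re (expansion_arg (- \<xi>)) > 0" using \<xi> by (intro Re_expansion_arg_pos) (simp add: D1_def)
  note second = scaled_Q_expansion_divided[OF Re_pos_notin_nonpos_Reals[OF this] \<alpha> lam, of G, symmetric,
      unfolded two_expansion_arg_uminus, folded Q_def]
  have first: "(\<Sum>n<N. acoef n (lam - 1 / 2) * (Gamma (\<nu> + lam - of_nat n) / G) * (- exp (- \<xi>) / sinh \<xi>) ^ n) +
      first_remainder K N \<xi> lam \<nu> = (P - K * (E' * Q)) / (E * G)"
    by (simp add: first_remainder_def Q_wave_def G_def E_def E'_def P_def Q_def)
  have "E \<noteq> 0" by (simp add: E_def)
  hence "E * rGamma lam / p * ((P - K * (E' * Q)) / (E * G)) = rGamma lam / p * ((P - K * (E' * Q)) / G)" by simp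
  hence "rGamma lam * (1 / G) / p * P =
      E * rGamma lam / p * ((P - K * (E' * Q)) / (E * G)) + K * (E' * rGamma lam / p) * (Q / G)"
    by (simp add: diff_divide_distrib algebra_simps)
  moreover have "rGamma (\<nu> + 1) = 1 / G" by (simp add: G_def Gamma_def inverse_eq_divide)
  ultimately show ?thesis
    unfolding gegenbauer_C_eq_scaled_P[OF \<xi>] second_remainder_def
      G_def[symmetric] E_def[symmetric] E'_def[symmetric] p_def[symmetric] K_def[symmetric] P_def[symmetric] first second
    by simp
qed

lemma second_remainder_real:
  fixes x l v :: real and M :: nat
  assumes x: "x > 0" and l: "- real M < l" "l < 1 + real M" and v: "v + l > real M"
  defines "T \<equiv> acoef M (l - 1 / 2) * (Gamma (v + l - real M) / Gamma (v + 1)) * (exp x / sinh x) ^ M"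
  shows "\<exists>q>0. second_remainder M (of_real x) (of_real l) (of_real v) = of_real (q * T)"
proof -
  define w where "w = 1 / (1 - exp (- (2 * x)))"
  have w: "w > 0" using x by (simp add: w_def)
  have v1: "v + 1 > 0" using l v by linarith
  have arg: "expansion_arg (- of_real x) = of_real w"
    by (simp add: expansion_arg_def w_def exp_of_real[symmetric])
  have Gamma: "Gamma (complex_of_real v + 1) = of_real (Gamma (v + 1))"
    by (simp add: Gamma_complex_of_real[symmetric])
  obtain r where r: "r > 0" "Q_remainder (of_real (v + l)) (of_real l) M (of_real w) =
      of_real ((- 1) ^ M * sin (pi * l) * r)"
    using Q_remainder_of_real[OF w v l] by blast
  define t where "t = acoef_quotient M l * (Gamma (v + l - real M) / Gamma (v + 1)) * (exp x / sinh x) ^ M"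
  have t: "t > 0" unfolding t_def
    using x v v1 acoef_quotient_pos[OF l]
    by (intro mult_pos_pos divide_pos_pos Gamma_real_pos zero_less_power) auto
  have T: "T = (- 1) ^ M * sin (pi * l) * t" unfolding T_def t_def acoef_eq_sin_mult_quotient[OF l] by simp
  have "second_remainder M (of_real x) (of_real l) (of_real v) = of_real (r / (Gamma (v + 1) * t) * T)"
    using r(2) t unfolding second_remainder_def arg Gamma T by simp
  moreover have "r / (Gamma (v + 1) * t) > 0" using r(1) t v1 by (intro divide_pos_pos mult_pos_pos Gamma_real_pos)
  ultimately show ?thesis by blast
qed

lemma neglected_term_bound_of_real:
  fixes x l v :: real and M :: nat
  assumes x: "x > 0" and l: "- real M < l" "l < 1 + real M" and v: "v + l > real M"
  shows "neglected_term_bound M (of_real v + of_real l) (of_real l) (exp (of_real x) / sinh (of_real x)) /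
      norm (Gamma (complex_of_real v + 1)) =
    \<bar>acoef M (l - 1 / 2) * (Gamma (v + l - real M) / Gamma (v + 1)) * (exp x / sinh x) ^ M\<bar>"
proof -
  have "v + 1 > 0" using l v by linarith
  hence Gammas: "Gamma (v + 1) > 0" "Gamma (v + l - real M) > 0" using v by (auto intro: Gamma_real_pos)
  have "Gamma (complex_of_real v + 1) = of_real (Gamma (v + 1))" by (simp add: Gamma_complex_of_real[symmetric])
  hence Gamma_norm: "norm (Gamma (complex_of_real v + 1)) = Gamma (v + 1)" using Gammas by simp
  have "exp (of_real x) / sinh (complex_of_real x) = of_real (exp x / sinh x)"
    by (simp add: sinh_field_def exp_of_real[symmetric])
  hence base_norm: "norm (exp (of_real x) / sinh (complex_of_real x)) = exp x / sinh x"
    using x by (simp only: norm_of_real) simp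
  have sin_norm: "norm (sin (of_real pi * complex_of_real l)) = \<bar>sin (pi * l)\<bar>"
    by (metis norm_of_real of_real_mult sin_of_real)
  show ?thesis
    unfolding neglected_term_bound_def sin_norm base_norm Gamma_norm acoef_eq_sin_mult_quotient[OF l]
    using x Gammas acoef_quotient_pos[OF l] acoef_over_sin_eq_quotient[OF l] by (simp add: abs_mult power_abs)
qed

lemma second_remainder_sign:
  fixes x l v :: real and M :: nat
  assumes x: "x > 0" and l: "- real M < l" "l < 1 + real M" and v: "v + l > real M"
  defines "R \<equiv> second_remainder M (of_real x) (of_real l) (of_real v)"
    and "T \<equiv> acoef M (l - 1 / 2) * (Gamma (v + l - real M) / Gamma (v + 1)) * (exp x / sinh x) ^ M"
  shows "R \<in> \<real> \<and> \<bar>Re R\<bar> \<le> \<bar>T\<bar> \<and> sgn (Re R) = sgn T"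
proof -
  obtain q where q: "q > 0" "R = of_real (q * T)"
    using second_remainder_real[OF x l v] unfolding R_def T_def by blast
  have "complex_of_real x \<in> D1" using x by (simp add: D1_def)
  hence "norm R \<le> \<bar>T\<bar>"
    unfolding R_def T_def neglected_term_bound_of_real[OF x l v, symmetric]
    using l v by (intro norm_second_remainder_le) auto
  moreover have "norm R = \<bar>q * T\<bar>" unfolding q(2) by (rule norm_of_real)
  ultimately show ?thesis unfolding q(2) using q(1) by (simp add: sgn_mult)
qed

theorem corollary5p1:
  shows "\<exists>R1 R2 :: nat \<Rightarrow> complex \<Rightarrow> complex \<Rightarrow> complex \<Rightarrow> complex.
    (\<forall>\<xi> \<in> D1. \<forall>(N::nat) (M::nat) (lam::complex) (\<nu>::complex).
       \<bar>Re lam - 1 / 2\<bar> < min (real N + 1 / 2) (real M + 1 / 2) \<longrightarrow>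
       Re \<nu> > max (real N - Re lam) (real M - Re lam) \<longrightarrow>
       gegenbauer_C lam \<nu> (cosh \<xi>) =
         exp (\<xi> * (\<nu> + lam)) * rGamma lam / (2 * sinh \<xi>) powr lam *
           ((\<Sum>n<N. acoef n (lam - 1 / 2) * (Gamma (\<nu> + lam - of_nat n) / Gamma (\<nu> + 1))
                      * (- exp (- \<xi>) / sinh \<xi>) ^ n)
            + R1 N \<xi> lam \<nu>)
         + Kfac \<xi> lam * (exp (- \<xi> * (\<nu> + lam)) * rGamma lam / (2 * sinh \<xi>) powr lam) *
           ((\<Sum>m<M. acoef m (lam - 1 / 2) * (Gamma (\<nu> + lam - of_nat m) / Gamma (\<nu> + 1))
                      * (exp \<xi> / sinh \<xi>) ^ m)
            + R2 M \<xi> lam \<nu>)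
       \<and> norm (R1 N \<xi> lam \<nu>)
           \<le> norm (sin (of_real pi * lam)) * acoef_over_sin N (Re lam)
              * (Gamma (Re \<nu> + Re lam - real N) / norm (Gamma (\<nu> + 1)))
              * norm (exp (- \<xi>) / sinh \<xi>) ^ N * C1_factor N \<xi>
       \<and> norm (R2 M \<xi> lam \<nu>)
           \<le> norm (sin (of_real pi * lam)) * acoef_over_sin M (Re lam)
              * (Gamma (Re \<nu> + Re lam - real M) / norm (Gamma (\<nu> + 1)))
              * norm (exp \<xi> / sinh \<xi>) ^ M)
    \<and> (\<forall>(x::real) (l::real) (v::real) (M::nat).
         x > 0 \<longrightarrow> \<bar>l - 1 / 2\<bar> < real M + 1 / 2 \<longrightarrow> v > real M - l \<longrightarrow>
         (let R = R2 M (of_real x) (of_real l) (of_real v);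
              T = acoef M (l - 1 / 2) * (Gamma (v + l - real M) / Gamma (v + 1))
                    * (exp x / sinh x) ^ M
          in R \<in> \<real> \<and> \<bar>Re R\<bar> \<le> \<bar>T\<bar> \<and> sgn (Re R) = sgn T))"
proof (rule exI[of _ "\<lambda>N \<xi> lam \<nu>. first_remainder (Kfac \<xi> lam) N \<xi> lam \<nu>"], rule exI[of _ second_remainder],
    (rule conjI; intro ballI allI impI), goal_cases)
  case (1 \<xi> N M lam \<nu>)
  hence lam: "- real N < Re lam" "Re lam < 1 + real N" "- real M < Re lam" "Re lam < 1 + real M"
    and \<alpha>: "Re (\<nu> + lam) > real N" "Re (\<nu> + lam) > real M"
    by (auto simp: abs_less_iff)
  hence "Re (\<nu> + 1) > 0" by simp
  show ?case
    using norm_first_remainder_le[OF \<open>\<xi> \<in> D1\<close> \<alpha>(1) lam(1,2) Gamma_nonzero_Re_pos[OF \<open>Re (\<nu> + 1) > 0\<close>]]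
      norm_second_remainder_le[OF \<open>\<xi> \<in> D1\<close> \<alpha>(2) lam(3,4)]
    by (intro conjI gegenbauer_expansion[OF \<open>\<xi> \<in> D1\<close> \<alpha>(2) lam(3,4)]) (simp_all add: neglected_term_bound_def)
next
  case (2 x l v M)
  hence "- real M < l" "l < 1 + real M" "v + l > real M" by (auto simp: abs_less_iff)
  from second_remainder_sign[OF \<open>x > 0\<close> this] show ?case unfolding Let_def .
qed

end
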